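(* Let $\overline{\mathbb B}$ be the closed unit ball of $\mathbb R^d$, and put $$\mathfrak B=\bigcup_n\Big\{X\in(M_n)^d_{sa}:\sum_{j=1}^dX_j^2\le I\Big\},\qquad \mathfrak D=\bigcup_n\Big\{X\in(M_n)^d_{sa}:\Big\|\sum_{j=1}^dX_j\otimes\overline{X_j}\Big\|\le1\Big\}.$$ Let $\mathcal S\subseteq\bigcup_n(M_n)^d_{sa}$ be a matrix convex set. Then $$\mathcal S_1\subseteq\overline{\mathbb B}\ \Longrightarrow\ \mathcal S\subseteq\sqrt d\,\mathfrak B\subseteq\sqrt d\,\mathfrak D$$ and $$\overline{\mathbb B}\subseteq\mathcal S_1\ \Longrightarrow\ \mathfrak D\subseteq\mathfrak B^\bullet\subseteq\sqrt d\,\mathcal S.$$ Moreover, the constant $\sqrt d$ is the optimal constant in both implications (it cannot be replaced by a smaller constant valid for all $\mathcal S$).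
   Context: $(M_n)^d_{sa}$ is the set of $d$-tuples of self-adjoint $n\times n$ complex matrices, and $\overline X$ is the entrywise complex conjugate of the matrix $X$. A set $\mathcal S=\bigcup_n\mathcal S_n$ with $\mathcal S_n\subseteq(M_n)^d_{sa}$ is matrix convex if it is closed under direct sums and under unital completely positive maps (if $X\in\mathcal S_n$ and $\phi:M_n\to M_k$ is UCP then $(\phi(X_1),\dots,\phi(X_d))\in\mathcal S_k$); its first level $\mathcal S_1$ is a subset of $\mathbb R^d$. The polar dual is $\mathcal S^\bullet=\bigcup_n\mathcal S^\bullet_n$, $\mathcal S^\bullet_n=\{X\in(M_n)^d_{sa}:\sum_jA_j\otimes X_j\le I\text{ for all }A\in\mathcal S\}$. $c\,\mathcal S=\{cX:X\in\mathcal S\}$; inclusion means inclusion at every level $n$. *)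

theory Defs
  imports "HOL-Analysis.Analysis" "Jordan_Normal_Form.Schur_Decomposition"
begin

text \<open>
  A \<open>d\<close>-tuple of matrices is a function from a finite index type \<open>'d\<close> with \<open>d = CARD('d)\<close>, so
  \<open>d\<close> is arbitrary, positive and fixed. The size \<open>n\<close> varies inside the statements, hence the
  carrier-based matrices. As \<open>'d\<close> is nonempty, a tuple determines the common size of its entries,
  so a set of tuples is the disjoint union of its levels, and inclusion of sets is inclusion at
  every level. All sizes are positive.
\<close>

definition hermitian_mat :: "nat \<Rightarrow> complex mat \<Rightarrow> bool" where
  "hermitian_mat n A \<longleftrightarrow> A \<in> carrier_mat n n \<and> mat_adjoint A = A"

text \<open>The order on \<open>complex\<close> is that of \<open>Complex_Order\<close>: \<open>0 \<le> z\<close> means that \<open>z\<close> is real and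
  nonnegative.\<close>

definition psd_mat :: "nat \<Rightarrow> complex mat \<Rightarrow> bool" where
  "psd_mat n A \<longleftrightarrow> hermitian_mat n A \<and> (\<forall>v \<in> carrier_vec n. 0 \<le> (A *\<^sub>v v) \<bullet>c v)"

text \<open>The Loewner order; the library's \<open>\<le>\<close> on matrices is the entrywise order.\<close>

definition loewner_le :: "nat \<Rightarrow> complex mat \<Rightarrow> complex mat \<Rightarrow> bool" where
  "loewner_le n A B \<longleftrightarrow> A \<in> carrier_mat n n \<and> B \<in> carrier_mat n n \<and> psd_mat n (B - A)"

definition cvec_norm :: "complex vec \<Rightarrow> real" where
  "cvec_norm v = sqrt (Re (v \<bullet>c v))"

definition mat_op_norm :: "complex mat \<Rightarrow> real" where
  "mat_op_norm A = (SUP v \<in> {v \<in> carrier_vec (dim_col A). cvec_norm v \<le> 1}. cvec_norm (A *\<^sub>v v))"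

definition mat_conj :: "complex mat \<Rightarrow> complex mat" where
  "mat_conj A = map_mat cnj A"

definition kron :: "complex mat \<Rightarrow> complex mat \<Rightarrow> complex mat" where
  "kron A B = mat (dim_row A * dim_row B) (dim_col A * dim_col B)
     (\<lambda>(r, s). A $$ (r div dim_row B, s div dim_col B) * B $$ (r mod dim_row B, s mod dim_col B))"

definition direct_sum_mat :: "complex mat \<Rightarrow> complex mat \<Rightarrow> complex mat" where
  "direct_sum_mat A B = diag_block_mat [A, B]"

text \<open>The sum over \<open>'d\<close> of \<open>n \<times> n\<close> matrices; the type of matrices of all sizes has no zero,
  so \<open>sum\<close> does not apply to it directly.\<close>

definition tuple_sum :: "nat \<Rightarrow> ('d::finite \<Rightarrow> complex mat) \<Rightarrow> complex mat" where
  "tuple_sum n F = mat n n (\<lambda>(r, s). \<Sum>j\<in>UNIV. F j $$ (r, s))"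

definition sa_tuples :: "nat \<Rightarrow> ('d::finite \<Rightarrow> complex mat) set" where
  "sa_tuples n = {X. \<forall>j. hermitian_mat n (X j)}"

definition sa_universe :: "('d::finite \<Rightarrow> complex mat) set" where
  "sa_universe = (\<Union>n\<in>{1..}. sa_tuples n)"

text \<open>A matrix of size \<open>m n\<close> is viewed as an element of \<open>M\<^sub>m(M\<^sub>n)\<close>; the ampliation applies
  \<open>\<phi>\<close> to each of its \<open>n \<times> n\<close> blocks and is \<open>id \<otimes> \<phi>\<close> on \<open>M\<^sub>m \<otimes> M\<^sub>n\<close>.\<close>

definition mat_block :: "nat \<Rightarrow> complex mat \<Rightarrow> nat \<Rightarrow> nat \<Rightarrow> complex mat" where
  "mat_block n P i j = mat n n (\<lambda>(r, s). P $$ (i * n + r, j * n + s))"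

definition ampliation ::
  "nat \<Rightarrow> nat \<Rightarrow> nat \<Rightarrow> (complex mat \<Rightarrow> complex mat) \<Rightarrow> complex mat \<Rightarrow> complex mat" where
  "ampliation m n k \<phi> P = mat (m * k) (m * k)
     (\<lambda>(r, s). \<phi> (mat_block n P (r div k) (s div k)) $$ (r mod k, s mod k))"

definition linear_mat_map :: "nat \<Rightarrow> nat \<Rightarrow> (complex mat \<Rightarrow> complex mat) \<Rightarrow> bool" where
  "linear_mat_map n k \<phi> \<longleftrightarrow>
     (\<forall>A \<in> carrier_mat n n. \<phi> A \<in> carrier_mat k k) \<and>
     (\<forall>A \<in> carrier_mat n n. \<forall>B \<in> carrier_mat n n. \<phi> (A + B) = \<phi> A + \<phi> B) \<and>
     (\<forall>a. \<forall>A \<in> carrier_mat n n. \<phi> (a \<cdot>\<^sub>m A) = a \<cdot>\<^sub>m \<phi> A)"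

definition completely_positive :: "nat \<Rightarrow> nat \<Rightarrow> (complex mat \<Rightarrow> complex mat) \<Rightarrow> bool" where
  "completely_positive n k \<phi> \<longleftrightarrow> linear_mat_map n k \<phi> \<and>
     (\<forall>m\<ge>1. \<forall>P. psd_mat (m * n) P \<longrightarrow> psd_mat (m * k) (ampliation m n k \<phi> P))"

definition ucp :: "nat \<Rightarrow> nat \<Rightarrow> (complex mat \<Rightarrow> complex mat) \<Rightarrow> bool" where
  "ucp n k \<phi> \<longleftrightarrow> completely_positive n k \<phi> \<and> \<phi> (1\<^sub>m n) = 1\<^sub>m k"

definition matrix_convex :: "('d::finite \<Rightarrow> complex mat) set \<Rightarrow> bool" where
  "matrix_convex S \<longleftrightarrow>
     S \<subseteq> sa_universe \<and>
     (\<forall>X \<in> S. \<forall>Y \<in> S. (\<lambda>j. direct_sum_mat (X j) (Y j)) \<in> S) \<and>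
     (\<forall>n\<ge>1. \<forall>k\<ge>1. \<forall>X \<in> S \<inter> sa_tuples n. \<forall>\<phi>. ucp n k \<phi> \<longrightarrow> (\<lambda>j. \<phi> (X j)) \<in> S)"

definition first_level :: "('d::finite \<Rightarrow> complex mat) set \<Rightarrow> (real ^ 'd) set" where
  "first_level S = {x. (\<lambda>j. mat 1 1 (\<lambda>_. complex_of_real (vec_nth x j))) \<in> S}"

definition polar_dual ::
  "('d::finite \<Rightarrow> complex mat) set \<Rightarrow> ('d \<Rightarrow> complex mat) set" where
  "polar_dual S = (\<Union>n\<in>{1..}. {X \<in> sa_tuples n.
     \<forall>m\<ge>1. \<forall>A \<in> S \<inter> sa_tuples m.
       loewner_le (m * n) (tuple_sum (m * n) (\<lambda>j. kron (A j) (X j))) (1\<^sub>m (m * n))})"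

definition dilate ::
  "real \<Rightarrow> ('d::finite \<Rightarrow> complex mat) set \<Rightarrow> ('d \<Rightarrow> complex mat) set" where
  "dilate c S = (\<lambda>X j. complex_of_real c \<cdot>\<^sub>m X j) ` S"

definition ball_B :: "('d::finite \<Rightarrow> complex mat) set" where
  "ball_B = (\<Union>n\<in>{1..}. {X \<in> sa_tuples n.
     loewner_le n (tuple_sum n (\<lambda>j. X j * X j)) (1\<^sub>m n)})"

definition ball_D :: "('d::finite \<Rightarrow> complex mat) set" where
  "ball_D = (\<Union>n\<in>{1..}. {X \<in> sa_tuples n.
     mat_op_norm (tuple_sum (n * n) (\<lambda>j. kron (X j) (mat_conj (X j)))) \<le> 1})"

end

theory Submission
  imports Defs
begin

text \<open>
  A point of \<open>\<S>\<close> has its joint numerical range in \<open>\<S>\<^sub>1\<close>, because vector states are UCP maps. If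
  \<open>\<S>\<^sub>1\<close> lies in the ball, every \<open>X\<^sub>j\<close> is therefore a contraction and \<open>\<Sum> X\<^sub>j\<^sup>2 \<le> d\<close>. The inclusions
  \<open>\<BB> \<subseteq> \<DD> \<subseteq> \<BB>\<^sup>\<bullet>\<close> are the Cauchy-Schwarz inequality for rows and columns and Haagerup's inequality.

  For \<open>\<BB>\<^sup>\<bullet> \<subseteq> sqrt d \<S>\<close>, semidefinite duality writes \<open>X \<in> \<BB>\<^sup>\<bullet>\<close> as \<open>X\<^sub>j = sqrt d (P\<^sub>j\<^sup>+ - P\<^sub>j\<^sup>-)\<close> with
  positive \<open>P\<^sub>j\<^sup>\<plusminus>\<close> of total sum \<open>I\<close>; the dual certificate is excluded because a tuple of contractions
  divided by \<open>sqrt d\<close> is in \<open>\<BB>\<close>. Splitting the \<open>P\<^sub>j\<^sup>\<plusminus>\<close> into rank ones exhibits \<open>X / sqrt d\<close> as the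
  compression of a diagonal tuple with entries \<open>\<plusminus>e\<^sub>j\<close>. Only finitely many points are used, so \<open>\<S>\<close>
  need not be closed. Anticommuting self-adjoint unitaries show that \<open>sqrt d\<close> is optimal.
\<close>

section \<open>Matrices over a finite index set\<close>

text \<open>The constant has one source: \<open>d\<close> contractions stack to a column of norm at
  most \<open>sqrt d\<close>, with equality for anticommuting unitaries. This estimate bounds the
  set in the first implication, and in the second it puts the normalised dual certificate into the
  column ball. The obstacle is complex conjugation. At the maximally entangled vector, the form of
  the sum of A_j tensor X_j is the bilinear pairing, the sum of A_j(s,t) X_j(s,t), whereas
  separation and traces of squares use the sesquilinear one. Passing between them replaces a tuple
  by its entrywise conjugate, which respects Hermitian matrices, column contractions and Clifford
  relations. Duality is obtained from the residual at a nearest point of a cone. The minimum is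
  attained because positive matrices are controlled by their diagonals, and these by the diagonal of
  the total sum. Both extremal sets are polar duals, which are matrix convex whatever they are polar
  to. As the set with the tensor norm lies between the column ball and its polar, two examples
  settle all four optimality claims.\<close>

text \<open>Vectors and matrices are total functions of which only the values on an index set \<open>I\<close> matter.
  Thus \<open>I \<times> J\<close> indexes a tensor product and no re-indexing is needed before the final translation
  to the matrices of the statement.\<close>

definition inner_on :: "'a set \<Rightarrow> ('a \<Rightarrow> complex) \<Rightarrow> ('a \<Rightarrow> complex) \<Rightarrow> complex" where
  "inner_on I u v = (\<Sum>i\<in>I. u i * cnj (v i))"

definition normsq :: "'a set \<Rightarrow> ('a \<Rightarrow> complex) \<Rightarrow> real" where
  "normsq I v = (\<Sum>i\<in>I. (cmod (v i))\<^sup>2)"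

definition apply_on :: "'a set \<Rightarrow> ('a \<Rightarrow> 'a \<Rightarrow> complex) \<Rightarrow> ('a \<Rightarrow> complex) \<Rightarrow> 'a \<Rightarrow> complex" where
  "apply_on I A v = (\<lambda>i. \<Sum>k\<in>I. A i k * v k)"

abbreviation quad_form :: "'a set \<Rightarrow> ('a \<Rightarrow> 'a \<Rightarrow> complex) \<Rightarrow> ('a \<Rightarrow> complex) \<Rightarrow> complex" where
  "quad_form I A v \<equiv> inner_on I (apply_on I A v) v"

definition herm_on :: "'a set \<Rightarrow> ('a \<Rightarrow> 'a \<Rightarrow> complex) \<Rightarrow> bool" where
  "herm_on I A \<longleftrightarrow> (\<forall>i\<in>I. \<forall>k\<in>I. A i k = cnj (A k i))"

definition psd_on :: "'a set \<Rightarrow> ('a \<Rightarrow> 'a \<Rightarrow> complex) \<Rightarrow> bool" where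
  "psd_on I A \<longleftrightarrow> herm_on I A \<and> (\<forall>v. 0 \<le> Re (quad_form I A v))"

definition orthonormal_on :: "'a set \<Rightarrow> ('a \<Rightarrow> complex) set \<Rightarrow> bool" where
  "orthonormal_on I F \<longleftrightarrow> (\<forall>f\<in>F. \<forall>g\<in>F. inner_on I f g = (if f = g then 1 else 0))"

section \<open>Sesquilinear algebra, Hermitian forms and Bessel's inequality\<close>

lemma normsq_nonneg [simp]: "0 \<le> normsq I v"
  by (simp add: normsq_def sum_nonneg)

lemma inner_on_self: "inner_on I v v = of_real (normsq I v)"
  by (simp add: inner_on_def normsq_def complex_norm_square [symmetric])

lemma inner_on_add_left: "inner_on I (\<lambda>i. u i + v i) w = inner_on I u w + inner_on I v w"
  by (simp add: inner_on_def sum.distrib algebra_simps)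

lemma inner_on_add_right: "inner_on I w (\<lambda>i. u i + v i) = inner_on I w u + inner_on I w v"
  by (simp add: inner_on_def sum.distrib algebra_simps)

lemma inner_on_diff_left: "inner_on I (\<lambda>i. u i - v i) w = inner_on I u w - inner_on I v w"
  by (simp add: inner_on_def sum_subtractf algebra_simps)

lemma inner_on_diff_right: "inner_on I w (\<lambda>i. u i - v i) = inner_on I w u - inner_on I w v"
  by (simp add: inner_on_def sum_subtractf algebra_simps)

lemma inner_on_scale_left: "inner_on I (\<lambda>i. c * u i) w = c * inner_on I u w"
  by (simp add: inner_on_def sum_distrib_left algebra_simps)

lemma inner_on_scale_right: "inner_on I w (\<lambda>i. c * u i) = cnj c * inner_on I w u"
  by (simp add: inner_on_def sum_distrib_left algebra_simps)

lemma inner_on_sum_left: "inner_on I (\<lambda>i. \<Sum>k\<in>K. u k i) w = (\<Sum>k\<in>K. inner_on I (u k) w)"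
  by (simp add: inner_on_def sum_distrib_right) (rule sum.swap)

lemma inner_on_cnj: "cnj (inner_on I u v) = inner_on I v u"
  by (simp add: inner_on_def mult.commute)

lemma inner_on_sum_right: "inner_on I w (\<lambda>i. \<Sum>k\<in>K. u k i) = (\<Sum>k\<in>K. inner_on I w (u k))"
  by (simp add: inner_on_def sum_distrib_left) (rule sum.swap)

lemma inner_on_cong:
  assumes "\<And>i. i \<in> I \<Longrightarrow> u i = u' i" "\<And>i. i \<in> I \<Longrightarrow> v i = v' i"
  shows "inner_on I u v = inner_on I u' v'"
  using assms by (simp add: inner_on_def)

lemma normsq_cong: "(\<And>i. i \<in> I \<Longrightarrow> u i = v i) \<Longrightarrow> normsq I u = normsq I v"
  by (simp add: normsq_def)

lemma normsq_scale: "normsq I (\<lambda>i. c * u i) = (cmod c)\<^sup>2 * normsq I u"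
  by (simp add: normsq_def sum_distrib_left norm_mult power_mult_distrib)

lemma normsq_cnj: "normsq I (\<lambda>i. cnj (u i)) = normsq I u"
  by (simp add: normsq_def)

lemma normsq_add: "normsq I (\<lambda>i. u i + v i) = normsq I u + normsq I v + 2 * Re (inner_on I u v)"
proof -
  have "(cmod (a + b))\<^sup>2 = (cmod a)\<^sup>2 + (cmod b)\<^sup>2 + 2 * Re (a * cnj b)" for a b
    unfolding cmod_power2 by (simp add: power2_eq_square algebra_simps)
  then show ?thesis
    by (simp add: normsq_def inner_on_def sum.distrib sum_distrib_left)
qed

lemma normsq_diff: "normsq I (\<lambda>i. u i - v i) = normsq I u + normsq I v - 2 * Re (inner_on I u v)"
  using normsq_add [of I u "\<lambda>i. - 1 * v i"]
  by (simp add: normsq_scale inner_on_def sum_negf) (simp add: normsq_def)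

text \<open>Cauchy-Schwarz in arithmetic-mean form, which needs no square roots. With one argument
  equal to \<open>T u\<close> it converts between bounds on the form of an operator \<open>T\<close>
  and bounds on its norm.\<close>

lemma Re_inner_on_le: "Re (inner_on I u v) \<le> (normsq I u + normsq I v) / 2"
  using normsq_diff [of I u v] normsq_nonneg [of I "\<lambda>i. u i - v i"] by simp

lemma normsq_eq_0_iff: "finite I \<Longrightarrow> normsq I v = 0 \<longleftrightarrow> (\<forall>i\<in>I. v i = 0)"
  by (simp add: normsq_def sum_nonneg_eq_0_iff)

lemma apply_on_add: "apply_on I A (\<lambda>i. u i + v i) = (\<lambda>i. apply_on I A u i + apply_on I A v i)"
  by (simp add: apply_on_def sum.distrib algebra_simps)

lemma apply_on_diff: "apply_on I A (\<lambda>i. u i - v i) = (\<lambda>i. apply_on I A u i - apply_on I A v i)"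
  by (simp add: apply_on_def sum_subtractf algebra_simps)

lemma apply_on_scale: "apply_on I A (\<lambda>i. c * u i) = (\<lambda>i. c * apply_on I A u i)"
  by (simp add: apply_on_def sum_distrib_left algebra_simps)

lemma herm_on_inner:
  assumes "herm_on I A"
  shows "inner_on I (apply_on I A u) v = inner_on I u (apply_on I A v)"
proof -
  have "inner_on I (apply_on I A u) v = (\<Sum>i\<in>I. \<Sum>k\<in>I. A i k * u k * cnj (v i))"
    by (simp add: inner_on_def apply_on_def sum_distrib_right)
  also have "\<dots> = (\<Sum>k\<in>I. \<Sum>i\<in>I. A i k * u k * cnj (v i))"
    by (rule sum.swap)
  also have "\<dots> = (\<Sum>k\<in>I. \<Sum>i\<in>I. u k * cnj (A k i * v i))"
  proof (intro sum.cong refl)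
    fix k i assume "k \<in> I" "i \<in> I"
    then have *: "A i k = cnj (A k i)" using assms unfolding herm_on_def by blast
    show "A i k * u k * cnj (v i) = u k * cnj (A k i * v i)" by (subst *) simp
  qed
  also have "\<dots> = inner_on I u (apply_on I A v)"
    by (simp add: inner_on_def apply_on_def sum_distrib_left)
  finally show ?thesis .
qed

lemma herm_on_Im_inner:
  assumes "herm_on I A"
  shows "Im (quad_form I A v) = 0"
proof -
  have "cnj (quad_form I A v) = quad_form I A v"
    by (simp add: inner_on_cnj herm_on_inner [OF assms])
  then show ?thesis by (simp add: complex_eq_iff)
qed

text \<open>Polarise \<open>\<langle>A (c v), w\<rangle>\<close> at \<open>w = A v\<close>; the factor \<open>c\<close> balances the two lengths.\<close>

lemma herm_on_normsq_apply_le: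
  assumes A: "herm_on I A" and c: "0 \<le> c"
    and bound: "\<And>v. \<bar>Re (quad_form I A v)\<bar> \<le> c * normsq I v"
  shows "normsq I (apply_on I A v) \<le> c\<^sup>2 * normsq I v"
proof -
  let ?q = "\<lambda>v. Re (quad_form I A v)"
  let ?w = "apply_on I A v"
  define u where "u = (\<lambda>i. of_real c * v i)"
  have sym: "Re (inner_on I (apply_on I A ?w) u) = Re (inner_on I (apply_on I A u) ?w)"
    by (subst herm_on_inner [OF A], subst inner_on_cnj [symmetric]) simp
  have "?q (\<lambda>i. u i + ?w i) - ?q (\<lambda>i. u i - ?w i) = 4 * Re (inner_on I (apply_on I A u) ?w)"
    using sym
    by (simp add: apply_on_add apply_on_diff inner_on_add_left inner_on_add_right
        inner_on_diff_left inner_on_diff_right)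
  also have "Re (inner_on I (apply_on I A u) ?w) = c * normsq I ?w"
    by (simp add: u_def apply_on_scale inner_on_scale_left inner_on_self)
  finally have "4 * (c * normsq I ?w)
      \<le> c * normsq I (\<lambda>i. u i + ?w i) + c * normsq I (\<lambda>i. u i - ?w i)"
    using bound [of "\<lambda>i. u i + ?w i"] bound [of "\<lambda>i. u i - ?w i"] by linarith
  also have "\<dots> = 2 * c * (c\<^sup>2 * normsq I v + normsq I ?w)"
    unfolding normsq_add normsq_diff by (simp add: u_def normsq_scale algebra_simps)
  finally have *: "c * normsq I ?w \<le> c * (c\<^sup>2 * normsq I v)"
    by (simp add: algebra_simps)
  show ?thesis
  proof (cases "c = 0")
    case True
    \<comment> \<open>For \<open>c = 0\<close> the vector \<open>u\<close> is zero and
      \<open>*\<close> says nothing. The form then vanishes identically, so the unscaled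
      \<open>v\<close> is polarised instead.\<close>
    have "4 * normsq I ?w = ?q (\<lambda>i. v i + ?w i) - ?q (\<lambda>i. v i - ?w i)"
      using herm_on_inner [OF A, of ?w v]
      by (simp add: apply_on_add apply_on_diff inner_on_add_left inner_on_add_right
        inner_on_diff_left inner_on_diff_right inner_on_self)
    then show ?thesis
      using bound [of "\<lambda>i. v i + ?w i"] bound [of "\<lambda>i. v i - ?w i"]
      unfolding True by (simp only: mult_zero_left power2_eq_square)
  next
    case False
    then show ?thesis using * c by simp
  qed
qed

lemma bessel:
  assumes "finite K"
    and orth: "\<And>k l. k \<in> K \<Longrightarrow> l \<in> K \<Longrightarrow> k \<noteq> l \<Longrightarrow> inner_on I (g k) (g l) = 0"
    and le1: "\<And>k. k \<in> K \<Longrightarrow> normsq I (g k) \<le> 1"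
  shows "(\<Sum>k\<in>K. (cmod (inner_on I x (g k)))\<^sup>2) \<le> normsq I x"
proof -
  let ?c = "\<lambda>k. inner_on I x (g k)"
  let ?p = "\<lambda>i. \<Sum>k\<in>K. ?c k * g k i"
  have px: "inner_on I x ?p = of_real (\<Sum>k\<in>K. (cmod (?c k))\<^sup>2)"
    unfolding inner_on_sum_right inner_on_scale_right
    by (simp add: complex_norm_square mult.commute del: of_real_power)
  have "inner_on I ?p ?p = (\<Sum>k\<in>K. \<Sum>l\<in>K. ?c k * (cnj (?c l) * inner_on I (g k) (g l)))"
    unfolding inner_on_sum_left
    unfolding inner_on_sum_right inner_on_scale_left inner_on_scale_right sum_distrib_left ..
  also have "\<dots> = (\<Sum>k\<in>K. of_real ((cmod (?c k))\<^sup>2 * normsq I (g k)))"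
  proof (rule sum.cong [OF refl])
    fix k assume k: "k \<in> K"
    have "(\<Sum>l\<in>K. ?c k * (cnj (?c l) * inner_on I (g k) (g l)))
        = (\<Sum>l\<in>K. if l = k then ?c k * (cnj (?c k) * inner_on I (g k) (g k)) else 0)"
      using orth k by (intro sum.cong) auto
    also have "\<dots> = ?c k * (cnj (?c k) * inner_on I (g k) (g k))"
      using \<open>finite K\<close> k by simp
    finally show "(\<Sum>l\<in>K. ?c k * (cnj (?c l) * inner_on I (g k) (g l)))
        = of_real ((cmod (?c k))\<^sup>2 * normsq I (g k))"
      by (simp only: inner_on_self complex_norm_square of_real_mult mult.assoc)
  qed
  finally have "normsq I ?p = (\<Sum>k\<in>K. (cmod (?c k))\<^sup>2 * normsq I (g k))"
    by (simp only: inner_on_self of_real_sum [symmetric] of_real_eq_iff)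
  also have "\<dots> \<le> (\<Sum>k\<in>K. (cmod (?c k))\<^sup>2)"
    by (intro sum_mono mult_left_le) (auto simp: le1)
  finally show ?thesis
    using normsq_diff [of I x ?p] normsq_nonneg [of I "\<lambda>i. x i - ?p i"]
    unfolding px Re_complex_of_real by linarith
qed

section \<open>The spectral theorem and best approximation from a cone\<close>

text \<open>The first-order condition at a one-sided minimum: divide by \<open>t\<close> and let
  \<open>t\<close> tend to 0. The range stops at 1 because one application scales a point of a cone
  by \<open>1 - t\<close>.\<close>

lemma nonneg_of_quadratic_nonneg:
  fixes a b :: real
  assumes "\<And>t. 0 < t \<Longrightarrow> t \<le> 1 \<Longrightarrow> 0 \<le> t * a + t\<^sup>2 * b"
  shows "0 \<le> a"
proof (rule tendsto_lowerbound)
  show "((\<lambda>t. a + t * b) \<longlongrightarrow> a) (at_right 0)"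
    by (auto intro!: tendsto_eq_intros)
  have "eventually (\<lambda>t. t < 1) (at_right (0::real))"
    by (rule order_tendstoD) (auto intro!: tendsto_eq_intros)
  then show "eventually (\<lambda>t. 0 \<le> a + t * b) (at_right 0)"
    using eventually_at_right_less [of "0::real"]
  proof eventually_elim
    case (elim t)
    have "0 \<le> t * (a + t * b)"
      using assms [of t] elim by (simp add: power2_eq_square algebra_simps)
    then show ?case using elim by (simp add: zero_le_mult_iff)
  qed
qed auto

text \<open>Tychonoff's theorem, so the index type may be infinite. The price is that the bound
  concerns every index; subspaces and cones to be made compact therefore consist of functions
  vanishing off the index set.\<close>

lemma compact_cmod_box: "compact {P :: 'a \<Rightarrow> complex. \<forall>i. cmod (P i) \<le> M}"
proof -
  have "compactin (product_topology (\<lambda>_::'a. euclidean) UNIV) (PiE UNIV (\<lambda>_. cball (0::complex) M))"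
    by (simp add: compactin_PiE)
  then show ?thesis
    by (simp add: euclidean_product_topology PiE_UNIV_domain Pi_def)
qed

lemma continuous_on_inner_left [continuous_intros]:
  assumes "\<And>i. i \<in> I \<Longrightarrow> continuous_on S (\<lambda>x. u x i)" "\<And>i. i \<in> I \<Longrightarrow> continuous_on S (\<lambda>x. v x i)"
  shows "continuous_on S (\<lambda>x. inner_on I (u x) (v x))"
  unfolding inner_on_def using assms by (intro continuous_intros) auto

lemma continuous_on_normsq [continuous_intros]:
  assumes "\<And>i. i \<in> I \<Longrightarrow> continuous_on S (\<lambda>x. u x i)"
  shows "continuous_on S (\<lambda>x. normsq I (u x))"
  unfolding normsq_def using assms by (intro continuous_intros) auto

lemma continuous_on_apply [continuous_intros]:
  assumes "\<And>i. i \<in> I \<Longrightarrow> continuous_on S (\<lambda>x. u x i)"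
  shows "continuous_on S (\<lambda>x. apply_on I A (u x) i)"
  unfolding apply_on_def using assms by (intro continuous_intros) auto

lemma cmod_power2_le_normsq:
  assumes "finite I" "i \<in> I"
  shows "(cmod (v i))\<^sup>2 \<le> normsq I v"
  using member_le_sum [of i I "\<lambda>i. (cmod (v i))\<^sup>2"] assms by (simp add: normsq_def)

text \<open>Maximise the quadratic form over the unit sphere of the invariant subspace.\<close>

lemma exists_eigenvector:
  fixes W :: "('a \<Rightarrow> complex) set"
  assumes "finite I" and A: "herm_on I A" and "closed W"
    and add: "\<And>u v. u \<in> W \<Longrightarrow> v \<in> W \<Longrightarrow> (\<lambda>i. u i + v i) \<in> W"
    and scale: "\<And>c u. u \<in> W \<Longrightarrow> (\<lambda>i. c * u i) \<in> W"
    and supp: "\<And>u i. u \<in> W \<Longrightarrow> i \<notin> I \<Longrightarrow> u i = 0"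
    and inv: "\<And>u. u \<in> W \<Longrightarrow> (\<lambda>i. if i \<in> I then apply_on I A u i else 0) \<in> W"
    and ne: "w \<in> W" "normsq I w \<noteq> 0"
  obtains v c where "v \<in> W" "normsq I v = 1" "\<And>i. i \<in> I \<Longrightarrow> apply_on I A v i = of_real c * v i"
proof -
  let ?q = "\<lambda>v. Re (quad_form I A v)"
  define K where "K = W \<inter> {v. normsq I v = 1}"
  have normalise: "(\<lambda>i. of_real (1 / sqrt (normsq I u)) * u i) \<in> K"
    if "u \<in> W" "normsq I u \<noteq> 0" for u
  proof -
    have "0 < normsq I u" using that(2) normsq_nonneg [of I u] by linarith
    then show ?thesis
      unfolding K_def using that(1) scale
      by (auto simp: normsq_scale norm_divide power_divide simp del: of_real_divide)
  qed
  have "closed K"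
    unfolding K_def using \<open>closed W\<close>
    by (intro closed_Int closed_Collect_eq continuous_intros) auto
  moreover have "K \<subseteq> {v. \<forall>i. cmod (v i) \<le> 1}"
  proof clarify
    fix v i assume v: "v \<in> K"
    show "cmod (v i) \<le> 1"
    proof (cases "i \<in> I")
      case True
      then have "(cmod (v i))\<^sup>2 \<le> 1\<^sup>2"
        using cmod_power2_le_normsq [OF \<open>finite I\<close>, of i v] v by (simp add: K_def)
      then show ?thesis by (rule power2_le_imp_le) simp
    next
      case False
      then have "v i = 0" using supp [of v i] v by (simp add: K_def)
      then show ?thesis by simp
    qed
  qed
  ultimately have "compact K"
    using compact_Int_closed [OF compact_cmod_box] by (metis inf.absorb2)
  moreover have "K \<noteq> {}" using normalise [OF ne] by auto
  moreover have "continuous_on K ?q"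
    by (intro continuous_intros continuous_on_subset [OF continuous_on_product_coordinates]) auto
  ultimately obtain v where v: "v \<in> K" and max: "\<And>u. u \<in> K \<Longrightarrow> ?q u \<le> ?q v"
    using continuous_attains_sup [of K ?q] by auto
  define c where "c = ?q v"
  have vW: "v \<in> W" and nv: "normsq I v = 1" using v by (auto simp: K_def)
  have le: "?q u \<le> c * normsq I u" if "u \<in> W" for u
  proof (cases "normsq I u = 0")
    case True
    then have "?q u = 0"
      using \<open>finite I\<close> by (simp add: normsq_eq_0_iff inner_on_def)
    then show ?thesis using True by simp
  next
    case False
    then have pos: "0 < normsq I u" using normsq_nonneg [of I u] by linarith
    let ?s = "1 / sqrt (normsq I u)"
    have "?q (\<lambda>i. of_real ?s * u i) \<le> c"
      using max [OF normalise [OF that False]] by (simp add: c_def)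
    also have "?q (\<lambda>i. of_real ?s * u i) = ?s * (?s * ?q u)"
      unfolding apply_on_scale inner_on_scale_left inner_on_scale_right by simp
    also have "\<dots> = ?q u / normsq I u"
      using pos by (simp add: field_simps)
    finally show ?thesis using pos by (simp add: field_simps)
  qed
  \<comment> \<open>The defect in the eigenvalue equation. Moving \<open>v\<close> by
    \<open>t\<close> times \<open>r\<close> changes c|u|^2 - q(u) to first order by -2 t |r|^2;
    since \<open>v\<close> is a maximiser this difference stays nonnegative, which forces
    \<open>r\<close> to vanish on \<open>I\<close>.\<close>
  define r where "r = (\<lambda>i. (if i \<in> I then apply_on I A v i else 0) + - of_real c * v i)"
  have rW: "r \<in> W" unfolding r_def by (intro add scale inv vW)
  have r_eq: "r i = apply_on I A v i - of_real c * v i" if "i \<in> I" for i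
    using that by (simp add: r_def)
  have "inner_on I (apply_on I A v) r - of_real c * inner_on I v r
      = inner_on I (\<lambda>i. apply_on I A v i - of_real c * v i) r"
    by (simp add: inner_on_diff_left inner_on_scale_left)
  also have "\<dots> = inner_on I r r" by (rule inner_on_cong) (auto simp: r_eq)
  finally have nr: "Re (inner_on I (apply_on I A v) r) - c * Re (inner_on I v r) = normsq I r"
    by (simp add: inner_on_self complex_eq_iff)
  have "0 \<le> - 2 * normsq I r"
  proof (rule nonneg_of_quadratic_nonneg)
    fix t :: real assume "0 < t"
    let ?u = "\<lambda>i. v i + of_real t * r i"
    have "?q ?u \<le> c * normsq I ?u" by (intro le add scale vW rW)
    moreover have "Re (inner_on I (apply_on I A r) v) = Re (inner_on I (apply_on I A v) r)"
      by (subst herm_on_inner [OF A], subst inner_on_cnj [symmetric]) simp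
    then have "?q ?u = c + 2 * t * Re (inner_on I (apply_on I A v) r) + t\<^sup>2 * ?q r"
      unfolding apply_on_add apply_on_scale inner_on_add_left inner_on_add_right
        inner_on_scale_left inner_on_scale_right c_def
      by (simp add: power2_eq_square algebra_simps)
    moreover have "normsq I ?u = 1 + t\<^sup>2 * normsq I r + 2 * t * Re (inner_on I v r)"
      unfolding normsq_add normsq_scale inner_on_scale_right by (simp add: nv)
    ultimately show "0 \<le> t * (- 2 * normsq I r) + t\<^sup>2 * (c * normsq I r - ?q r)"
      by (simp add: nr [symmetric] algebra_simps)
  qed
  then have "normsq I r = 0" using normsq_nonneg [of I r] by linarith
  then have "apply_on I A v i = of_real c * v i" if "i \<in> I" for i
    using r_eq [OF that] that \<open>finite I\<close> by (simp add: normsq_eq_0_iff)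
  with vW nv show thesis by (rule that)
qed

text \<open>Functional calculus over a fixed system of eigenvectors \<open>F\<close>. For
  orthonormal \<open>F\<close>, matrix products multiply the coefficients pointwise
  (\<open>spec_sum_mult\<close>), which yields square roots and their inverses.\<close>

definition spec_sum :: "('a \<Rightarrow> complex) set \<Rightarrow> (('a \<Rightarrow> complex) \<Rightarrow> real) \<Rightarrow> 'a \<Rightarrow> 'a \<Rightarrow> complex" where
  "spec_sum F c r s = (\<Sum>f\<in>F. of_real (c f) * (f r * cnj (f s)))"

lemma spec_sum_cnj: "cnj (spec_sum F c r s) = spec_sum F c s r"
  by (simp add: spec_sum_def mult.commute)

lemma spec_sum_mult:
  assumes "finite F" "orthonormal_on I F"
  shows "(\<Sum>t\<in>I. spec_sum F c r t * spec_sum F d t s) = spec_sum F (\<lambda>f. c f * d f) r s"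
proof -
  have "(\<Sum>t\<in>I. spec_sum F c r t * spec_sum F d t s)
      = (\<Sum>t\<in>I. \<Sum>f\<in>F. \<Sum>g\<in>F. of_real (c f * d g) * (f r * cnj (g s)) * (g t * cnj (f t)))"
    unfolding spec_sum_def sum_product by (intro sum.cong refl) (simp add: algebra_simps)
  also have "\<dots> = (\<Sum>f\<in>F. \<Sum>g\<in>F. \<Sum>t\<in>I. of_real (c f * d g) * (f r * cnj (g s)) * (g t * cnj (f t)))"
    by (subst sum.swap, intro sum.cong refl, rule sum.swap)
  also have "\<dots> = (\<Sum>f\<in>F. \<Sum>g\<in>F. of_real (c f * d g) * (f r * cnj (g s)) * inner_on I g f)"
    by (simp only: inner_on_def sum_distrib_left)
  also have "\<dots> = (\<Sum>f\<in>F. \<Sum>g\<in>F. if g = f then of_real (c f * d f) * (f r * cnj (f s)) else 0)"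
    using assms(2) unfolding orthonormal_on_def by (intro sum.cong refl) auto
  finally show ?thesis using \<open>finite F\<close> by (simp add: spec_sum_def)
qed

text \<open>Count the squared moduli |f(i)|^2 twice: each \<open>f\<close> contributes 1, and each
  index at most 1, by Bessel's inequality for the basis vector at \<open>i\<close>. The bound makes
  an orthonormal set of eigenvectors of greatest size exist.\<close>

lemma orthonormal_on_card_le:
  assumes "finite I" "finite F" "orthonormal_on I F"
  shows "card F \<le> card I"
proof -
  have 1: "normsq I f = 1" if "f \<in> F" for f
  proof -
    have "inner_on I f f = 1" using assms(3) that by (simp add: orthonormal_on_def)
    then show ?thesis by (simp add: inner_on_self)
  qed
  have *: "(\<Sum>f\<in>F. (cmod (f i))\<^sup>2) \<le> 1" if "i \<in> I" for i
  proof -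
    let ?d = "\<lambda>k. if k = i then 1 else 0 :: complex"
    have "(\<Sum>f\<in>F. (cmod (inner_on I ?d f))\<^sup>2) \<le> normsq I ?d"
      using assms 1 by (intro bessel) (auto simp: orthonormal_on_def)
    moreover have "inner_on I ?d f = cnj (f i)" for f
      using that \<open>finite I\<close> by (simp add: inner_on_def if_distrib [of "\<lambda>x. x * _"] cong: if_cong)
    moreover have "normsq I ?d = 1"
      using that \<open>finite I\<close> by (simp add: normsq_def if_distrib [of "\<lambda>x. (cmod x)\<^sup>2"] cong: if_cong)
    ultimately show ?thesis by simp
  qed
  have "real (card F) = (\<Sum>f\<in>F. normsq I f)" using 1 by simp
  also have "\<dots> = (\<Sum>i\<in>I. \<Sum>f\<in>F. (cmod (f i))\<^sup>2)" unfolding normsq_def by (rule sum.swap)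
  also have "\<dots> \<le> (\<Sum>i\<in>I. 1)" by (intro sum_mono *)
  finally show ?thesis by simp
qed

text \<open>Take an orthonormal set of eigenvectors of greatest size. Its orthogonal complement
  \<open>W\<close> is invariant under \<open>A\<close>, so a vector of \<open>W\<close> that is
  nonzero on \<open>I\<close> would yield one more eigenvector.\<close>

theorem spectral_theorem:
  fixes A :: "'a \<Rightarrow> 'a \<Rightarrow> complex"
  assumes "finite I" and A: "herm_on I A"
  obtains F c where "finite F" "orthonormal_on I F"
    "\<And>r s. r \<in> I \<Longrightarrow> s \<in> I \<Longrightarrow> spec_sum F (\<lambda>_. 1) r s = (if r = s then 1 else 0)"
    "\<And>f i. f \<in> F \<Longrightarrow> i \<in> I \<Longrightarrow> apply_on I A f i = of_real (c f) * f i"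
    "\<And>r s. r \<in> I \<Longrightarrow> s \<in> I \<Longrightarrow> A r s = spec_sum F c r s"
proof -
  let ?P = "\<lambda>F. finite F \<and> orthonormal_on I F \<and>
    (\<forall>f\<in>F. (\<forall>i. i \<notin> I \<longrightarrow> f i = 0) \<and> (\<exists>c::real. \<forall>i\<in>I. apply_on I A f i = of_real c * f i))"
  have "?P {}" by (simp add: orthonormal_on_def)
  moreover have "\<forall>F. ?P F \<longrightarrow> card F < Suc (card I)"
    using orthonormal_on_card_le [OF \<open>finite I\<close>] le_imp_less_Suc by blast
  ultimately have "\<exists>F. ?P F \<and> (\<forall>G. ?P G \<longrightarrow> card G \<le> card F)"
    by (rule ex_has_greatest_nat [where P = ?P and f = card and b = "Suc (card I)"])
  then obtain F where F: "?P F" and max: "\<And>G. ?P G \<Longrightarrow> card G \<le> card F"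
    by (elim exE conjE) blast
  then have "finite F" and orth: "orthonormal_on I F" by auto
  from F obtain c where
    c: "\<And>f i. f \<in> F \<Longrightarrow> i \<in> I \<Longrightarrow> apply_on I A f i = of_real (c f :: real) * f i" by metis
  define W where "W = {v. (\<forall>i. i \<notin> I \<longrightarrow> v i = 0) \<and> (\<forall>f\<in>F. inner_on I v f = 0)}"
  have W0: "normsq I w = 0" if w: "w \<in> W" for w
  proof (rule ccontr)
    assume nz: "normsq I w \<noteq> 0"
    have cl: "closed W"
      unfolding W_def Ball_def
      by (intro closed_Collect_conj closed_Collect_all closed_Collect_imp closed_Collect_eq
          continuous_intros) auto
    have inv: "(\<lambda>i. if i \<in> I then apply_on I A u i else 0) \<in> W" if u: "u \<in> W" for u
    proof -
      have "inner_on I (\<lambda>i. if i \<in> I then apply_on I A u i else 0) f = 0" if f: "f \<in> F" for f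
      proof -
        have "inner_on I (\<lambda>i. if i \<in> I then apply_on I A u i else 0) f
            = inner_on I (apply_on I A u) f"
          by (rule inner_on_cong) auto
        also have "\<dots> = inner_on I u (apply_on I A f)" by (rule herm_on_inner [OF A])
        also have "\<dots> = inner_on I u (\<lambda>i. of_real (c f) * f i)"
          by (rule inner_on_cong) (auto simp: c f)
        also have "\<dots> = 0" using u f by (simp add: inner_on_scale_right W_def)
        finally show ?thesis .
      qed
      then show ?thesis by (simp add: W_def)
    qed
    obtain v d where v: "v \<in> W" "normsq I v = 1"
      and d: "\<And>i. i \<in> I \<Longrightarrow> apply_on I A v i = of_real (d::real) * v i"
      by (rule exists_eigenvector [OF \<open>finite I\<close> A cl _ _ _ inv w nz])
        (auto simp: W_def inner_on_add_left inner_on_scale_left)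
    have vf: "inner_on I v f = 0" "inner_on I f v = 0" if "f \<in> F" for f
      using v(1) that inner_on_cnj [of I v f] by (auto simp: W_def)
    have vv: "inner_on I v v = 1" using v(2) by (simp add: inner_on_self)
    have "v \<notin> F" using vf vv by force
    moreover have "?P (insert v F)"
      using F vf vv v(1) d by (auto simp: orthonormal_on_def W_def)
    then have "card (insert v F) \<le> card F" by (rule max)
    ultimately show False using \<open>finite F\<close> by simp
  qed
  have complete: "spec_sum F (\<lambda>_. 1) r s = (if r = s then 1 else 0)" if "r \<in> I" "s \<in> I" for r s
  proof -
    \<comment> \<open>The component of the basis vector at \<open>s\<close> orthogonal to
      \<open>F\<close>. It lies in \<open>W\<close>, hence vanishes, and its entry at
      \<open>r\<close> is the completeness relation.\<close>
    define w where "w = (\<lambda>i. (if i = s then 1 else 0) - (\<Sum>f\<in>F. cnj (f s) * f i))"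
    have "inner_on I w g = 0" if g: "g \<in> F" for g
    proof -
      have "inner_on I (\<lambda>i. if i = s then 1 else 0) g = cnj (g s)"
        using \<open>s \<in> I\<close> \<open>finite I\<close> by (simp add: inner_on_def if_distrib [of "\<lambda>x. x * _"] cong: if_cong)
      moreover have "inner_on I (\<lambda>i. \<Sum>f\<in>F. cnj (f s) * f i) g
          = (\<Sum>f\<in>F. if f = g then cnj (g s) else 0)"
        using orth g unfolding inner_on_sum_left inner_on_scale_left orthonormal_on_def
        by (intro sum.cong) auto
      ultimately show ?thesis using g \<open>finite F\<close> by (simp add: w_def inner_on_diff_left)
    qed
    then have "w \<in> W" using F that(2) by (auto simp: W_def w_def)
    then have "w r = 0" using W0 \<open>finite I\<close> that(1) by (simp add: normsq_eq_0_iff)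
    then show ?thesis by (simp add: w_def spec_sum_def mult.commute)
  qed
  have "A r s = spec_sum F c r s" if "r \<in> I" "s \<in> I" for r s
  proof -
    have "A r s = (\<Sum>k\<in>I. A r k * spec_sum F (\<lambda>_. 1) k s)"
      using that \<open>finite I\<close> by (simp add: complete if_distrib [of "\<lambda>x. _ * x"] cong: if_cong)
    also have "\<dots> = (\<Sum>f\<in>F. apply_on I A f r * cnj (f s))"
      unfolding spec_sum_def apply_on_def sum_distrib_left sum_distrib_right
      by (subst sum.swap) (simp add: algebra_simps)
    finally show ?thesis using that by (simp add: c spec_sum_def mult.assoc)
  qed
  with \<open>finite F\<close> orth complete c show thesis by (rule that)
qed

lemma eigenvalue_eq:
  assumes "orthonormal_on I F" "f \<in> F" "\<And>i. i \<in> I \<Longrightarrow> apply_on I A f i = of_real (c f) * f i"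
  shows "Re (quad_form I A f) = c f"
proof -
  have "quad_form I A f = inner_on I (\<lambda>i. of_real (c f) * f i) f"
    using assms(3) by (intro inner_on_cong) auto
  then show ?thesis
    using assms(1,2) by (simp add: inner_on_scale_left orthonormal_on_def)
qed

lemma psd_on_sqrt:
  assumes "finite I" and A: "psd_on I A"
  obtains R where "\<And>r s. cnj (R r s) = R s r"
    "\<And>r s. r \<in> I \<Longrightarrow> s \<in> I \<Longrightarrow> A r s = (\<Sum>t\<in>I. R r t * R t s)"
proof -
  have "herm_on I A" using A by (simp add: psd_on_def)
  from spectral_theorem [OF \<open>finite I\<close> this] obtain F c where F: "finite F" "orthonormal_on I F"
    and ev: "\<And>f i. f \<in> F \<Longrightarrow> i \<in> I \<Longrightarrow> apply_on I A f i = of_real (c f) * f i"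
    and A_eq: "\<And>r s. r \<in> I \<Longrightarrow> s \<in> I \<Longrightarrow> A r s = spec_sum F c r s" by metis
  have "0 \<le> c f" if "f \<in> F" for f
    using eigenvalue_eq [where F = F and A = A and c = c, OF F(2) that ev] A that
    by (metis psd_on_def)
  then have "spec_sum F c r s = spec_sum F (\<lambda>f. sqrt (c f) * sqrt (c f)) r s" for r s
    by (simp add: spec_sum_def)
  then show thesis
    using that [of "spec_sum F (\<lambda>f. sqrt (c f))"] A_eq spec_sum_mult [OF F] spec_sum_cnj by metis
qed

text \<open>The square root of \<open>A\<close> and the inverse of that root share the eigenvectors
  of \<open>A\<close>, with coefficients \<open>sqrt (c f)\<close> and
  \<open>1 / sqrt (c f)\<close>. Strict positivity of the form makes every \<open>c f\<close>
  positive.\<close>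

lemma pos_def_sqrt_inverse:
  assumes "finite I" and A: "herm_on I A"
    and pos: "\<And>v. normsq I v \<noteq> 0 \<Longrightarrow> 0 < Re (quad_form I A v)"
  obtains R S where "\<And>r s. cnj (R r s) = R s r" "\<And>r s. cnj (S r s) = S s r"
    "\<And>r s. r \<in> I \<Longrightarrow> s \<in> I \<Longrightarrow> A r s = (\<Sum>t\<in>I. R r t * R t s)"
    "\<And>r s. r \<in> I \<Longrightarrow> s \<in> I \<Longrightarrow> (\<Sum>t\<in>I. R r t * S t s) = (if r = s then 1 else 0)"
    "\<And>r s. r \<in> I \<Longrightarrow> s \<in> I \<Longrightarrow> (\<Sum>t\<in>I. S r t * R t s) = (if r = s then 1 else 0)"
proof -
  from spectral_theorem [OF \<open>finite I\<close> A] obtain F c where F: "finite F" "orthonormal_on I F"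
    and one: "\<And>r s. r \<in> I \<Longrightarrow> s \<in> I \<Longrightarrow> spec_sum F (\<lambda>_. 1) r s = (if r = s then 1 else 0)"
    and ev: "\<And>f i. f \<in> F \<Longrightarrow> i \<in> I \<Longrightarrow> apply_on I A f i = of_real (c f) * f i"
    and A_eq: "\<And>r s. r \<in> I \<Longrightarrow> s \<in> I \<Longrightarrow> A r s = spec_sum F c r s" by metis
  have c: "0 < c f" if "f \<in> F" for f
  proof -
    have "inner_on I f f = 1" using F(2) that by (simp add: orthonormal_on_def)
    then have "normsq I f \<noteq> 0" by (auto simp: inner_on_self)
    then show ?thesis
      using eigenvalue_eq [where F = F and A = A and c = c, OF F(2) that ev] pos that by metis
  qed
  have c1: "spec_sum F c r s = spec_sum F (\<lambda>f. sqrt (c f) * sqrt (c f)) r s" for r s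
    unfolding spec_sum_def by (intro sum.cong refl) (simp add: c less_imp_le)
  have c2: "spec_sum F (\<lambda>_. 1) r s = spec_sum F (\<lambda>f. sqrt (c f) * (1 / sqrt (c f))) r s"
    "spec_sum F (\<lambda>_. 1) r s = spec_sum F (\<lambda>f. (1 / sqrt (c f)) * sqrt (c f)) r s" for r s
    unfolding spec_sum_def by (intro sum.cong refl; use c in fastforce)+
  show thesis
  proof (rule that [of "spec_sum F (\<lambda>f. sqrt (c f))" "spec_sum F (\<lambda>f. 1 / sqrt (c f))"])
  qed (use A_eq c1 c2 one in \<open>simp_all only: spec_sum_mult [OF F] spec_sum_cnj\<close>)
qed

text \<open>The residual \<open>L P - y\<close> of a best approximation of \<open>y\<close> from the cone \<open>L ` K\<close> separates \<open>y\<close>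
  from it.\<close>

lemma cone_best_approximation:
  fixes K :: "('k \<Rightarrow> complex) set" and L :: "('k \<Rightarrow> complex) \<Rightarrow> 't \<Rightarrow> complex"
  assumes "finite T" "closed K" and zero: "(\<lambda>_. 0) \<in> K"
    and add: "\<And>P Q. P \<in> K \<Longrightarrow> Q \<in> K \<Longrightarrow> (\<lambda>i. P i + Q i) \<in> K"
    and scale: "\<And>a P. 0 \<le> a \<Longrightarrow> P \<in> K \<Longrightarrow> (\<lambda>i. of_real a * P i) \<in> K"
    and L_add: "\<And>P Q. L (\<lambda>i. P i + Q i) = (\<lambda>t. L P t + L Q t)"
    and L_scale: "\<And>a P. L (\<lambda>i. of_real a * P i) = (\<lambda>t. of_real a * L P t)"
    and L_cont: "\<And>t. continuous_on UNIV (\<lambda>P. L P t)"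
    and bdd: "\<And>b. \<exists>M. \<forall>P\<in>K. normsq T (\<lambda>t. L P t - y t) \<le> b \<longrightarrow> (\<forall>i. cmod (P i) \<le> M)"
  obtains P where "P \<in> K" "\<And>Q. Q \<in> K \<Longrightarrow> 0 \<le> Re (inner_on T (L Q) (\<lambda>t. L P t - y t))"
    "Re (inner_on T y (\<lambda>t. L P t - y t)) = - normsq T (\<lambda>t. L P t - y t)"
proof -
  let ?E = "\<lambda>P. normsq T (\<lambda>t. L P t - y t)"
  obtain M where M: "\<And>P i. P \<in> K \<Longrightarrow> ?E P \<le> ?E (\<lambda>_. 0) \<Longrightarrow> cmod (P i) \<le> M"
    using bdd [of "?E (\<lambda>_. 0)"] by blast
  \<comment> \<open>Only points no worse than the zero function compete for the minimum, and
    \<open>bdd\<close> puts those into a compact box.\<close>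
  let ?C = "{P. \<forall>i. cmod (P i) \<le> M} \<inter> K"
  have C: "compact ?C" by (intro compact_Int_closed compact_cmod_box \<open>closed K\<close>)
  have 0: "(\<lambda>_. 0) \<in> ?C" using zero M [OF zero order_refl] by simp
  then have "?C \<noteq> {}" by (intro ex_in_conv [THEN iffD1] exI)
  moreover have "continuous_on ?C ?E"
    by (intro continuous_intros continuous_on_subset [OF L_cont]) auto
  ultimately have "\<exists>P\<in>?C. \<forall>Q\<in>?C. ?E P \<le> ?E Q"
    by (intro continuous_attains_inf C)
  then obtain P where P: "P \<in> ?C" and min: "\<And>Q. Q \<in> ?C \<Longrightarrow> ?E P \<le> ?E Q"
    by blast
  have "P \<in> K" using P by simp
  have global: "?E P \<le> ?E Q" if "Q \<in> K" for Q
  proof (cases "?E Q \<le> ?E (\<lambda>_. 0)")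
    case True
    then show ?thesis using min M that by simp
  next
    case False
    then show ?thesis using min [OF 0] by linarith
  qed
  define R where "R = (\<lambda>t. L P t - y t)"
  have expand: "?E (\<lambda>i. P i + of_real t * Q i)
      = normsq T R + t\<^sup>2 * normsq T (L Q) + 2 * t * Re (inner_on T R (L Q))" for t Q
  proof -
    have "?E (\<lambda>i. P i + of_real t * Q i) = normsq T (\<lambda>s. R s + of_real t * L Q s)"
      unfolding L_add L_scale R_def by (simp add: algebra_simps)
    then show ?thesis unfolding normsq_add normsq_scale inner_on_scale_right by simp
  qed
  have swap: "Re (inner_on T R u) = Re (inner_on T u R)" for u
    by (subst inner_on_cnj [symmetric]) simp
  have pos: "0 \<le> Re (inner_on T (L Q) R)" if "Q \<in> K" for Q
  proof -
    have "0 \<le> 2 * Re (inner_on T R (L Q))"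
    proof (rule nonneg_of_quadratic_nonneg)
      fix t :: real assume "0 < t"
      then have "?E P \<le> ?E (\<lambda>i. P i + of_real t * Q i)"
        using that \<open>P \<in> K\<close> by (intro global add scale) auto
      then show "0 \<le> t * (2 * Re (inner_on T R (L Q))) + t\<^sup>2 * normsq T (L Q)"
        unfolding expand R_def [symmetric] by (simp add: algebra_simps)
    qed
    then show ?thesis by (simp add: swap)
  qed
  \<comment> \<open>Shrinking \<open>P\<close> stays in the cone. Together with \<open>pos\<close>
    at \<open>P\<close> itself this makes the residual orthogonal to \<open>L P\<close>, in real
    part.\<close>
  have "0 \<le> - 2 * Re (inner_on T R (L P))"
  proof (rule nonneg_of_quadratic_nonneg)
    fix t :: real assume "0 < t" "t \<le> 1"
    then have "?E P \<le> ?E (\<lambda>i. of_real (1 - t) * P i)"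
      using \<open>P \<in> K\<close> by (intro global scale) auto
    also have "(\<lambda>i. of_real (1 - t) * P i) = (\<lambda>i. P i + of_real (- t) * P i)"
      by (simp add: algebra_simps)
    finally show "0 \<le> t * (- 2 * Re (inner_on T R (L P))) + t\<^sup>2 * normsq T (L P)"
      unfolding expand R_def [symmetric] by (simp add: algebra_simps)
  qed
  then have "Re (inner_on T (L P) R) = 0" using pos [OF \<open>P \<in> K\<close>] swap by simp
  moreover have "inner_on T (L P) R - inner_on T y R = of_real (normsq T R)"
    by (simp only: inner_on_diff_left [symmetric] R_def [symmetric] inner_on_self)
  then have "Re (inner_on T (L P) R) - Re (inner_on T y R) = normsq T R"
    by (metis Re_complex_of_real minus_complex.sel(1))
  ultimately have "Re (inner_on T y R) = - normsq T R" by linarith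
  with \<open>P \<in> K\<close> pos show thesis unfolding R_def by (rule that)
qed

section \<open>Tensor products of tuples\<close>

definition tens :: "('d::finite \<Rightarrow> 'a \<Rightarrow> 'a \<Rightarrow> complex) \<Rightarrow> ('d \<Rightarrow> 'b \<Rightarrow> 'b \<Rightarrow> complex)
    \<Rightarrow> 'a \<times> 'b \<Rightarrow> 'a \<times> 'b \<Rightarrow> complex" where
  "tens A X p q = (\<Sum>j\<in>UNIV. A j (fst p) (fst q) * X j (snd p) (snd q))"

text \<open>For Hermitian entries this is the condition that the sum of squares is at most the
  identity (\<open>mem_ball_B_iff\<close>), phrased through norms so that no squares have to be
  formed.\<close>

definition column_contraction :: "'a set \<Rightarrow> ('d::finite \<Rightarrow> 'a \<Rightarrow> 'a \<Rightarrow> complex) \<Rightarrow> bool" where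
  "column_contraction I X \<longleftrightarrow> (\<forall>v. (\<Sum>j\<in>UNIV. normsq I (apply_on I (X j) v)) \<le> normsq I v)"

definition basis_fun :: "'a \<Rightarrow> 'a \<Rightarrow> complex" where
  "basis_fun k = (\<lambda>i. if i = k then 1 else 0)"

lemma sum_basis_fun:
  assumes "finite I"
  shows "(\<Sum>i\<in>I. f i * basis_fun k i) = (if k \<in> I then f k else 0)"
    "(\<Sum>i\<in>I. f i * basis_fun i k) = (if k \<in> I then f k else 0)"
  using assms by (simp_all add: basis_fun_def if_distrib [of "\<lambda>x. _ * x"] cong: if_cong)

lemma sum_rotate:
  "(\<Sum>j\<in>K. \<Sum>k\<in>I. \<Sum>r\<in>J. f j k r) = (\<Sum>r\<in>J. \<Sum>j\<in>K. \<Sum>k\<in>I. f j k r)"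
proof -
  have "(\<Sum>j\<in>K. \<Sum>k\<in>I. \<Sum>r\<in>J. f j k r) = (\<Sum>j\<in>K. \<Sum>r\<in>J. \<Sum>k\<in>I. f j k r)"
    by (intro sum.cong refl sum.swap)
  also have "\<dots> = (\<Sum>r\<in>J. \<Sum>j\<in>K. \<Sum>k\<in>I. f j k r)" by (rule sum.swap)
  finally show ?thesis .
qed

lemma inner_basis_fun:
  assumes "finite I" "k \<in> I"
  shows "inner_on I u (basis_fun k) = u k"
proof -
  have "cnj (basis_fun k i) = basis_fun k i" for i by (simp add: basis_fun_def)
  then show ?thesis using assms by (simp add: inner_on_def sum_basis_fun)
qed

lemma apply_basis_fun:
  assumes "finite I" "k \<in> I"
  shows "apply_on I A (basis_fun k) = (\<lambda>i. A i k)"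
  using assms by (simp add: apply_on_def sum_basis_fun)

lemma apply_on_sum: "apply_on I A (\<lambda>i. \<Sum>k\<in>K. u k i) = (\<lambda>i. \<Sum>k\<in>K. apply_on I A (u k) i)"
proof
  fix i
  show "apply_on I A (\<lambda>i. \<Sum>k\<in>K. u k i) i = (\<Sum>k\<in>K. apply_on I A (u k) i)"
    unfolding apply_on_def sum_distrib_left by (rule sum.swap)
qed

lemma apply_on_cnj: "apply_on I (\<lambda>r s. cnj (A r s)) v = (\<lambda>i. cnj (apply_on I A (\<lambda>i. cnj (v i)) i))"
  by (simp add: apply_on_def)

lemma inner_on_cnj_cnj: "inner_on I (\<lambda>i. cnj (u i)) (\<lambda>i. cnj (v i)) = cnj (inner_on I u v)"
  by (simp add: inner_on_def)

lemma column_contraction_cnj: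
  assumes "column_contraction I X"
  shows "column_contraction I (\<lambda>j r s. cnj (X j r s))"
  unfolding column_contraction_def
proof
  fix v
  show "(\<Sum>j\<in>UNIV. normsq I (apply_on I (\<lambda>r s. cnj (X j r s)) v)) \<le> normsq I v"
    using assms [unfolded column_contraction_def, rule_format, of "\<lambda>i. cnj (v i)"]
    by (simp only: apply_on_cnj normsq_cnj)
qed

lemma inner_on_prod:
  "inner_on (I \<times> J) (\<lambda>p. a (fst p) * b (snd p)) (\<lambda>p. a' (fst p) * b' (snd p))
    = inner_on I a a' * inner_on J b b'"
  unfolding inner_on_def sum_product sum.cartesian_product
  by (intro sum.cong refl) (auto simp: algebra_simps)

lemma apply_tens_prod:
  "apply_on (I \<times> J) (tens A X) (\<lambda>p. a (fst p) * b (snd p))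
    = (\<lambda>p. \<Sum>j\<in>UNIV. apply_on I (A j) a (fst p) * apply_on J (X j) b (snd p))"
proof
  fix p
  have "apply_on (I \<times> J) (tens A X) (\<lambda>p. a (fst p) * b (snd p)) p
      = (\<Sum>q\<in>I \<times> J. \<Sum>j\<in>UNIV. A j (fst p) (fst q) * a (fst q) * (X j (snd p) (snd q) * b (snd q)))"
    unfolding apply_on_def tens_def sum_distrib_right
    by (intro sum.cong refl) (simp add: algebra_simps)
  also have "\<dots> = (\<Sum>j\<in>UNIV. \<Sum>q\<in>I \<times> J. A j (fst p) (fst q) * a (fst q)
      * (X j (snd p) (snd q) * b (snd q)))"
    by (rule sum.swap)
  also have "\<dots> = (\<Sum>j\<in>UNIV. apply_on I (A j) a (fst p) * apply_on J (X j) b (snd p))"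
    unfolding apply_on_def sum_product sum.cartesian_product
    by (intro sum.cong refl) auto
  finally show "apply_on (I \<times> J) (tens A X) (\<lambda>p. a (fst p) * b (snd p)) p
      = (\<Sum>j\<in>UNIV. apply_on I (A j) a (fst p) * apply_on J (X j) b (snd p))" .
qed

abbreviation tens_form :: "'a set \<Rightarrow> 'b set \<Rightarrow> ('d::finite \<Rightarrow> 'a \<Rightarrow> 'a \<Rightarrow> complex)
    \<Rightarrow> ('d \<Rightarrow> 'b \<Rightarrow> 'b \<Rightarrow> complex) \<Rightarrow> ('a \<times> 'b \<Rightarrow> complex) \<Rightarrow> complex" where
  "tens_form I J A X u \<equiv> inner_on (I \<times> J) (apply_on (I \<times> J) (tens A X) u) u"

text \<open>Expansion over sums of product vectors, the form in which both the maximally entangled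
  vector and Schmidt decompositions are inserted.\<close>

lemma inner_tens_sum_prod:
  "inner_on (I \<times> J) (apply_on (I \<times> J) (tens A X) (\<lambda>p. \<Sum>f\<in>F. a f (fst p) * b f (snd p)))
      (\<lambda>p. \<Sum>g\<in>G. a' g (fst p) * b' g (snd p))
    = (\<Sum>f\<in>F. \<Sum>g\<in>G. \<Sum>j\<in>UNIV. inner_on I (apply_on I (A j) (a f)) (a' g)
        * inner_on J (apply_on J (X j) (b f)) (b' g))"
  unfolding apply_on_sum inner_on_sum_left unfolding inner_on_sum_right
  unfolding apply_tens_prod inner_on_sum_left inner_on_prod ..

text \<open>The test vector is the maximally entangled \<open>\<Sum>\<^sub>t \<delta>\<^sub>t \<otimes> \<delta>\<^sub>t\<close> with \<open>R\<close> applied to the first leg.\<close>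

lemma inner_tens_entangled:
  fixes A X :: "'d::finite \<Rightarrow> 'a \<Rightarrow> 'a \<Rightarrow> complex"
  assumes "finite I"
  shows "tens_form I I A X (\<lambda>p. R (snd p) (fst p))
    = (\<Sum>t\<in>I. \<Sum>s\<in>I. \<Sum>j\<in>UNIV. inner_on I (apply_on I (A j) (R t)) (R s) * X j s t)"
proof -
  let ?u = "\<lambda>p. \<Sum>t\<in>I. R t (fst p) * basis_fun t (snd p)"
  have u: "R (snd p) (fst p) = ?u p" if "p \<in> I \<times> I" for p
    using that sum_basis_fun(2) [OF assms, of "\<lambda>t. R t (fst p)" "snd p"] by auto
  have "tens_form I I A X (\<lambda>p. R (snd p) (fst p))
      = tens_form I I A X ?u"
  proof (rule inner_on_cong)
    show "apply_on (I \<times> I) (tens A X) (\<lambda>p. R (snd p) (fst p)) q = apply_on (I \<times> I) (tens A X) ?u q"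
      for q
      unfolding apply_on_def using u by (intro sum.cong) auto
  qed (rule u)
  then show ?thesis
    unfolding inner_tens_sum_prod
    by (simp add: apply_basis_fun inner_basis_fun assms)
qed

text \<open>As the \<open>A\<^sub>j\<close> are Hermitian, \<open>\<Sum> A\<^sub>j \<otimes> X\<^sub>j\<close> is the row contraction with entries \<open>A\<^sub>j \<otimes> I\<close> times the
  column contraction with entries \<open>I \<otimes> X\<^sub>j\<close>.\<close>

lemma column_contraction_tens:
  assumes fin: "finite I" "finite J" and herm: "\<And>j. herm_on I (A j)"
    and A: "column_contraction I A" and X: "column_contraction J X"
  shows "normsq (I \<times> J) (apply_on (I \<times> J) (tens A X) u) \<le> normsq (I \<times> J) u"
proof -
  let ?T = "apply_on (I \<times> J) (tens A X)"
  \<comment> \<open>The estimate is proved against an arbitrary \<open>w\<close>; the choice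
    \<open>w = ?T u\<close> then absorbs half of |T u|^2.\<close>
  have "Re (inner_on (I \<times> J) (?T u) w) \<le> (normsq (I \<times> J) u + normsq (I \<times> J) w) / 2" for w
  proof -
    \<comment> \<open>\<open>a j\<close> is I tensor X_j applied to \<open>u\<close>, and
      \<open>b j\<close> is A_j tensor I applied to \<open>w\<close>. Moving the Hermitian A_j to
      the other side turns the form into the sum of the inner products of \<open>a j\<close> with
      \<open>b j\<close>.\<close>
    define a where "a j p = apply_on J (X j) (\<lambda>s. u (fst p, s)) (snd p)" for j p
    define b where "b j p = apply_on I (A j) (\<lambda>i. w (i, snd p)) (fst p)" for j p
    have b_cnj: "(\<Sum>i\<in>I. A j i k * cnj (w (i, r))) = cnj (b j (k, r))" if "k \<in> I" for j k r
    proof -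
      have "A j i k * cnj (w (i, r)) = cnj (A j k i * w (i, r))" if "i \<in> I" for i
        using herm [of j] that \<open>k \<in> I\<close> unfolding herm_on_def by (metis complex_cnj_mult)
      then have "(\<Sum>i\<in>I. A j i k * cnj (w (i, r))) = (\<Sum>i\<in>I. cnj (A j k i * w (i, r)))"
        by (rule sum.cong [OF refl])
      then show ?thesis by (simp only: b_def apply_on_def fst_conv snd_conv cnj_sum)
    qed
    have "inner_on (I \<times> J) (?T u) w
        = (\<Sum>i\<in>I. \<Sum>r\<in>J. \<Sum>k\<in>I. \<Sum>s\<in>J. \<Sum>j\<in>UNIV. A j i k * cnj (w (i, r)) * (X j r s * u (k, s)))"
      unfolding inner_on_def apply_on_def tens_def sum_distrib_right sum.cartesian_product'
      by (intro sum.cong refl) (simp add: algebra_simps)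
    also have "\<dots> = (\<Sum>i\<in>I. \<Sum>r\<in>J. \<Sum>j\<in>UNIV. \<Sum>k\<in>I. A j i k * cnj (w (i, r)) * a j (k, r))"
      by (intro sum.cong refl, subst sum_rotate) (simp add: a_def apply_on_def sum_distrib_left)
    also have "\<dots> = (\<Sum>j\<in>UNIV. \<Sum>i\<in>I. \<Sum>r\<in>J. \<Sum>k\<in>I. A j i k * cnj (w (i, r)) * a j (k, r))"
      by (rule sum_rotate)
    also have "\<dots> = (\<Sum>j\<in>UNIV. \<Sum>k\<in>I. \<Sum>r\<in>J. a j (k, r) * cnj (b j (k, r)))"
    proof (rule sum.cong [OF refl])
      fix j
      have "(\<Sum>i\<in>I. \<Sum>r\<in>J. \<Sum>k\<in>I. A j i k * cnj (w (i, r)) * a j (k, r))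
          = (\<Sum>k\<in>I. \<Sum>i\<in>I. \<Sum>r\<in>J. A j i k * cnj (w (i, r)) * a j (k, r))"
        by (rule sum_rotate)
      also have "\<dots> = (\<Sum>k\<in>I. \<Sum>r\<in>J. \<Sum>i\<in>I. A j i k * cnj (w (i, r)) * a j (k, r))"
        by (intro sum.cong refl sum.swap)
      also have "\<dots> = (\<Sum>k\<in>I. \<Sum>r\<in>J. a j (k, r) * cnj (b j (k, r)))"
        by (intro sum.cong refl) (simp only: sum_distrib_right [symmetric] b_cnj, rule mult.commute)
      finally show "(\<Sum>i\<in>I. \<Sum>r\<in>J. \<Sum>k\<in>I. A j i k * cnj (w (i, r)) * a j (k, r))
          = (\<Sum>k\<in>I. \<Sum>r\<in>J. a j (k, r) * cnj (b j (k, r)))" .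
    qed
    also have "\<dots> = (\<Sum>j\<in>UNIV. inner_on (I \<times> J) (a j) (b j))"
      unfolding inner_on_def sum.cartesian_product' ..
    finally have "Re (inner_on (I \<times> J) (?T u) w) = (\<Sum>j\<in>UNIV. Re (inner_on (I \<times> J) (a j) (b j)))"
      by simp
    also have "\<dots> \<le> (\<Sum>j\<in>UNIV. (normsq (I \<times> J) (a j) + normsq (I \<times> J) (b j)) / 2)"
      by (intro sum_mono Re_inner_on_le)
    also have "\<dots> = ((\<Sum>j\<in>UNIV. normsq (I \<times> J) (a j)) + (\<Sum>j\<in>UNIV. normsq (I \<times> J) (b j))) / 2"
      by (simp add: sum.distrib sum_divide_distrib [symmetric])
    also have "(\<Sum>j\<in>UNIV. normsq (I \<times> J) (a j))
        = (\<Sum>k\<in>I. \<Sum>j\<in>UNIV. normsq J (apply_on J (X j) (\<lambda>s. u (k, s))))"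
      unfolding normsq_def sum.cartesian_product' a_def by (subst sum.swap) simp
    also have "\<dots> \<le> (\<Sum>k\<in>I. normsq J (\<lambda>s. u (k, s)))"
      using X unfolding column_contraction_def by (intro sum_mono) blast
    also have "\<dots> = normsq (I \<times> J) u"
      unfolding normsq_def sum.cartesian_product' ..
    also have "(\<Sum>j\<in>UNIV. normsq (I \<times> J) (b j))
        = (\<Sum>r\<in>J. \<Sum>j\<in>UNIV. normsq I (apply_on I (A j) (\<lambda>i. w (i, r))))"
      unfolding normsq_def sum.cartesian_product' b_def
      by (subst sum_rotate) simp
    also have "\<dots> \<le> (\<Sum>r\<in>J. normsq I (\<lambda>i. w (i, r)))"
      using A unfolding column_contraction_def by (intro sum_mono) blast
    also have "\<dots> = normsq (I \<times> J) w"
      unfolding normsq_def sum.cartesian_product' by (rule sum.swap)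
    finally show ?thesis by (simp add: divide_right_mono)
  qed
  from this [of "?T u"] show ?thesis by (simp add: inner_on_self)
qed

section \<open>Schmidt decomposition and Haagerup's inequality\<close>

lemma spec_sum_trace:
  assumes "orthonormal_on I F"
  shows "(\<Sum>t\<in>I. spec_sum F c t t) = of_real (\<Sum>f\<in>F. c f)"
proof -
  have "(\<Sum>t\<in>I. spec_sum F c t t) = (\<Sum>f\<in>F. of_real (c f) * inner_on I f f)"
    unfolding spec_sum_def inner_on_def sum_distrib_left by (rule sum.swap)
  also have "\<dots> = (\<Sum>f\<in>F. of_real (c f))"
    using assms by (simp add: orthonormal_on_def)
  finally show ?thesis by simp
qed

text \<open>The singular value decomposition of \<open>u\<close>, read as an \<open>I\<close> by
  \<open>J\<close> matrix: \<open>F\<close> diagonalises the Gram matrix of its columns and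
  \<open>h f\<close> is \<open>u\<close> applied to \<open>f\<close>. The left vectors stay
  unnormalised, since the squared singular values \<open>c f\<close> may be zero.\<close>

lemma schmidt_decomposition:
  fixes u :: "'a \<times> 'b \<Rightarrow> complex"
  assumes fin: "finite I" "finite J"
  obtains F c h where "finite F" "orthonormal_on J F" "\<And>f. f \<in> F \<Longrightarrow> 0 \<le> c f"
    "\<And>f g. f \<in> F \<Longrightarrow> g \<in> F \<Longrightarrow> inner_on I (h f) (h g) = (if f = g then of_real (c f) else 0)"
    "\<And>p. p \<in> I \<times> J \<Longrightarrow> u p = (\<Sum>f\<in>F. h f (fst p) * cnj (f (snd p)))"
    "normsq (I \<times> J) u = (\<Sum>f\<in>F. c f)"
proof -
  define M where "M r s = (\<Sum>i\<in>I. cnj (u (i, r)) * u (i, s))" for r s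
  have "herm_on J M" by (simp add: herm_on_def M_def mult.commute)
  from spectral_theorem [OF \<open>finite J\<close> this] obtain F c where F: "finite F" "orthonormal_on J F"
    and one: "\<And>r s. r \<in> J \<Longrightarrow> s \<in> J \<Longrightarrow> spec_sum F (\<lambda>_. 1) r s = (if r = s then 1 else 0)"
    and ev: "\<And>f i. f \<in> F \<Longrightarrow> i \<in> J \<Longrightarrow> apply_on J M f i = of_real (c f) * f i"
    and M_eq: "\<And>r s. r \<in> J \<Longrightarrow> s \<in> J \<Longrightarrow> M r s = spec_sum F c r s" by metis
  define h where "h f i = (\<Sum>r\<in>J. u (i, r) * f r)" for f i
  have hh: "inner_on I (h f) (h g) = (if f = g then of_real (c f) else 0)" if "f \<in> F" "g \<in> F"
    for f g
  proof -
    have "inner_on I (h f) (h g) = (\<Sum>i\<in>I. \<Sum>r\<in>J. \<Sum>s\<in>J. (u (i, r) * f r) * cnj (u (i, s) * g s))"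
      unfolding inner_on_def h_def cnj_sum sum_product ..
    also have "\<dots> = (\<Sum>s\<in>J. \<Sum>i\<in>I. \<Sum>r\<in>J. (u (i, r) * f r) * cnj (u (i, s) * g s))"
      by (rule sum_rotate)
    also have "\<dots> = (\<Sum>s\<in>J. \<Sum>r\<in>J. \<Sum>i\<in>I. (u (i, r) * f r) * cnj (u (i, s) * g s))"
      by (intro sum.cong refl sum.swap)
    also have "\<dots> = inner_on J (apply_on J M f) g"
      unfolding inner_on_def apply_on_def M_def sum_distrib_right
      by (intro sum.cong refl) (simp add: algebra_simps)
    also have "\<dots> = inner_on J (\<lambda>i. of_real (c f) * f i) g"
      by (rule inner_on_cong) (simp_all add: ev that)
    also have "\<dots> = (if f = g then of_real (c f) else 0)"
      using F(2) that by (simp add: inner_on_scale_left orthonormal_on_def)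
    finally show ?thesis .
  qed
  have c: "0 \<le> c f" if "f \<in> F" for f
  proof -
    have "of_real (c f) = inner_on I (h f) (h f)" using hh that by simp
    then have "c f = normsq I (h f)" by (simp only: inner_on_self of_real_eq_iff)
    then show ?thesis by simp
  qed
  have u: "u p = (\<Sum>f\<in>F. h f (fst p) * cnj (f (snd p)))" if p: "p \<in> I \<times> J" for p
  proof -
    have "(\<Sum>f\<in>F. h f (fst p) * cnj (f (snd p)))
        = (\<Sum>r\<in>J. u (fst p, r) * spec_sum F (\<lambda>_. 1) r (snd p))"
      unfolding h_def spec_sum_def sum_distrib_left sum_distrib_right
      by (subst sum.swap) (simp add: algebra_simps)
    also have "\<dots> = (\<Sum>r\<in>J. if r = snd p then u (fst p, r) else 0)"
      using p by (intro sum.cong refl) (auto simp: one)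
    also have "\<dots> = u p" using p \<open>finite J\<close> by auto
    finally show ?thesis ..
  qed
  have "complex_of_real (normsq (I \<times> J) u) = (\<Sum>t\<in>J. M t t)"
    unfolding normsq_def M_def sum.cartesian_product' of_real_sum
    by (subst sum.swap) (simp add: complex_norm_square mult.commute del: of_real_power)
  also have "\<dots> = (\<Sum>t\<in>J. spec_sum F c t t)" by (simp add: M_eq)
  also have "\<dots> = of_real (\<Sum>f\<in>F. c f)" by (rule spec_sum_trace [OF F(2)])
  finally have "normsq (I \<times> J) u = (\<Sum>f\<in>F. c f)" by (simp only: of_real_eq_iff)
  with F c hh u show thesis by (rule that)
qed

text \<open>In a Schmidt decomposition of \<open>u\<close> with coefficients \<open>s\<^sub>f\<close> the form is \<open>\<Sum> s\<^sub>f s\<^sub>g \<beta>\<^sub>f\<^sub>g \<xi>\<^sub>f\<^sub>g\<close>. After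
  AM-GM the terms \<open>s\<^sub>f s\<^sub>g |\<beta>\<^sub>f\<^sub>g|\<^sup>2\<close> are bounded by Bessel's inequality, and the terms
  \<open>s\<^sub>f s\<^sub>g |\<xi>\<^sub>f\<^sub>g|\<^sup>2\<close> sum to the form of \<open>\<Sum> X\<^sub>j \<otimes> cnj X\<^sub>j\<close> at \<open>\<Sum> s\<^sub>f cnj f \<otimes> f\<close>.\<close>

lemma haagerup_inequality:
  fixes A :: "'d::finite \<Rightarrow> 'a \<Rightarrow> 'a \<Rightarrow> complex" and X :: "'d \<Rightarrow> 'b \<Rightarrow> 'b \<Rightarrow> complex"
  assumes fin: "finite I" "finite J"
    and herm: "\<And>j. herm_on I (A j)" and A: "column_contraction I A"
    and X: "\<And>w. normsq (J \<times> J) (apply_on (J \<times> J) (tens X (\<lambda>j r s. cnj (X j r s))) w)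
        \<le> normsq (J \<times> J) w"
  shows "Re (tens_form I J A X u) \<le> normsq (I \<times> J) u"
proof -
  obtain F c h where F: "finite F" "orthonormal_on J F" and c: "\<And>f. f \<in> F \<Longrightarrow> 0 \<le> c f"
    and hh: "\<And>f g. f \<in> F \<Longrightarrow> g \<in> F \<Longrightarrow> inner_on I (h f) (h g) = (if f = g then of_real (c f) else 0)"
    and u: "\<And>p. p \<in> I \<times> J \<Longrightarrow> u p = (\<Sum>f\<in>F. h f (fst p) * cnj (f (snd p)))"
    and nu: "normsq (I \<times> J) u = (\<Sum>f\<in>F. c f)"
    by (rule schmidt_decomposition [OF fin, of u]) blast
  let ?c = "\<lambda>f. \<lambda>i. cnj (f i)"
  define s where "s f = sqrt (c f)" for f
  define N where "N = (\<Sum>f\<in>F. c f)"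
  have s: "0 \<le> s f" "s f * s f = c f" if "f \<in> F" for f
    using c [OF that] by (simp_all add: s_def)
  have nh: "normsq I (h f) = c f" if "f \<in> F" for f
    using hh [OF that that] by (simp add: inner_on_self)
  \<comment> \<open>If \<open>s f = 0\<close>, division by zero makes \<open>g f\<close> the zero
    vector. Then \<open>h f\<close> vanishes on \<open>I\<close> too, so \<open>h_g\<close>
    survives.\<close>
  define g where "g f = (\<lambda>i. of_real (1 / s f) * h f i)" for f
  have h_g: "h f i = of_real (s f) * g f i" if "f \<in> F" "i \<in> I" for f i
  proof (cases "s f = 0")
    case True
    then have "normsq I (h f) = 0" using s(2) [OF that(1)] nh [OF that(1)] by simp
    then show ?thesis using that(2) True \<open>finite I\<close> by (simp add: normsq_eq_0_iff)
  qed (simp add: g_def)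
  have g_orth: "inner_on I (g f) (g f') = 0" if "f \<in> F" "f' \<in> F" "f \<noteq> f'" for f f'
    using hh [OF that(1,2)] that(3) unfolding g_def inner_on_scale_left inner_on_scale_right by simp
  have g_le: "normsq I (g f) \<le> 1" if "f \<in> F" for f
    unfolding g_def normsq_scale nh [OF that] using s [OF that]
    by (simp add: norm_divide power2_eq_square divide_simps)
  define \<beta> where "\<beta> j f f' = inner_on I (apply_on I (A j) (g f)) (g f')" for j f f'
  define \<xi> where "\<xi> j f f' = inner_on J (apply_on J (X j) (?c f)) (?c f')" for j f f'
  have \<alpha>: "inner_on I (apply_on I (A j) (h f)) (g f') = of_real (s f) * \<beta> j f f'"
    if "f \<in> F" for j f f'
  proof -
    have "apply_on I (A j) (h f) = apply_on I (A j) (\<lambda>i. of_real (s f) * g f i)"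
      unfolding apply_on_def using h_g that by (intro ext sum.cong) auto
    then show ?thesis by (simp only: apply_on_scale inner_on_scale_left \<beta>_def)
  qed
  have \<alpha>2: "inner_on I (apply_on I (A j) (h f)) (h f') = of_real (s f * s f') * \<beta> j f f'"
    if "f \<in> F" "f' \<in> F" for j f f'
  proof -
    have "inner_on I (apply_on I (A j) (h f)) (h f')
        = inner_on I (apply_on I (A j) (h f)) (\<lambda>i. of_real (s f') * g f' i)"
      using h_g that by (intro inner_on_cong) auto
    then show ?thesis by (simp add: inner_on_scale_right \<alpha> that)
  qed
  have \<beta>_sym: "cmod (\<beta> j f f') = cmod (\<beta> j f' f)" for j f f'
    unfolding \<beta>_def by (subst herm_on_inner [OF herm], subst inner_on_cnj [symmetric]) simp
  have "tens_form I J A X u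
      = tens_form I J A X (\<lambda>p. \<Sum>f\<in>F. h f (fst p) * ?c f (snd p))"
  proof (rule inner_on_cong)
    show "apply_on (I \<times> J) (tens A X) u q
        = apply_on (I \<times> J) (tens A X) (\<lambda>p. \<Sum>f\<in>F. h f (fst p) * ?c f (snd p)) q" for q
      unfolding apply_on_def using u by (intro sum.cong) auto
  qed (rule u)
  also have "\<dots> = (\<Sum>f\<in>F. \<Sum>f'\<in>F. \<Sum>j\<in>UNIV. of_real (s f * s f') * \<beta> j f f' * \<xi> j f f')"
    unfolding inner_tens_sum_prod [where a = h and a' = h and b = "\<lambda>f i. cnj (f i)" and b'
        = "\<lambda>f i. cnj (f i)"]
    by (intro sum.cong refl) (simp only: \<alpha>2 \<xi>_def)
  finally have "Re (tens_form I J A X u)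
      = (\<Sum>f\<in>F. \<Sum>f'\<in>F. \<Sum>j\<in>UNIV. Re (of_real (s f * s f') * \<beta> j f f' * \<xi> j f f'))"
    by simp
  \<comment> \<open>AM-GM twice: on the product of the moduli of \<beta> and \<xi>, and then on
    \<open>s f * s f'\<close>, but only in the \<beta> terms. By \<open>\<beta>_sym\<close> the part
    with \<open>c f'\<close> can be written with transposed indices, so that both parts have the
    same sum \<open>?B\<close>.\<close>
  also have "\<dots> \<le> (\<Sum>f\<in>F. \<Sum>f'\<in>F. \<Sum>j\<in>UNIV.
      (c f * (cmod (\<beta> j f f'))\<^sup>2 + c f' * (cmod (\<beta> j f' f))\<^sup>2) / 4 + s f * s f'
          * (cmod (\<xi> j f f'))\<^sup>2 / 2)"
  proof (intro sum_mono)
    fix f f' j assume f: "f \<in> F" "f' \<in> F"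
    let ?b = "cmod (\<beta> j f f')" and ?x = "cmod (\<xi> j f f')"
    have "Re (of_real (s f * s f') * \<beta> j f f' * \<xi> j f f') \<le> s f * s f' * (?b * ?x)"
      using complex_Re_le_cmod [of "of_real (s f * s f') * \<beta> j f f' * \<xi> j f f'"] s(1) f
      by (simp add: norm_mult mult.assoc)
    also have "\<dots> \<le> s f * s f' * ((?b\<^sup>2 + ?x\<^sup>2) / 2)"
      using s(1) f sum_squares_bound [of ?b ?x] by (intro mult_left_mono mult_nonneg_nonneg) auto
    also have "\<dots> \<le> (c f + c f') * ?b\<^sup>2 / 4 + s f * s f' * ?x\<^sup>2 / 2"
    proof -
      have "s f * s f' * ?b\<^sup>2 \<le> (c f + c f') / 2 * ?b\<^sup>2"
        using sum_squares_bound [of "s f" "s f'"] s(2) f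
        by (intro mult_right_mono) (auto simp: power2_eq_square)
      then show ?thesis by (simp add: field_simps)
    qed
    finally show "Re (of_real (s f * s f') * \<beta> j f f' * \<xi> j f f')
        \<le> (c f * ?b\<^sup>2 + c f' * (cmod (\<beta> j f' f))\<^sup>2) / 4 + s f * s f' * ?x\<^sup>2 / 2"
      by (simp add: \<beta>_sym [of j f' f] algebra_simps)
  qed
  also have "\<dots> = (\<Sum>f\<in>F. \<Sum>f'\<in>F. \<Sum>j\<in>UNIV. c f * (cmod (\<beta> j f f'))\<^sup>2) / 2
      + (\<Sum>f\<in>F. \<Sum>f'\<in>F. \<Sum>j\<in>UNIV. s f * s f' * (cmod (\<xi> j f f'))\<^sup>2) / 2"
    (is "_ = ?B / 2 + ?X / 2")
  proof -
    have "(\<Sum>f\<in>F. \<Sum>f'\<in>F. \<Sum>j\<in>UNIV. c f' * (cmod (\<beta> j f' f))\<^sup>2) = ?B"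
      by (rule sum.swap)
    then show ?thesis
      by (simp add: sum.distrib sum_divide_distrib [symmetric] add_divide_distrib)
  qed
  \<comment> \<open>The factor \<open>c f\<close> is absorbed by replacing \<open>g f\<close> with
    \<open>h f\<close> on the left. Bessel's inequality in \<open>f'\<close> and the column bound
    for \<open>A\<close> at \<open>h f\<close> remain.\<close>
  also have "?B \<le> N"
  proof -
    have "?B = (\<Sum>f\<in>F. \<Sum>j\<in>UNIV. \<Sum>f'\<in>F. (cmod (inner_on I (apply_on I (A j) (h f)) (g f')))\<^sup>2)"
      by (intro sum.cong refl, subst sum.swap, intro sum.cong refl)
        (simp add: \<alpha> norm_mult power_mult_distrib s(2) [symmetric] power2_eq_square)
    also have "\<dots> \<le> (\<Sum>f\<in>F. \<Sum>j\<in>UNIV. normsq I (apply_on I (A j) (h f)))"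
      by (intro sum_mono bessel F g_orth g_le)
    also have "\<dots> \<le> (\<Sum>f\<in>F. normsq I (h f))"
      using A unfolding column_contraction_def by (intro sum_mono) blast
    finally show ?thesis by (simp add: nh N_def)
  qed
  also have "?X \<le> N"
  proof -
    \<comment> \<open>The vectorised matrix with coefficients \<open>s\<close> over
      \<open>F\<close>. Since \<open>s f * s f = c f\<close>, its squared norm is the trace of the
      matrix with coefficients \<open>c\<close>, which is \<open>N\<close>.\<close>
    define w where "w p = (\<Sum>f\<in>F. (of_real (s f) * cnj (f (fst p))) * f (snd p))" for p :: "'b \<times> 'b"
    have w: "w p = spec_sum F s (snd p) (fst p)" for p
      unfolding w_def spec_sum_def by (simp add: algebra_simps)
    let ?T = "apply_on (J \<times> J) (tens X (\<lambda>j r s. cnj (X j r s)))"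
    have "inner_on (J \<times> J) (?T w) w
        = (\<Sum>f\<in>F. \<Sum>f'\<in>F. \<Sum>j\<in>UNIV. of_real (s f * s f') * (\<xi> j f f' * cnj (\<xi> j f f')))"
      unfolding w_def inner_tens_sum_prod [where a = "\<lambda>f i. of_real (s f) * cnj (f i)"
          and a' = "\<lambda>f i. of_real (s f) * cnj (f i)" and b = "\<lambda>f. f" and b'
              = "\<lambda>f. f"] apply_on_scale inner_on_scale_left inner_on_scale_right
        apply_on_cnj [of J "X _"]
      unfolding \<xi>_def inner_on_cnj_cnj [symmetric]
      by (simp add: algebra_simps)
    also have "\<dots> = of_real ?X"
      by (simp add: complex_norm_square [symmetric])
    finally have "?X = Re (inner_on (J \<times> J) (?T w) w)" by simp
    also have "\<dots> \<le> (normsq (J \<times> J) (?T w) + normsq (J \<times> J) w) / 2" by (rule Re_inner_on_le)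
    also have "\<dots> \<le> normsq (J \<times> J) w" using X [of w] by simp
    also have "\<dots> = N"
    proof -
      have "complex_of_real (normsq (J \<times> J) w) = (\<Sum>t\<in>J. \<Sum>r\<in>J. spec_sum F s t r * spec_sum F s r t)"
        unfolding normsq_def sum.cartesian_product' of_real_sum complex_norm_square w spec_sum_cnj
        by (simp add: mult.commute)
      also have "\<dots> = (\<Sum>t\<in>J. spec_sum F c t t)"
        unfolding spec_sum_mult [OF F] unfolding spec_sum_def by (simp add: s(2))
      also have "\<dots> = of_real N" unfolding N_def by (rule spec_sum_trace [OF F(2)])
      finally show ?thesis by (simp only: of_real_eq_iff)
    qed
    finally show ?thesis .
  qed
  finally show ?thesis by (simp add: nu N_def)
qed

section \<open>The polar of the column ball\<close>

definition mat_prod :: "'a set \<Rightarrow> ('a \<Rightarrow> 'a \<Rightarrow> complex) \<Rightarrow>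
    ('a \<Rightarrow> 'a \<Rightarrow> complex) \<Rightarrow> 'a \<Rightarrow> 'a \<Rightarrow> complex" where
  "mat_prod I A B r s = (\<Sum>t\<in>I. A r t * B t s)"

lemma apply_mat_prod: "apply_on I (mat_prod I A B) v = apply_on I A (apply_on I B v)"
proof
  fix i
  have "apply_on I (mat_prod I A B) v i = (\<Sum>k\<in>I. \<Sum>t\<in>I. A i t * B t k * v k)"
    by (simp add: apply_on_def mat_prod_def sum_distrib_right)
  also have "\<dots> = (\<Sum>t\<in>I. \<Sum>k\<in>I. A i t * B t k * v k)" by (rule sum.swap)
  finally show "apply_on I (mat_prod I A B) v i = apply_on I A (apply_on I B v) i"
    by (simp add: apply_on_def sum_distrib_left mult.assoc)
qed

lemma mat_prod_assoc: "mat_prod I (mat_prod I A B) C = mat_prod I A (mat_prod I B C)"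
proof (intro ext)
  fix r s
  have "mat_prod I (mat_prod I A B) C r s = (\<Sum>t\<in>I. \<Sum>k\<in>I. A r k * B k t * C t s)"
    by (simp add: mat_prod_def sum_distrib_right)
  also have "\<dots> = (\<Sum>k\<in>I. \<Sum>t\<in>I. A r k * B k t * C t s)" by (rule sum.swap)
  finally show "mat_prod I (mat_prod I A B) C r s = mat_prod I A (mat_prod I B C) r s"
    by (simp add: mat_prod_def sum_distrib_left mult.assoc)
qed

lemma herm_on_iff: "herm_on I A \<longleftrightarrow> (\<forall>r\<in>I. \<forall>s\<in>I. cnj (A r s) = A s r)"
  unfolding herm_on_def by (metis complex_cnj_cnj)

lemma herm_onI_cnj: "(\<And>r s. cnj (A r s) = A s r) \<Longrightarrow> herm_on I A"
  by (simp add: herm_on_iff)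

lemma herm_on_cnj: "herm_on I A \<Longrightarrow> r \<in> I \<Longrightarrow> s \<in> I \<Longrightarrow> cnj (A r s) = A s r"
  by (simp add: herm_on_iff)

lemma apply_on_add_left: "apply_on I (\<lambda>r s. A r s + B r s) v
    = (\<lambda>i. apply_on I A v i + apply_on I B v i)"
  by (simp add: apply_on_def sum.distrib algebra_simps)

lemma apply_on_scale_left: "apply_on I (\<lambda>r s. c * A r s) v = (\<lambda>i. c * apply_on I A v i)"
  by (simp add: apply_on_def sum_distrib_left mult.assoc)

lemma psd_on_add:
  assumes "psd_on I A" "psd_on I B"
  shows "psd_on I (\<lambda>r s. A r s + B r s)"
  using assms by (simp add: psd_on_def herm_on_iff apply_on_add_left inner_on_add_left)

lemma psd_on_scale:
  assumes "psd_on I A" "0 \<le> c"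
  shows "psd_on I (\<lambda>r s. of_real c * A r s)"
  using assms by (simp add: psd_on_def herm_on_iff apply_on_scale_left inner_on_scale_left)

lemma psd_on_diag:
  assumes "finite I" "psd_on I A" "r \<in> I"
  shows "0 \<le> Re (A r r)"
proof -
  have "0 \<le> Re (quad_form I A (basis_fun r))"
    using assms(2) by (simp add: psd_on_def)
  then show ?thesis using assms by (simp add: apply_basis_fun inner_basis_fun)
qed

text \<open>Test the form on e_r - z e_s, where the phase \<open>z\<close> turns
  \<open>A r s\<close> into its modulus. This is what bounds a family of positive matrices once the
  diagonals are bounded.\<close>

lemma psd_on_entry_le:
  assumes fin: "finite I" and A: "psd_on I A" and rs: "r \<in> I" "s \<in> I"
  shows "cmod (A r s) \<le> (Re (A r r) + Re (A s s)) / 2"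
proof -
  define z where "z = (if A r s = 0 then 1 else cnj (A r s) / of_real (cmod (A r s)))"
  have z: "cmod z = 1" "z * A r s = of_real (cmod (A r s))"
    by (auto simp: z_def norm_divide complex_norm_square [symmetric] power2_eq_square mult.commute
        [of "cnj _"])
  have zz: "cnj z * z = 1"
    using z(1) by (metis complex_norm_square mult.commute of_real_1 power_one)
  have rs': "cnj z * A s r = of_real (cmod (A r s))"
  proof -
    have "A s r = cnj (A r s)"
      using A rs unfolding psd_on_def herm_on_def by blast
    then show ?thesis using arg_cong [OF z(2), of cnj] by simp
  qed
  let ?v = "\<lambda>i. basis_fun r i - z * basis_fun s i"
  have "quad_form I A ?v = A r r - z * A r s - cnj z * A s r + cnj z * z * A s s"
    unfolding apply_on_diff apply_on_scale inner_on_diff_left inner_on_diff_right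
      inner_on_scale_left inner_on_scale_right
    by (simp add: apply_basis_fun inner_basis_fun fin rs algebra_simps)
  then have "Re (quad_form I A ?v) = Re (A r r) + Re (A s s) - 2 * cmod (A r s)"
    by (simp add: z(2) rs' zz)
  moreover have "0 \<le> Re (quad_form I A ?v)" using A by (simp add: psd_on_def)
  ultimately show ?thesis by simp
qed

lemma psd_on_rank_one: "psd_on I (\<lambda>r s. w r * cnj (w s))"
proof -
  have "apply_on I (\<lambda>r s. w r * cnj (w s)) v = (\<lambda>i. inner_on I v w * w i)" for v
    unfolding apply_on_def inner_on_def sum_distrib_right by (simp add: algebra_simps)
  then have "quad_form I (\<lambda>r s. w r * cnj (w s)) v = of_real ((cmod (inner_on I v w))\<^sup>2)" for v
    by (simp only: inner_on_scale_left complex_norm_square inner_on_cnj)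
  then show ?thesis
    unfolding psd_on_def herm_on_def by simp
qed

lemma psd_on_cong:
  assumes "psd_on I A" "\<And>r s. r \<in> I \<Longrightarrow> s \<in> I \<Longrightarrow> A r s = B r s"
  shows "psd_on I B"
proof -
  have "quad_form I B v = quad_form I A v" for v
    using assms(2) by (intro inner_on_cong) (simp_all add: apply_on_def)
  then show ?thesis using assms by (simp add: psd_on_def herm_on_iff)
qed

lemma psd_on_zero: "psd_on I (\<lambda>_ _. 0)"
  by (simp add: psd_on_def herm_on_def apply_on_def inner_on_def)

lemma closed_psd:
  assumes "\<And>r s. continuous_on UNIV (\<lambda>P. A P r s)"
  shows "closed {P. psd_on I (A P)}"
  unfolding psd_on_def herm_on_def inner_on_def apply_on_def Ball_def
  by (intro closed_Collect_conj closed_Collect_all closed_Collect_imp closed_Collect_eq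
      closed_Collect_le continuous_intros assms) auto

text \<open>The entrywise conjugate of the tuple \<open>- B\<^sub>0\<^sup>-\<^sup>1\<^sup>/\<^sup>2 B\<^sub>j B\<^sub>0\<^sup>-\<^sup>1\<^sup>/\<^sup>2 / sqrt d\<close> is a column contraction;
  the polar condition is tested on the vector \<open>B\<^sub>0\<^sup>1\<^sup>/\<^sup>2\<close>.\<close>

lemma polar_column_separation:
  fixes X B :: "'d::finite \<Rightarrow> 'a \<Rightarrow> 'a \<Rightarrow> complex"
  assumes fin: "finite I"
    and polar: "\<And>A u. (\<And>j. herm_on I (A j)) \<Longrightarrow> column_contraction I A \<Longrightarrow>
      Re (tens_form I I A X u) \<le> normsq (I \<times> I) u"
    and B0: "herm_on I B0" and B: "\<And>j. herm_on I (B j)"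
    and pos: "\<And>v. normsq I v \<noteq> 0 \<Longrightarrow> 0 < Re (quad_form I B0 v)"
    and dom: "\<And>j v. \<bar>Re (quad_form I (B j) v)\<bar> \<le> Re (quad_form I B0 v)"
  shows "0 \<le> (\<Sum>r\<in>I. Re (B0 r r))
    + (\<Sum>j\<in>UNIV. \<Sum>r\<in>I. \<Sum>s\<in>I. Re (X j r s * cnj (B j r s))) / sqrt (real CARD('d))"
proof -
  let ?d = "sqrt (real CARD('d))"
  have d: "0 < ?d" by simp
  obtain R S where R: "\<And>r s. cnj (R r s) = R s r" and S: "\<And>r s. cnj (S r s) = S s r"
    and RR: "\<And>r s. r \<in> I \<Longrightarrow> s \<in> I \<Longrightarrow> B0 r s = (\<Sum>t\<in>I. R r t * R t s)"
    and RS: "\<And>r s. r \<in> I \<Longrightarrow> s \<in> I \<Longrightarrow> (\<Sum>t\<in>I. R r t * S t s) = (if r = s then 1 else 0)"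
    and SR: "\<And>r s. r \<in> I \<Longrightarrow> s \<in> I \<Longrightarrow> (\<Sum>t\<in>I. S r t * R t s) = (if r = s then 1 else 0)"
    by (rule pos_def_sqrt_inverse [OF fin B0 pos]) auto
  have S_herm: "herm_on I S" and R_herm: "herm_on I R" using R S by (auto intro: herm_onI_cnj)
  define C where "C j = mat_prod I S (mat_prod I (B j) S)" for j
  \<comment> \<open>Dividing by \<open>sqrt d\<close> makes \<open>d\<close> contractions a column
    contraction. The conjugate converts the bilinear pairing at the entangled vector into the trace
    pairing, and the sign turns the upper bound of the polar into a lower bound.\<close>
  define A where "A j r s = of_real (- 1 / ?d) * cnj (C j r s)" for j r s
  have C_cnj: "cnj (C j r s) = C j s r" for j r s
  proof -
    have "cnj (C j r s) = (\<Sum>t\<in>I. \<Sum>k\<in>I. S t r * (B j k t * S s k))"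
      by (simp add: C_def mat_prod_def S sum_distrib_left herm_on_cnj [OF B])
    also have "\<dots> = (\<Sum>k\<in>I. \<Sum>t\<in>I. S t r * (B j k t * S s k))" by (rule sum.swap)
    also have "\<dots> = C j s r"
      unfolding C_def mat_prod_def sum_distrib_left
      by (intro sum.cong refl) (simp add: algebra_simps)
    finally show ?thesis .
  qed
  then have C_herm: "herm_on I (C j)" for j by (rule herm_onI_cnj)
  have RS_id: "apply_on I R (apply_on I S v) i = v i" if "i \<in> I" for v i
  proof -
    have "apply_on I R (apply_on I S v) i = (\<Sum>k\<in>I. (if i = k then 1 else 0) * v k)"
      unfolding apply_mat_prod [symmetric]
      using that by (simp add: apply_on_def mat_prod_def RS)
    then show ?thesis using that fin by (simp add: if_distrib [of "\<lambda>x. x * _"] cong: if_cong)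
  qed
  \<comment> \<open>At \<open>apply_on I S v\<close> the form of \<open>B0\<close> equals |v|^2,
    because \<open>B0\<close> is the square of \<open>R\<close> and \<open>S\<close> inverts
    \<open>R\<close>; \<open>dom\<close> then bounds the form of \<open>C j\<close> by
    |v|^2.\<close>
  have C_bound: "\<bar>Re (quad_form I (C j) v)\<bar> \<le> 1 * normsq I v" for j v
  proof -
    let ?w = "apply_on I S v"
    have "quad_form I (C j) v = quad_form I (B j) ?w"
      unfolding C_def apply_mat_prod by (rule herm_on_inner [OF S_herm])
    moreover have "quad_form I B0 ?w = of_real (normsq I v)"
    proof -
      have "quad_form I B0 ?w = quad_form I (mat_prod I R R) ?w"
        by (intro inner_on_cong) (simp_all add: apply_on_def mat_prod_def RR)
      also have "\<dots> = inner_on I (apply_on I R ?w) (apply_on I R ?w)"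
        unfolding apply_mat_prod by (rule herm_on_inner [OF R_herm])
      also have "\<dots> = inner_on I v v" by (rule inner_on_cong) (simp_all add: RS_id)
      finally show ?thesis by (simp only: inner_on_self)
    qed
    ultimately show ?thesis using dom [of j ?w] by simp
  qed
  have "column_contraction I A"
    unfolding column_contraction_def
  proof
    fix v :: "'a \<Rightarrow> complex"
    let ?v = "\<lambda>i. cnj (v i)"
    have "normsq I (apply_on I (A j) v) \<le> normsq I v / real CARD('d)" for j
    proof -
      have "apply_on I (A j) v = (\<lambda>i. of_real (- 1 / ?d) * cnj (apply_on I (C j) ?v i))"
        unfolding A_def apply_on_scale_left apply_on_cnj ..
      then have "normsq I (apply_on I (A j) v) = normsq I (apply_on I (C j) ?v) / real CARD('d)"
        by (simp only: normsq_scale normsq_cnj) (simp add: norm_divide power_divide)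
      also have "normsq I (apply_on I (C j) ?v) \<le> 1\<^sup>2 * normsq I ?v"
        by (rule herm_on_normsq_apply_le [OF C_herm _ C_bound]) simp
      finally show ?thesis by (simp add: normsq_cnj divide_right_mono)
    qed
    then have "(\<Sum>j\<in>UNIV. normsq I (apply_on I (A j) v))
        \<le> (\<Sum>j\<in>(UNIV :: 'd set). normsq I v / real CARD('d))"
      by (rule sum_mono)
    then show "(\<Sum>j\<in>UNIV. normsq I (apply_on I (A j) v)) \<le> normsq I v" by simp
  qed
  moreover have "herm_on I (A j)" for j
    by (rule herm_onI_cnj) (simp add: A_def C_cnj)
  ultimately have le: "Re (tens_form I I A X (\<lambda>p. R (snd p) (fst p)))
      \<le> normsq (I \<times> I) (\<lambda>p. R (snd p) (fst p))"
    by (intro polar)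
  \<comment> \<open>Sandwiching between the roots undoes the normalisation: R C_j R = (R S) B_j (S
    R) = B_j.\<close>
  have AR: "inner_on I (apply_on I (A j) (R t)) (R s) = of_real (- 1 / ?d) * cnj (B j s t)"
    if "s \<in> I" "t \<in> I" for j s t
  proof -
    have SBR: "mat_prod I (B j) (mat_prod I S R) k t = B j k t" if "k \<in> I" for k
      using that \<open>t \<in> I\<close> fin by (simp add: mat_prod_def SR if_distrib [of "\<lambda>x. _ * x"] cong: if_cong)
    have RSB: "mat_prod I (mat_prod I R S) (B j) s t = B j s t"
      using that fin by (simp add: mat_prod_def RS if_distrib [of "\<lambda>x. x * _"] cong: if_cong)
    have "apply_on I (A j) (R t) = (\<lambda>i. of_real (- 1 / ?d) * cnj (apply_on I (C j) (\<lambda>k. R k t) i))"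
      unfolding A_def apply_on_scale_left apply_on_cnj by (simp add: R)
    moreover have "inner_on I (\<lambda>i. cnj (apply_on I (C j) (\<lambda>k. R k t) i)) (R s)
        = cnj (mat_prod I R (mat_prod I (C j) R) s t)"
      by (simp add: inner_on_def apply_on_def mat_prod_def mult.commute)
    moreover have "mat_prod I R (mat_prod I (C j) R) s t
        = mat_prod I (mat_prod I R S) (mat_prod I (B j) (mat_prod I S R)) s t"
      by (simp only: C_def mat_prod_assoc)
    moreover have "\<dots> = mat_prod I (mat_prod I R S) (B j) s t"
      unfolding mat_prod_def [of I "mat_prod I R S"] by (intro sum.cong refl) (simp add: SBR)
    ultimately show ?thesis by (simp only: inner_on_scale_left RSB)
  qed
  have "tens_form I I A X (\<lambda>p. R (snd p) (fst p))
      = (\<Sum>t\<in>I. \<Sum>s\<in>I. \<Sum>j\<in>UNIV. of_real (- 1 / ?d) * (X j s t * cnj (B j s t)))"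
    unfolding inner_tens_entangled [OF fin] by (intro sum.cong refl) (simp add: AR)
  also have "\<dots> = (\<Sum>j\<in>UNIV. \<Sum>s\<in>I. \<Sum>t\<in>I. of_real (- 1 / ?d) * (X j s t * cnj (B j s t)))"
    by (subst sum_rotate) (intro sum.cong refl sum.swap)
  also have "\<dots> = of_real (- 1 / ?d) * (\<Sum>j\<in>UNIV. \<Sum>r\<in>I. \<Sum>s\<in>I. X j r s * cnj (B j r s))"
    by (simp only: sum_distrib_left)
  finally have "Re (tens_form I I A X (\<lambda>p. R (snd p) (fst p)))
      = - 1 / ?d * (\<Sum>j\<in>UNIV. \<Sum>r\<in>I. \<Sum>s\<in>I. Re (X j r s * cnj (B j r s)))"
    by (simp only: times_complex.sel Re_sum Re_complex_of_real Im_complex_of_real mult_zero_left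
        diff_zero)
  moreover have "normsq (I \<times> I) (\<lambda>p. R (snd p) (fst p)) = (\<Sum>r\<in>I. Re (B0 r r))"
  proof -
    have "complex_of_real (normsq (I \<times> I) (\<lambda>p. R (snd p) (fst p))) = (\<Sum>r\<in>I. B0 r r)"
      unfolding normsq_def sum.cartesian_product' of_real_sum complex_norm_square
      by (simp add: R RR mult.commute)
    then show ?thesis by (metis Re_complex_of_real Re_sum)
  qed
  ultimately show ?thesis using le by simp
qed

lemma inner_on_option_prod:
  fixes R :: "'d::finite option \<times> 'a \<times> 'a \<Rightarrow> complex"
  shows "inner_on (UNIV \<times> I \<times> I) L R
    = (\<Sum>r\<in>I. \<Sum>s\<in>I. L (None, r, s) * cnj (R (None, r, s)))
      + (\<Sum>j\<in>UNIV. \<Sum>r\<in>I. \<Sum>s\<in>I. L (Some j, r, s) * cnj (R (Some j, r, s)))"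
proof -
  have "(\<Sum>x\<in>UNIV. f x) = f None + (\<Sum>j\<in>UNIV. f (Some j))" for f :: "'d option \<Rightarrow> complex"
    unfolding UNIV_option_conv by (simp add: sum.reindex)
  then show ?thesis unfolding inner_on_def sum.cartesian_product' by simp
qed

text \<open>Pairing with a rank one evaluates a quadratic form, so an inequality tested on rank ones
  becomes positivity.\<close>

lemma inner_rank_one:
  "(\<Sum>r\<in>I. \<Sum>s\<in>I. (w r * cnj (w s)) * cnj (B r s)) = cnj (quad_form I B w)"
  unfolding inner_on_def apply_on_def sum_distrib_right cnj_sum
  by (intro sum.cong refl) (simp add: algebra_simps)

text \<open>The residual \<open>(B\<^sub>0, B\<^sub>j)\<close> of a best approximate solution \<open>P\<close> satisfies \<open>B\<^sub>0 \<ge> \<plusminus>B\<^sub>j\<close>. If it is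
  nonzero, the separation is strict, so \<open>B\<^sub>0\<close> can be made invertible by adding a small multiple of
  the identity.\<close>

theorem polar_column_decomposition:
  fixes X :: "'d::finite \<Rightarrow> 'a \<Rightarrow> 'a \<Rightarrow> complex"
  assumes fin: "finite I" and X: "\<And>j. herm_on I (X j)"
    and polar: "\<And>A u. (\<And>j. herm_on I (A j)) \<Longrightarrow> column_contraction I A \<Longrightarrow>
      Re (tens_form I I A X u) \<le> normsq (I \<times> I) u"
  obtains P where "\<And>j b. psd_on I (P j b)"
    "\<And>r s. r \<in> I \<Longrightarrow> s \<in> I \<Longrightarrow> (\<Sum>j\<in>UNIV. P j True r s + P j False r s) = (if r = s then 1 else 0)"
    "\<And>j r s. r \<in> I \<Longrightarrow> s \<in> I \<Longrightarrow>
      X j r s = of_real (sqrt (real CARD('d))) * (P j True r s - P j False r s)"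
proof -
  let ?d = "sqrt (real CARD('d))"
  let ?T = "UNIV \<times> I \<times> I :: ('d option \<times> 'a \<times> 'a) set"
  \<comment> \<open>The decomposition is the feasibility problem \<open>L P = y\<close> over this
    cone: the coordinate \<open>None\<close> carries the total sum, which should be the identity,
    and \<open>Some j\<close> the difference, which should be X_j divided by
    \<open>sqrt d\<close>.\<close>
  define K where "K = {P :: 'd \<times> bool \<times> 'a \<times> 'a \<Rightarrow> complex.
    (\<forall>j b. psd_on I (\<lambda>r s. P (j, b, r, s))) \<and> (\<forall>j b r s. r \<notin> I \<or> s \<notin> I \<longrightarrow> P (j, b, r, s) = 0)}"
  define L where "L P t = (case t of (None, r, s) \<Rightarrow> \<Sum>j\<in>UNIV. P (j, True, r, s) + P (j, False, r, s)
    | (Some j, r, s) \<Rightarrow> P (j, True, r, s) - P (j, False, r, s))"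
    for P :: "'d \<times> bool \<times> 'a \<times> 'a \<Rightarrow> complex" and t :: "'d option \<times> 'a \<times> 'a"
  define y where "y t = (case t of (None, r, s) \<Rightarrow> if r = s then 1
      else 0 | (Some j, r, s) \<Rightarrow> X j r s / of_real ?d)"
    for t :: "'d option \<times> 'a \<times> 'a"
  have L_simps [simp]: "L P (None, r, s) = (\<Sum>j\<in>UNIV. P (j, True, r, s) + P (j, False, r, s))"
    "L P (Some j, r, s) = P (j, True, r, s) - P (j, False, r, s)" for P r s j
    by (simp_all add: L_def)
  have y_simps [simp]: "y (None, r, s) = (if r = s then 1 else 0)" "y (Some j, r, s)
      = X j r s / of_real ?d" for r s j
    by (simp_all add: y_def)
  \<comment> \<open>A residual of squared norm at most \<open>b\<close> puts each diagonal entry of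
    the total sum within \<open>sqrt b\<close> of 1. The summands have nonnegative diagonals, so
    each of these is bounded as well, and the diagonals bound all entries.\<close>
  have bdd: "\<exists>M. \<forall>P\<in>K. normsq ?T (\<lambda>t. L P t - y t) \<le> b \<longrightarrow> (\<forall>i. cmod (P i) \<le> M)" for b
  proof (intro exI ballI impI allI)
    fix P :: "'d \<times> bool \<times> 'a \<times> 'a \<Rightarrow> complex" and i :: "'d \<times> bool \<times> 'a \<times> 'a"
    assume P: "P \<in> K" and le: "normsq ?T (\<lambda>t. L P t - y t) \<le> b"
    have b: "0 \<le> b" using le normsq_nonneg order_trans by blast
    have psd: "psd_on I (\<lambda>r s. P (j, b, r, s))" for j b using P by (simp add: K_def)
    have diag: "Re (P (j, c, r, r)) \<le> 1 + sqrt b" if "r \<in> I" for j c r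
    proof -
      have nonneg: "0 \<le> Re (P (j, c, r, r))" for j c using psd_on_diag [OF fin psd \<open>r \<in> I\<close>] .
      have "Re (P (j, c, r, r)) \<le> Re (P (j, True, r, r) + P (j, False, r, r))"
        using nonneg [of j True] nonneg [of j False] by (cases c) auto
      also have "\<dots> \<le> (\<Sum>j\<in>UNIV. Re (P (j, True, r, r) + P (j, False, r, r)))"
        by (rule member_le_sum) (use nonneg in auto)
      also have "\<dots> = 1 + Re (L P (None, r, r) - y (None, r, r))" by simp
      also have "Re (L P (None, r, r) - y (None, r, r)) \<le> cmod (L P (None, r, r) - y (None, r, r))"
        by (rule complex_Re_le_cmod)
      also have "\<dots> \<le> sqrt b"
      proof (rule real_le_rsqrt)
        have "(cmod (L P (None, r, r) - y (None, r, r)))\<^sup>2 \<le> normsq ?T (\<lambda>t. L P t - y t)"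
          using that fin by (intro cmod_power2_le_normsq [where v = "\<lambda>t. L P t - y t"]) auto
        then show "(cmod (L P (None, r, r) - y (None, r, r)))\<^sup>2 \<le> b" using le by linarith
      qed
      finally show ?thesis by simp
    qed
    obtain j c r s where i: "i = (j, c, r, s)" by (cases i) auto
    show "cmod (P i) \<le> 1 + sqrt b"
    proof (cases "r \<in> I \<and> s \<in> I")
      case True
      then show ?thesis
        using psd_on_entry_le [OF fin psd, of r s j c] diag [of r j c] diag [of s j c] i by simp
    next
      case False
      then have "P i = 0" using P i by (auto simp: K_def)
      then show ?thesis using b by simp
    qed
  qed
  have L_cont: "continuous_on UNIV (\<lambda>P. L P t)" for t
    by (cases t; cases "fst t") (auto intro!: continuous_intros)
  have "closed K"
    unfolding K_def
    by (intro closed_Collect_conj closed_Collect_all closed_Collect_imp closed_psd closed_Collect_eq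
        continuous_intros continuous_on_product_coordinates) auto
  obtain P where P: "P \<in> K"
    and dual: "\<And>Q. Q \<in> K \<Longrightarrow> 0 \<le> Re (inner_on ?T (L Q) (\<lambda>t. L P t - y t))"
    and sep: "Re (inner_on ?T y (\<lambda>t. L P t - y t)) = - normsq ?T (\<lambda>t. L P t - y t)"
  proof (rule cone_best_approximation [OF _ \<open>closed K\<close>, of ?T L y])
    show "L (\<lambda>i. P i + Q i) = (\<lambda>t. L P t + L Q t)" for P Q
    proof
      show "L (\<lambda>i. P i + Q i) t = L P t + L Q t" for t
        by (cases t; cases "fst t") (auto simp: sum.distrib)
    qed
    show "L (\<lambda>i. of_real a * P i) = (\<lambda>t. of_real a * L P t)" for a P
    proof
      show "L (\<lambda>i. of_real a * P i) t = of_real a * L P t" for t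
        by (cases t; cases "fst t") (auto simp: sum_distrib_left algebra_simps)
    qed
  qed (use fin bdd L_cont in \<open>auto simp: K_def psd_on_add psd_on_scale psd_on_zero\<close>)
  let ?R = "\<lambda>t. L P t - y t"
  define B0 where "B0 r s = ?R (None, r, s)" for r s
  define B where "B j r s = ?R (Some j, r, s)" for j r s
  have P_cnj: "cnj (P (j, b, r, s)) = P (j, b, s, r)" if "r \<in> I" "s \<in> I" for j b r s
    using P that by (simp add: K_def psd_on_def herm_on_iff)
  have B0: "herm_on I B0" unfolding B0_def herm_on_iff by (simp add: P_cnj)
  have B: "herm_on I (B j)" for j unfolding B_def herm_on_iff
    by (simp add: P_cnj herm_on_cnj [OF X])
  have dom: "\<bar>Re (quad_form I (B j) w)\<bar> \<le> Re (quad_form I B0 w)" for j w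
  proof -
    have le: "0 \<le> Re (quad_form I B0 w)
        + (if b then 1 else - 1) * Re (quad_form I (B j) w)" for b
    proof -
      \<comment> \<open>A single rank one in the slot \<open>(j, b)\<close>. The dual inequality at
        \<open>Q\<close> says that the form of \<open>B0\<close>, plus or minus that of
        \<open>B j\<close> according to \<open>b\<close>, is nonnegative at
        \<open>w\<close>.\<close>
      define Q where "Q t = (case t of (j', b', r, s) \<Rightarrow>
        if j' = j \<and> b' = b \<and> r \<in> I \<and> s \<in> I then w r * cnj (w s) else 0)" for t
      have Q_simps: "Q (j', b', r, s) = (if j' = j \<and> b' = b then w r * cnj (w s) else 0)"
        if "r \<in> I" "s \<in> I" for j' b' r s
        using that by (simp add: Q_def)
      have "psd_on I (\<lambda>r s. Q (j', b', r, s))" for j' b'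
      proof (cases "j' = j \<and> b' = b")
        case True
        then show ?thesis by (intro psd_on_cong [OF psd_on_rank_one [of I w]]) (simp add: Q_simps)
      next
        case False
        then have "Q (j', b', r, s) = 0" for r s by (auto simp: Q_def)
        then show ?thesis by (simp add: psd_on_zero)
      qed
      then have "Q \<in> K" by (auto simp: K_def Q_def)
      then have "0 \<le> Re (inner_on ?T (L Q) ?R)" by (rule dual)
      moreover have "inner_on ?T (L Q) ?R
          = (\<Sum>r\<in>I. \<Sum>s\<in>I. (w r * cnj (w s)) * cnj (B0 r s))
            + (\<Sum>j'\<in>UNIV. if j' = j then (if b then 1 else - 1)
                * (\<Sum>r\<in>I. \<Sum>s\<in>I. (w r * cnj (w s)) * cnj (B j' r s)) else 0)"
      proof -
        have 1: "L Q (None, r, s) = w r * cnj (w s)" if "r \<in> I" "s \<in> I" for r s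
          using that by (cases b) (simp_all add: Q_simps)
        have 2: "L Q (Some j', r, s)
            = (if j' = j then (if b then 1 else - 1) * (w r * cnj (w s)) else 0)"
          if "r \<in> I" "s \<in> I" for j' r s
          using that by (simp add: Q_simps)
        have 3: "(\<Sum>r\<in>I. \<Sum>s\<in>I. L Q (Some j', r, s) * cnj (?R (Some j', r, s)))
            = (if j' = j then (if b then 1 else - 1)
                * (\<Sum>r\<in>I. \<Sum>s\<in>I. (w r * cnj (w s)) * cnj (B j' r s)) else 0)" for j'
          by (simp add: 2 B_def sum_distrib_left mult.assoc del: L_simps)
        show ?thesis
          unfolding inner_on_option_prod 3 by (simp add: 1 B0_def del: L_simps)
      qed
      ultimately show ?thesis by (simp add: inner_rank_one split: if_splits)
    qed
    show ?thesis using le [of True] le [of False] by simp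
  qed
  have "normsq ?T ?R = 0"
  proof (rule ccontr)
    assume "normsq ?T ?R \<noteq> 0"
    then have pos: "0 < normsq ?T ?R" using normsq_nonneg [of ?T ?R] by linarith
    \<comment> \<open>Shifting \<open>B0\<close> by \<open>e\<close> times the identity raises its
      trace by \<open>e * card I\<close>, which must stay below the gap \<open>normsq ?T ?R\<close>
      left by \<open>sep\<close>. The \<open>+ 1\<close> covers an empty index set.\<close>
    define e where "e = normsq ?T ?R / (2 * (real (card I) + 1))"
    have e: "0 < e" "e * real (card I) < normsq ?T ?R"
    proof -
      show "0 < e" using pos by (simp add: e_def)
      have "e * (2 * (real (card I) + 1)) = normsq ?T ?R" by (simp add: e_def)
      moreover have "e * (2 * (real (card I) + 1)) = 2 * e + 2 * (e * real (card I))"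
        by (simp add: algebra_simps)
      moreover have "0 \<le> e * real (card I)" using \<open>0 < e\<close> by simp
      ultimately show "e * real (card I) < normsq ?T ?R" using \<open>0 < e\<close> by linarith
    qed
    define B1 where "B1 r s = B0 r s + of_real e * (if r = s then 1 else 0)" for r s
    have app: "apply_on I B1 v i = apply_on I B0 v i + of_real e * v i" if "i \<in> I" for v i
      using that fin unfolding B1_def apply_on_def
      by (simp add: algebra_simps sum.distrib if_distrib [of "\<lambda>x. _ * x"] cong: if_cong)
    have q: "Re (quad_form I B1 v) = Re (quad_form I B0 v) + e * normsq I v" for v
    proof -
      have "quad_form I B1 v = inner_on I (\<lambda>i. apply_on I B0 v i + of_real e * v i) v"
        by (rule inner_on_cong) (simp_all add: app)
      then show ?thesis by (simp add: inner_on_add_left inner_on_scale_left inner_on_self)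
    qed
    have q0: "0 \<le> Re (quad_form I B0 v)" for v
      using dom [of undefined v] by linarith
    have "0 \<le> (\<Sum>r\<in>I. Re (B1 r r)) + (\<Sum>j\<in>UNIV. \<Sum>r\<in>I. \<Sum>s\<in>I. Re (X j r s * cnj (B j r s))) / ?d"
    proof (rule polar_column_separation [OF fin, where X = X and B = B and ?B0.0 = B1])
      show "Re (tens_form I I A X u) \<le> normsq (I \<times> I) u"
        if "\<And>j. herm_on I (A j)" "column_contraction I A" for A u
        using that by (rule polar)
      show "herm_on I B1" using B0 by (auto simp: herm_on_iff B1_def)
      show "0 < Re (quad_form I B1 v)" if "normsq I v \<noteq> 0" for v
      proof -
        have "0 < e * normsq I v" using that e(1) normsq_nonneg [of I v]
          by (intro mult_pos_pos) linarith+
        then show ?thesis using q0 [of v] by (simp add: q)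
      qed
      show "\<bar>Re (quad_form I (B j) v)\<bar> \<le> Re (quad_form I B1 v)" for j v
      proof -
        have "0 \<le> e * normsq I v" using e(1) by simp
        then show ?thesis using dom [of j v] by (simp add: q)
      qed
    qed (rule B)
    moreover have "Re (inner_on ?T y ?R)
        = (\<Sum>r\<in>I. Re (B0 r r)) + (\<Sum>j\<in>UNIV. \<Sum>r\<in>I. \<Sum>s\<in>I. Re (X j r s * cnj (B j r s))) / ?d"
    proof -
      have 1: "(\<Sum>s\<in>I. y (None, r, s) * cnj (?R (None, r, s))) = cnj (B0 r r)" if "r \<in> I" for r
        using that fin by (simp add: B0_def if_distrib [of "\<lambda>x. x * _"] cong: if_cong)
      have 2: "(\<Sum>r\<in>I. \<Sum>s\<in>I. y (Some j, r, s) * cnj (?R (Some j, r, s)))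
          = (\<Sum>r\<in>I. \<Sum>s\<in>I. X j r s * cnj (B j r s)) / of_real ?d" for j
        by (simp add: B_def sum_divide_distrib)
      have 3: "(\<Sum>r\<in>I. \<Sum>s\<in>I. y (None, r, s) * cnj (?R (None, r, s))) = (\<Sum>r\<in>I. cnj (B0 r r))"
        by (intro sum.cong refl 1)
      show ?thesis
        unfolding inner_on_option_prod 2 3
        by (simp add: sum_divide_distrib [symmetric] del: y_simps)
    qed
    moreover have "(\<Sum>r\<in>I. Re (B1 r r)) = (\<Sum>r\<in>I. Re (B0 r r)) + e * real (card I)"
      by (simp add: B1_def sum.distrib)
    ultimately show False using sep e(2) by linarith
  qed
  then have R0: "L P t = y t" if "t \<in> ?T" for t
    using that fin by (auto simp: normsq_eq_0_iff)
  show thesis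
  proof (rule that [of "\<lambda>j b r s. P (j, b, r, s)"])
    show "psd_on I (\<lambda>r s. P (j, b, r, s))" for j b using P by (simp add: K_def)
    show "(\<Sum>j\<in>UNIV. P (j, True, r, s) + P (j, False, r, s)) = (if r = s then 1 else 0)"
      if "r \<in> I" "s \<in> I" for r s
      using R0 [of "(None, r, s)"] that by simp
    show "X j r s = of_real ?d * (P (j, True, r, s) - P (j, False, r, s))" if "r \<in> I" "s \<in> I"
      for j r s
      using R0 [of "(Some j, r, s)"] that by (simp add: field_simps)
  qed
qed

section \<open>From matrices to functions\<close>

definition entries :: "complex mat \<Rightarrow> nat \<Rightarrow> nat \<Rightarrow> complex" where
  "entries A r s = A $$ (r, s)"

abbreviation entries_tuple :: "('d \<Rightarrow> complex mat) \<Rightarrow> 'd \<Rightarrow> nat \<Rightarrow> nat \<Rightarrow> complex" where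
  "entries_tuple X \<equiv> \<lambda>j. entries (X j)"

lemma mat_adjoint_carrier: "A \<in> carrier_mat n m \<Longrightarrow> mat_adjoint A \<in> carrier_mat m n"
  by (auto simp: mat_adjoint_def)

lemma mat_adjoint_index:
  assumes "i < dim_col A" "j < dim_row A"
  shows "mat_adjoint A $$ (i, j) = cnj (A $$ (j, i))"
  using assms by (simp add: mat_adjoint_def mat_of_rows_index)

lemma hermitian_mat_iff:
  "hermitian_mat n A \<longleftrightarrow> A \<in> carrier_mat n n \<and> herm_on {..<n} (entries A)"
proof -
  have "mat_adjoint A = A \<longleftrightarrow> herm_on {..<n} (entries A)" if A: "A \<in> carrier_mat n n"
  proof
    assume *: "mat_adjoint A = A"
    have "cnj (A $$ (s, r)) = A $$ (r, s)" if "r < n" "s < n" for r s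
      using mat_adjoint_index [of r A s] that A * by auto
    then show "herm_on {..<n} (entries A)" by (simp add: herm_on_iff entries_def)
  next
    assume "herm_on {..<n} (entries A)"
    then show "mat_adjoint A = A"
      using A mat_adjoint_carrier [OF A]
      by (intro eq_matI) (auto simp: mat_adjoint_index herm_on_iff entries_def)
  qed
  then show ?thesis by (auto simp: hermitian_mat_def)
qed

lemma sa_tuples_iff:
  "X \<in> sa_tuples n \<longleftrightarrow> (\<forall>j. X j \<in> carrier_mat n n \<and> herm_on {..<n} (entries (X j)))"
  by (simp add: sa_tuples_def hermitian_mat_iff)

lemma sa_tuples_unique: "X \<in> sa_tuples n \<Longrightarrow> X \<in> sa_tuples m \<Longrightarrow> n = m"
  unfolding sa_tuples_iff by (metis carrier_matD(1))

lemma inner_mult_mat_vec: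
  assumes "A \<in> carrier_mat n n" "v \<in> carrier_vec n" "w \<in> carrier_vec n"
  shows "(A *\<^sub>v v) \<bullet>c w = inner_on {..<n} (apply_on {..<n} (entries A) (($) v)) (($) w)"
  using assms
  by (auto simp: scalar_prod_def inner_on_def apply_on_def entries_def atLeast0LessThan intro!:
      sum.cong)

text \<open>The complex order also asks the form to be real, which is automatic for a Hermitian
  matrix; hence real parts suffice on the right.\<close>

lemma psd_mat_iff: "psd_mat n A \<longleftrightarrow> A \<in> carrier_mat n n \<and> psd_on {..<n} (entries A)"
proof -
  have "(\<forall>v \<in> carrier_vec n. 0 \<le> (A *\<^sub>v v) \<bullet>c v)
      \<longleftrightarrow> (\<forall>v. 0 \<le> Re (inner_on {..<n} (apply_on {..<n} (entries A) v) v))" (is "?l \<longleftrightarrow> ?r")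
    if A: "A \<in> carrier_mat n n" and herm: "herm_on {..<n} (entries A)"
  proof
    assume l: ?l
    show ?r
    proof
      fix v
      have "0 \<le> Re (inner_on {..<n} (apply_on {..<n} (entries A) (($) (vec n v))) (($) (vec n v)))"
        using bspec [OF l, of "vec n v"] A inner_mult_mat_vec [of A n "vec n v" "vec n v"]
        by (simp add: less_eq_complex_def)
      also have "inner_on {..<n} (apply_on {..<n} (entries A) (($) (vec n v))) (($) (vec n v))
          = inner_on {..<n} (apply_on {..<n} (entries A) v) v"
        by (intro inner_on_cong) (simp_all add: apply_on_def)
      finally show "0 \<le> Re (inner_on {..<n} (apply_on {..<n} (entries A) v) v)" .
    qed
  next
    assume ?r
    then show ?l
      using A herm_on_Im_inner [OF herm] by (simp add: inner_mult_mat_vec less_eq_complex_def)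
  qed
  then show ?thesis by (auto simp: psd_mat_def hermitian_mat_iff psd_on_def)
qed

lemma apply_on_identity:
  assumes "finite I" "i \<in> I" "\<And>k. k \<in> I \<Longrightarrow> D i k = (if i = k then 1 else 0)"
  shows "apply_on I D v i = v i"
proof -
  have "apply_on I D v i = (\<Sum>k\<in>I. if i = k then v k else 0)"
    unfolding apply_on_def using assms by (intro sum.cong) auto
  then show ?thesis using assms by simp
qed

lemma loewner_le_one_iff:
  assumes A: "A \<in> carrier_mat n n" and herm: "herm_on {..<n} (entries A)"
  shows "loewner_le n A (1\<^sub>m n) \<longleftrightarrow>
    (\<forall>v. Re (inner_on {..<n} (apply_on {..<n} (entries A) v) v) \<le> normsq {..<n} v)"
proof -
  have app: "apply_on {..<n} (entries (1\<^sub>m n - A)) v i = v i - apply_on {..<n} (entries A) v i"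
    if "i < n" for v i
  proof -
    have "apply_on {..<n} (entries (1\<^sub>m n - A)) v i
        = apply_on {..<n} (entries (1\<^sub>m n)) v i - apply_on {..<n} (entries A) v i"
      unfolding apply_on_def sum_subtractf [symmetric]
      using A that by (intro sum.cong) (simp_all add: entries_def algebra_simps)
    also have "apply_on {..<n} (entries (1\<^sub>m n)) v i = v i"
      using that by (intro apply_on_identity) (simp_all add: entries_def)
    finally show ?thesis .
  qed
  have "inner_on {..<n} (apply_on {..<n} (entries (1\<^sub>m n - A)) v) v
      = of_real (normsq {..<n} v) - inner_on {..<n} (apply_on {..<n} (entries A) v) v" for v
    unfolding inner_on_self [symmetric] inner_on_diff_left [symmetric]
    by (intro inner_on_cong) (simp_all add: app)
  moreover have "herm_on {..<n} (entries (1\<^sub>m n - A))"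
    using herm A by (simp add: herm_on_iff entries_def)
  ultimately show ?thesis
    using A by (auto simp: loewner_le_def psd_mat_iff psd_on_def)
qed

lemma tuple_sum_carrier [simp]: "tuple_sum n F \<in> carrier_mat n n"
  by (simp add: tuple_sum_def)

lemma entries_tuple_sum:
  "r < n \<Longrightarrow> s < n \<Longrightarrow> entries (tuple_sum n F) r s = (\<Sum>j\<in>UNIV. entries (F j) r s)"
  by (simp add: tuple_sum_def entries_def)

lemma herm_on_tuple_sum:
  assumes "\<And>j. herm_on {..<n} (entries (F j))"
  shows "herm_on {..<n} (entries (tuple_sum n F))"
  using assms by (simp add: herm_on_iff entries_tuple_sum)

lemma entries_mult:
  assumes "A \<in> carrier_mat n n" "B \<in> carrier_mat n n" "r < n" "s < n"
  shows "entries (A * B) r s = mat_prod {..<n} (entries A) (entries B) r s"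
  using assms by (auto simp: entries_def mat_prod_def scalar_prod_def atLeast0LessThan)

lemma inner_square_sum:
  assumes X: "X \<in> sa_tuples n"
  shows "inner_on {..<n} (apply_on {..<n} (entries (tuple_sum n (\<lambda>j. X j * X j))) v) v
    = of_real (\<Sum>j\<in>UNIV. normsq {..<n} (apply_on {..<n} (entries (X j)) v))"
proof -
  let ?I = "{..<n}"
  have "quad_form ?I (entries (tuple_sum n (\<lambda>j. X j * X j))) v
      = inner_on ?I (\<lambda>i. \<Sum>j\<in>UNIV. apply_on ?I (mat_prod ?I (entries (X j)) (entries (X j))) v i) v"
  proof (rule inner_on_cong)
    fix i assume "i \<in> ?I"
    then have "apply_on ?I (entries (tuple_sum n (\<lambda>j. X j * X j))) v i
        = (\<Sum>k\<in>?I. \<Sum>j\<in>UNIV. mat_prod ?I (entries (X j)) (entries (X j)) i k * v k)"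
      unfolding apply_on_def using X
      by (intro sum.cong refl)
        (simp add: entries_tuple_sum entries_mult [where n = n] sa_tuples_iff sum_distrib_right)
    also have "\<dots> = (\<Sum>j\<in>UNIV. apply_on ?I (mat_prod ?I (entries (X j)) (entries (X j))) v i)"
      unfolding apply_on_def by (rule sum.swap)
    finally show "apply_on ?I (entries (tuple_sum n (\<lambda>j. X j * X j))) v i
        = (\<Sum>j\<in>UNIV. apply_on ?I (mat_prod ?I (entries (X j)) (entries (X j))) v i)" .
  qed simp
  also have "\<dots> = (\<Sum>j\<in>UNIV. inner_on ?I (apply_on ?I (entries (X j)) v)
      (apply_on ?I (entries (X j)) v))"
    unfolding inner_on_sum_left apply_mat_prod
    using X by (intro sum.cong refl herm_on_inner) (simp add: sa_tuples_iff)
  finally show ?thesis by (simp add: inner_on_self)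
qed

lemma herm_on_square:
  assumes "hermitian_mat n A"
  shows "herm_on {..<n} (entries (A * A))"
proof -
  have A: "A \<in> carrier_mat n n" "herm_on {..<n} (entries A)" using assms
    by (auto simp: hermitian_mat_iff)
  show ?thesis
    unfolding herm_on_iff
  proof (intro ballI)
    fix r s assume "r \<in> {..<n}" "s \<in> {..<n}"
    then show "cnj (entries (A * A) r s) = entries (A * A) s r"
      using A by (simp add: entries_mult [where n
          = n] mat_prod_def herm_on_cnj [OF A(2)] mult.commute)
  qed
qed

lemma mem_ball_B_iff:
  "X \<in> ball_B \<longleftrightarrow> (\<exists>n\<ge>1. X \<in> sa_tuples n \<and> column_contraction {..<n} (entries_tuple X))"
proof -
  have "loewner_le n (tuple_sum n (\<lambda>j. X j * X j)) (1\<^sub>m n)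
      \<longleftrightarrow> column_contraction {..<n} (entries_tuple X)"
    if X: "X \<in> sa_tuples n" for n
  proof -
    have "herm_on {..<n} (entries (X j * X j))" for j
      using X by (intro herm_on_square) (simp add: sa_tuples_def)
    then show ?thesis
      by (simp add: loewner_le_one_iff herm_on_tuple_sum inner_square_sum [OF X]
          column_contraction_def)
  qed
  then show ?thesis by (auto simp: ball_B_def)
qed

section \<open>Pair indices, Kronecker sums and membership in the three sets\<close>

definition pair_code :: "nat \<Rightarrow> nat \<times> nat \<Rightarrow> nat" where
  "pair_code n p = fst p * n + snd p"

lemma pair_code_less: "i < m \<Longrightarrow> r < n \<Longrightarrow> i * n + r < m * (n::nat)"
proof -
  assume "i < m" "r < n"
  then have "i * n + r < Suc i * n" by simp
  also have "\<dots> \<le> m * n" using \<open>i < m\<close> by (intro mult_le_mono1) simp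
  finally show ?thesis .
qed

text \<open>The row-major numbering built into \<open>kron\<close>, \<open>mat_block\<close> and
  \<open>ampliation\<close> through \<open>div\<close> and \<open>mod\<close>; it carries all
  statements about pairs over to matrices.\<close>

lemma bij_betw_pair_code: "bij_betw (pair_code n) ({..<m} \<times> {..<n}) {..<m * n}"
proof (rule bij_betw_byWitness [where f' = "\<lambda>k. (k div n, k mod n)"])
  show "\<forall>p\<in>{..<m} \<times> {..<n}. (pair_code n p div n, pair_code n p mod n) = p"
    by (auto simp: pair_code_def)
  show "\<forall>k\<in>{..<m * n}. pair_code n (k div n, k mod n) = k"
    by (simp add: pair_code_def)
  show "pair_code n ` ({..<m} \<times> {..<n}) \<subseteq> {..<m * n}"
    by (auto simp: pair_code_def pair_code_less)
  show "(\<lambda>k. (k div n, k mod n)) ` {..<m * n} \<subseteq> {..<m} \<times> {..<n}"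
    by (auto simp: less_mult_imp_div_less)
        (metis mod_less_divisor mult_0_right not_less_zero neq0_conv)
qed

lemma inner_on_reindex:
  assumes "bij_betw h J I"
  shows "inner_on I u v = inner_on J (\<lambda>p. u (h p)) (\<lambda>p. v (h p))"
  unfolding inner_on_def by (rule sum.reindex_bij_betw [OF assms, symmetric])

lemma normsq_reindex:
  assumes "bij_betw h J I"
  shows "normsq I u = normsq J (\<lambda>p. u (h p))"
  unfolding normsq_def by (rule sum.reindex_bij_betw [OF assms, symmetric])

lemma apply_on_reindex:
  assumes "bij_betw h J I"
  shows "apply_on I A u (h q) = apply_on J (\<lambda>p q. A (h p) (h q)) (\<lambda>p. u (h p)) q"
  unfolding apply_on_def by (rule sum.reindex_bij_betw [OF assms, symmetric])

text \<open>Composition with \<open>h\<close> need not produce every total function, but it produces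
  all possible values on \<open>J\<close>, and by \<open>cong\<close> nothing else matters to
  \<open>Q\<close>.\<close>

lemma all_reindex_iff:
  assumes "bij_betw h J I"
    and cong: "\<And>v w. (\<And>i. i \<in> J \<Longrightarrow> v i = w i) \<Longrightarrow> Q v \<longleftrightarrow> Q w"
  shows "(\<forall>u. Q (\<lambda>p. u (h p))) \<longleftrightarrow> (\<forall>w. Q w)"
proof (intro iffI allI)
  fix w assume *: "\<forall>u. Q (\<lambda>p. u (h p))"
  have "Q (\<lambda>p. (\<lambda>i. w (the_inv_into J h i)) (h p)) \<longleftrightarrow> Q w"
    using assms(1) by (intro cong) (simp add: the_inv_into_f_f bij_betw_def)
  then show "Q w" using *[THEN spec, of "\<lambda>i. w (the_inv_into J h i)"] by blast
qed blast

lemma entries_kron_sum: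
  assumes "\<And>j. A j \<in> carrier_mat m m" "\<And>j. X j \<in> carrier_mat n n"
    and "p \<in> {..<m} \<times> {..<n}" "q \<in> {..<m} \<times> {..<n}"
  shows "entries (tuple_sum (m * n) (\<lambda>j. kron (A j) (X j))) (pair_code n p) (pair_code n q)
    = tens (entries_tuple A) (entries_tuple X) p q"
proof -
  have "pair_code n p < m * n" "pair_code n q < m * n"
    using assms(3,4) by (auto simp: pair_code_def pair_code_less)
  moreover have "pair_code n p div n = fst p" "pair_code n p mod n = snd p"
    "pair_code n q div n = fst q" "pair_code n q mod n = snd q"
    using assms(3,4) by (auto simp: pair_code_def)
  moreover have "dim_row (A j) = m" "dim_col (A j) = m" "dim_row (X j) = n" "dim_col (X j) = n"
    for j
    using assms(1,2) [of j] by auto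
  ultimately show ?thesis
    by (simp add: tuple_sum_def entries_def tens_def kron_def)
qed

lemma apply_kron_sum:
  assumes "\<And>j. A j \<in> carrier_mat m m" "\<And>j. X j \<in> carrier_mat n n" and q: "q \<in> {..<m} \<times> {..<n}"
  shows "apply_on {..<m * n} (entries (tuple_sum (m * n) (\<lambda>j. kron (A j) (X j)))) u (pair_code n q)
    = apply_on ({..<m} \<times> {..<n}) (tens (entries_tuple A) (entries_tuple X))
        (\<lambda>p. u (pair_code n p)) q"
  unfolding apply_on_reindex [OF bij_betw_pair_code]
  unfolding apply_on_def
  using assms by (intro sum.cong refl) (simp add: entries_kron_sum)

lemma herm_on_kron_sum:
  assumes "A \<in> sa_tuples m" "X \<in> sa_tuples n"
  shows "herm_on {..<m * n} (entries (tuple_sum (m * n) (\<lambda>j. kron (A j) (X j))))"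
  unfolding herm_on_iff
proof (intro ballI)
  fix r s assume "r \<in> {..<m * n}" "s \<in> {..<m * n}"
  then have "r \<in> pair_code n ` ({..<m} \<times> {..<n})" "s \<in> pair_code n ` ({..<m} \<times> {..<n})"
    by (simp_all only: bij_betw_imp_surj_on [OF bij_betw_pair_code])
  then obtain p q where pq: "p \<in> {..<m} \<times> {..<n}" "q \<in> {..<m} \<times> {..<n}" "r = pair_code n p" "s
      = pair_code n q"
    by (elim imageE)
  then have 1: "fst p < m" "snd p < n" "fst q < m" "snd q < n" by auto
  have A: "\<And>j. A j \<in> carrier_mat m m" "\<And>j. herm_on {..<m} (entries (A j))"
    and X: "\<And>j. X j \<in> carrier_mat n n" "\<And>j. herm_on {..<n} (entries (X j))"
    using assms by (auto simp: sa_tuples_iff)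
  show "cnj (entries (tuple_sum (m * n) (\<lambda>j. kron (A j) (X j))) r s)
      = entries (tuple_sum (m * n) (\<lambda>j. kron (A j) (X j))) s r"
    unfolding pq(3,4) entries_kron_sum [OF A(1) X(1) pq(1,2)] entries_kron_sum
        [OF A(1) X(1) pq(2,1)]
    by (simp add: tens_def herm_on_cnj [OF A(2)] herm_on_cnj [OF X(2)] 1)
qed

lemma loewner_kron_iff:
  assumes A: "A \<in> sa_tuples m" and X: "X \<in> sa_tuples n"
  shows "loewner_le (m * n) (tuple_sum (m * n) (\<lambda>j. kron (A j) (X j))) (1\<^sub>m (m * n)) \<longleftrightarrow>
    (\<forall>u. Re (tens_form {..<m} {..<n} (entries_tuple A) (entries_tuple X) u)
      \<le> normsq ({..<m} \<times> {..<n}) u)" (is "_ \<longleftrightarrow> (\<forall>u. ?Q u)")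
proof -
  let ?P = "{..<m} \<times> {..<n}" and ?T = "tens (entries_tuple A) (entries_tuple X)"
  have c: "\<And>j. A j \<in> carrier_mat m m" "\<And>j. X j \<in> carrier_mat n n"
    using assms by (auto simp: sa_tuples_iff)
  have "inner_on {..<m * n}
      (apply_on {..<m * n} (entries (tuple_sum (m * n) (\<lambda>j. kron (A j) (X j)))) u) u
      = quad_form ?P ?T (\<lambda>p. u (pair_code n p))" for u
    unfolding inner_on_reindex [OF bij_betw_pair_code]
    by (intro inner_on_cong) (simp_all add: apply_kron_sum c)
  then have "loewner_le (m * n) (tuple_sum (m * n) (\<lambda>j. kron (A j) (X j))) (1\<^sub>m (m * n))
      \<longleftrightarrow> (\<forall>u. ?Q (\<lambda>p. u (pair_code n p)))"
    by (simp add: loewner_le_one_iff herm_on_kron_sum [OF assms] normsq_reindex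
        [OF bij_betw_pair_code, of m n])
  also have "\<dots> \<longleftrightarrow> (\<forall>u. ?Q u)"
  proof (rule all_reindex_iff [OF bij_betw_pair_code])
    fix v w :: "nat \<times> nat \<Rightarrow> complex" assume vw: "\<And>i. i \<in> ?P \<Longrightarrow> v i = w i"
    have "apply_on ?P ?T v = apply_on ?P ?T w"
      unfolding apply_on_def using vw by (intro ext sum.cong) auto
    then have "quad_form ?P ?T v = quad_form ?P ?T w"
      using vw by (intro inner_on_cong) auto
    then show "?Q v \<longleftrightarrow> ?Q w" using normsq_cong [of ?P v w] vw by simp
  qed
  finally show ?thesis .
qed

lemma mem_polar_dual_iff:
  "X \<in> polar_dual S \<longleftrightarrow> (\<exists>n\<ge>1. X \<in> sa_tuples n \<and> (\<forall>m\<ge>1. \<forall>A\<in>S \<inter> sa_tuples m. \<forall>u.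
    Re (tens_form {..<m} {..<n} (entries_tuple A) (entries_tuple X) u)
      \<le> normsq ({..<m} \<times> {..<n}) u))"
  unfolding polar_dual_def by (auto simp: loewner_kron_iff)

text \<open>A crude constant suffices: it makes the supremum in \<open>mat_op_norm\<close> one of a
  bounded set, and it shows that a Hermitian matrix becomes positive after adding a large multiple
  of the identity.\<close>

lemma normsq_apply_le:
  assumes "finite I"
  shows "normsq I (apply_on I A v) \<le> (\<Sum>i\<in>I. (\<Sum>k\<in>I. cmod (A i k))\<^sup>2) * normsq I v"
proof -
  have v: "cmod (v k) \<le> sqrt (normsq I v)" if "k \<in> I" for k
    by (rule real_le_rsqrt) (rule cmod_power2_le_normsq [OF assms that])
  have "(cmod (apply_on I A v i))\<^sup>2 \<le> (\<Sum>k\<in>I. cmod (A i k))\<^sup>2 * normsq I v" for i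
  proof -
    have "cmod (apply_on I A v i) \<le> (\<Sum>k\<in>I. cmod (A i k) * sqrt (normsq I v))"
      unfolding apply_on_def
      by (rule order_trans [OF norm_sum sum_mono]) (simp add: norm_mult v mult_left_mono)
    then have "cmod (apply_on I A v i) \<le> (\<Sum>k\<in>I. cmod (A i k)) * sqrt (normsq I v)"
      by (simp add: sum_distrib_right)
    then have "(cmod (apply_on I A v i))\<^sup>2 \<le> ((\<Sum>k\<in>I. cmod (A i k)) * sqrt (normsq I v))\<^sup>2"
      by (intro power_mono) auto
    then show ?thesis by (simp add: power_mult_distrib)
  qed
  then show ?thesis
    unfolding normsq_def [of I "apply_on I A v"] sum_distrib_right by (intro sum_mono)
qed

lemma cvec_norm_eq: "v \<in> carrier_vec n \<Longrightarrow> cvec_norm v = sqrt (normsq {..<n} (($) v))"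
  unfolding cvec_norm_def normsq_def scalar_prod_def
  by (auto simp: atLeast0LessThan complex_norm_square [symmetric] Re_power2 intro!: sum.cong)

lemma cvec_norm_mult:
  assumes "A \<in> carrier_mat n n" "v \<in> carrier_vec n"
  shows "cvec_norm (A *\<^sub>v v) = sqrt (normsq {..<n} (apply_on {..<n} (entries A) (($) v)))"
proof -
  have "normsq {..<n} (($) (A *\<^sub>v v)) = normsq {..<n} (apply_on {..<n} (entries A) (($) v))"
    using assms
    by (intro normsq_cong) (auto simp: apply_on_def entries_def scalar_prod_def atLeast0LessThan)
  then show ?thesis using cvec_norm_eq [of "A *\<^sub>v v" n] assms by simp
qed

lemma mat_op_norm_le_one_iff:
  assumes A: "A \<in> carrier_mat n n"
  shows "mat_op_norm A \<le> 1 \<longleftrightarrow>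
    (\<forall>u. normsq {..<n} (apply_on {..<n} (entries A) u) \<le> normsq {..<n} u)"
proof
  let ?I = "{..<n}" and ?V = "{v \<in> carrier_vec n. cvec_norm v \<le> 1}"
  let ?C = "\<Sum>i\<in>?I. (\<Sum>k\<in>?I. cmod (entries A i k))\<^sup>2"
  have dim: "dim_col A = n" using A by simp
  have C: "0 \<le> ?C" by (intro sum_nonneg) simp
  assume le: "mat_op_norm A \<le> 1"
  \<comment> \<open>A supremum of reals dominates its members only when the set is bounded above, so
    boundedness has to come first.\<close>
  have "cvec_norm (A *\<^sub>v v) \<le> sqrt ?C" if "v \<in> ?V" for v
  proof -
    have v: "v \<in> carrier_vec n" "normsq ?I (($) v) \<le> 1" using that by (auto simp: cvec_norm_eq)
    have "normsq ?I (apply_on ?I (entries A) (($) v)) \<le> ?C * normsq ?I (($) v)"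
      by (rule normsq_apply_le) simp
    also have "\<dots> \<le> ?C * 1" by (intro mult_left_mono v C)
    finally show ?thesis by (simp add: cvec_norm_mult [OF A v(1)])
  qed
  then have bdd: "bdd_above ((\<lambda>v. cvec_norm (A *\<^sub>v v)) ` ?V)" by (auto intro!: bdd_aboveI2)
  then have unit: "cvec_norm (A *\<^sub>v v) \<le> 1" if "v \<in> ?V" for v
  proof -
    have "cvec_norm (A *\<^sub>v v) \<le> mat_op_norm A"
      unfolding mat_op_norm_def dim using that bdd by (rule cSUP_upper)
    then show ?thesis using le by simp
  qed
  show "\<forall>u. normsq ?I (apply_on ?I (entries A) u) \<le> normsq ?I u"
  proof
    fix u
    show "normsq ?I (apply_on ?I (entries A) u) \<le> normsq ?I u"
    proof (cases "normsq ?I u = 0")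
      case True
      then have "normsq ?I (apply_on ?I (entries A) u) = normsq ?I (\<lambda>_. 0)"
        by (intro normsq_cong) (simp add: normsq_eq_0_iff apply_on_def)
      also have "\<dots> \<le> normsq ?I u" by (simp add: normsq_def sum_nonneg)
      finally show ?thesis .
    next
      case False
      then have pos: "0 < normsq ?I u" using normsq_nonneg [of ?I u] by linarith
      let ?a = "1 / sqrt (normsq ?I u)"
      let ?v = "vec n (\<lambda>i. of_real ?a * u i)"
      have a2: "(cmod (of_real ?a))\<^sup>2 = 1 / normsq ?I u"
        using pos by (simp add: norm_divide power_divide)
      have nv: "normsq ?I (($) ?v) = 1"
      proof -
        have "normsq ?I (($) ?v) = normsq ?I (\<lambda>i. of_real ?a * u i)" by (intro normsq_cong) simp
        then show ?thesis using pos by (simp only: normsq_scale a2) simp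
      qed
      then have "cvec_norm (A *\<^sub>v ?v) \<le> 1" by (intro unit) (simp add: cvec_norm_eq [of _ n])
      then have "normsq ?I (apply_on ?I (entries A) (($) ?v)) \<le> 1"
        using cvec_norm_mult [OF A, of ?v] by simp
      also have "apply_on ?I (entries A) (($) ?v) = apply_on ?I (entries A) (\<lambda>i. of_real ?a * u i)"
        unfolding apply_on_def by (intro ext sum.cong) auto
      finally have "1 / normsq ?I u * normsq ?I (apply_on ?I (entries A) u) \<le> 1"
        unfolding apply_on_scale normsq_scale a2 .
      then show ?thesis using pos by (simp add: field_simps)
    qed
  qed
next
  assume *: "\<forall>u. normsq {..<n} (apply_on {..<n} (entries A) u) \<le> normsq {..<n} u"
  show "mat_op_norm A \<le> 1"
    unfolding mat_op_norm_def
  proof (rule cSUP_least)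
    have "0\<^sub>v n \<in> {v \<in> carrier_vec (dim_col A). cvec_norm v \<le> 1}"
      using A by (simp add: cvec_norm_eq [of _ n] normsq_def)
    then show "{v \<in> carrier_vec (dim_col A). cvec_norm v \<le> 1} \<noteq> {}" by blast
    fix v assume "v \<in> {v \<in> carrier_vec (dim_col A). cvec_norm v \<le> 1}"
    then have v: "v \<in> carrier_vec n" "normsq {..<n} (($) v) \<le> 1" using A
      by (auto simp: cvec_norm_eq)
    then show "cvec_norm (A *\<^sub>v v) \<le> 1"
      using order_trans [OF *[rule_format] v(2)] by (simp add: cvec_norm_mult [OF A])
  qed
qed

lemma entries_mat_conj:
  "A \<in> carrier_mat n n \<Longrightarrow> r < n \<Longrightarrow> s < n \<Longrightarrow> entries (mat_conj A) r s = cnj (entries A r s)"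
  by (simp add: entries_def mat_conj_def)

lemma mat_conj_carrier: "A \<in> carrier_mat n n \<Longrightarrow> mat_conj A \<in> carrier_mat n n"
  by (simp add: mat_conj_def)

lemma mem_ball_D_iff:
  "X \<in> ball_D \<longleftrightarrow> (\<exists>n\<ge>1. X \<in> sa_tuples n \<and> (\<forall>u. normsq ({..<n} \<times> {..<n})
      (apply_on ({..<n} \<times> {..<n}) (tens (entries_tuple X) (\<lambda>j r s. cnj (entries (X j) r s))) u)
    \<le> normsq ({..<n} \<times> {..<n}) u))"
proof -
  have "mat_op_norm (tuple_sum (n * n) (\<lambda>j. kron (X j) (mat_conj (X j)))) \<le> 1 \<longleftrightarrow>
    (\<forall>u. normsq ({..<n} \<times> {..<n})
        (apply_on ({..<n} \<times> {..<n}) (tens (entries_tuple X) (\<lambda>j r s. cnj (entries (X j) r s))) u)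
      \<le> normsq ({..<n} \<times> {..<n}) u)" (is "_ \<longleftrightarrow> (\<forall>u. ?Q u)")
    if X: "X \<in> sa_tuples n" for n
  proof -
    let ?P = "{..<n} \<times> {..<n}" and ?T = "tens (entries_tuple X) (\<lambda>j r s. cnj (entries (X j) r s))"
    have c: "\<And>j. X j \<in> carrier_mat n n" "\<And>j. mat_conj (X j) \<in> carrier_mat n n"
      using X by (auto simp: sa_tuples_iff mat_conj_carrier)
    have "apply_on ?P (tens (entries_tuple X) (\<lambda>j. entries (mat_conj (X j)))) u q
        = apply_on ?P ?T u q"
      if "q \<in> ?P" for u q
      unfolding apply_on_def tens_def
      using that c by (intro sum.cong refl) (auto simp: entries_mat_conj [where n = n])
    then have eq: "normsq {..<n * n} (apply_on {..<n * n}
          (entries (tuple_sum (n * n) (\<lambda>j. kron (X j) (mat_conj (X j))))) u)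
        = normsq ?P (apply_on ?P ?T (\<lambda>p. u (pair_code n p)))" for u
      unfolding normsq_reindex [OF bij_betw_pair_code]
      by (intro normsq_cong) (simp add: apply_kron_sum c)
    then have "mat_op_norm (tuple_sum (n * n) (\<lambda>j. kron (X j) (mat_conj (X j)))) \<le> 1
        \<longleftrightarrow> (\<forall>u. ?Q (\<lambda>p. u (pair_code n p)))"
      unfolding mat_op_norm_le_one_iff [OF tuple_sum_carrier] eq
      by (simp only: normsq_reindex [OF bij_betw_pair_code, of n n])
    also have "\<dots> \<longleftrightarrow> (\<forall>u. ?Q u)"
    proof (rule all_reindex_iff [OF bij_betw_pair_code])
      fix v w :: "nat \<times> nat \<Rightarrow> complex" assume vw: "\<And>i. i \<in> ?P \<Longrightarrow> v i = w i"
      have "apply_on ?P ?T v = apply_on ?P ?T w"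
        unfolding apply_on_def using vw by (intro ext sum.cong) auto
      then show "?Q v \<longleftrightarrow> ?Q w" using normsq_cong [of ?P v w] vw by simp
    qed
    finally show ?thesis .
  qed
  then show ?thesis by (auto simp: ball_D_def)
qed

section \<open>Polar duals and compressions\<close>

lemma sum_lessThan_plus:
  "(\<Sum>k<n + m. f k) = (\<Sum>k<n. f k) + (\<Sum>k<m. f (n + k) :: 'a::comm_monoid_add)" for n m :: nat
  by (induction m) (simp_all add: add_ac)

lemma direct_sum_mat_carrier:
  "A \<in> carrier_mat n n \<Longrightarrow> B \<in> carrier_mat m m \<Longrightarrow> direct_sum_mat A B \<in> carrier_mat (n + m) (n + m)"
  by (auto simp: direct_sum_mat_def Let_def)

lemma entries_direct_sum:
  assumes "A \<in> carrier_mat n n" "B \<in> carrier_mat m m" "r < n + m" "s < n + m"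
  shows "entries (direct_sum_mat A B) r s =
    (if r < n then if s < n then entries A r s else 0
     else if s < n then 0 else entries B (r - n) (s - n))"
  using assms by (auto simp: direct_sum_mat_def Let_def entries_def)

lemma sa_tuples_direct_sum:
  assumes "X \<in> sa_tuples n" "Y \<in> sa_tuples m"
  shows "(\<lambda>j. direct_sum_mat (X j) (Y j)) \<in> sa_tuples (n + m)"
proof -
  have X: "\<And>j. X j \<in> carrier_mat n n" "\<And>j. herm_on {..<n} (entries (X j))"
    and Y: "\<And>j. Y j \<in> carrier_mat m m" "\<And>j. herm_on {..<m} (entries (Y j))"
    using assms by (auto simp: sa_tuples_iff)
  then show ?thesis
    unfolding sa_tuples_iff
    by (auto simp: direct_sum_mat_carrier herm_on_iff entries_direct_sum [OF X(1) Y(1)])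
qed

text \<open>No entry couples the two index ranges, so the forms add up, as do the norms; the polar
  inequalities of \<open>X\<close> and \<open>Y\<close> can then be added.\<close>

lemma tens_direct_sum:
  assumes X: "\<And>j. X j \<in> carrier_mat n n" and Y: "\<And>j. Y j \<in> carrier_mat m m"
  defines "Z \<equiv> \<lambda>j. entries (direct_sum_mat (X j) (Y j))"
  shows "tens_form I {..<n + m} A Z u
    = tens_form I {..<n} A (entries_tuple X) u
      + tens_form I {..<m} A (entries_tuple Y) (\<lambda>p. u (fst p, n + snd p))"
proof -
  have X_part: "apply_on (I \<times> {..<n + m}) (tens A Z) u (i, r)
      = apply_on (I \<times> {..<n}) (tens A (entries_tuple X)) u (i, r)" if "r < n" for i r
    unfolding apply_on_def tens_def sum.cartesian_product' sum_lessThan_plus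
    using that by (simp add: Z_def entries_direct_sum [OF X Y])
  have Y_part: "apply_on (I \<times> {..<n + m}) (tens A Z) u (i, n + r)
      = apply_on (I \<times> {..<m}) (tens A (entries_tuple Y)) (\<lambda>p. u (fst p, n + snd p)) (i, r)"
    if "r < m" for i r
    unfolding apply_on_def tens_def sum.cartesian_product' sum_lessThan_plus
    using that by (simp add: Z_def entries_direct_sum [OF X Y])
  show ?thesis
    unfolding inner_on_def sum.cartesian_product' sum_lessThan_plus
    by (simp add: X_part Y_part sum.distrib)
qed

lemma normsq_direct_sum:
  "normsq (I \<times> {..<n + m :: nat}) u
      = normsq (I \<times> {..<n}) u + normsq (I \<times> {..<m}) (\<lambda>p. u (fst p, n + snd p))"
  unfolding normsq_def sum.cartesian_product' by (simp add: sum_lessThan_plus sum.distrib)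

text \<open>The argument is the shape of a block of I minus the sum of A_j tensor X_j: there
  \<open>c\<close> is 0 or 1, and \<open>a j\<close> is an entry of A_j.\<close>

lemma linear_mat_map_combination:
  assumes lin: "linear_mat_map n k \<phi>" and X: "\<And>j. X j \<in> carrier_mat n n" and "finite J"
  shows "\<phi> (mat n n (\<lambda>(p, q). c * 1\<^sub>m n $$ (p, q) - (\<Sum>j\<in>J. a j * X j $$ (p, q))))
    = mat k k (\<lambda>(p, q). c * \<phi> (1\<^sub>m n) $$ (p, q) - (\<Sum>j\<in>J. a j * \<phi> (X j) $$ (p, q)))"
  using \<open>finite J\<close>
proof (induction J)
  case empty
  have 1: "mat n n (\<lambda>(p, q). c * 1\<^sub>m n $$ (p, q) - (\<Sum>j\<in>{}. a j * X j $$ (p, q))) = c \<cdot>\<^sub>m 1\<^sub>m n"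
    by (intro eq_matI) auto
  have 2: "\<phi> (c \<cdot>\<^sub>m 1\<^sub>m n) = c \<cdot>\<^sub>m \<phi> (1\<^sub>m n)" "\<phi> (1\<^sub>m n) \<in> carrier_mat k k"
    using lin by (simp_all add: linear_mat_map_def)
  show ?case unfolding 1 2(1) using 2(2) by (intro eq_matI) auto
next
  case (insert x J)
  let ?M = "\<lambda>J. mat n n (\<lambda>(p, q). c * 1\<^sub>m n $$ (p, q) - (\<Sum>j\<in>J. a j * X j $$ (p, q)))"
  have 1: "?M (insert x J) = ?M J + (- a x) \<cdot>\<^sub>m X x"
    using insert.hyps X [of x] by (intro eq_matI) (auto simp: algebra_simps)
  have add: "\<And>A B. A \<in> carrier_mat n n \<Longrightarrow> B \<in> carrier_mat n n \<Longrightarrow> \<phi> (A + B) = \<phi> A + \<phi> B"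
    and smult: "\<And>b A. A \<in> carrier_mat n n \<Longrightarrow> \<phi> (b \<cdot>\<^sub>m A) = b \<cdot>\<^sub>m \<phi> A"
    using lin unfolding linear_mat_map_def by blast+
  have 2: "\<phi> (?M J + (- a x) \<cdot>\<^sub>m X x) = \<phi> (?M J) + (- a x) \<cdot>\<^sub>m \<phi> (X x)"
    unfolding smult [OF X, symmetric] by (rule add) (use X in auto)
  have "\<phi> (X x) \<in> carrier_mat k k" using lin X by (simp add: linear_mat_map_def)
  then show ?case
    unfolding 1 2 insert.IH using insert.hyps by (intro eq_matI) (auto simp: algebra_simps)
qed

lemma ampliation_one:
  assumes "linear_mat_map n k \<phi>" "A \<in> carrier_mat n n"
  shows "ampliation 1 n k \<phi> A = \<phi> A"
proof -
  have "mat_block n A 0 0 = A" using assms(2) by (intro eq_matI) (auto simp: mat_block_def)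
  moreover have "\<phi> A \<in> carrier_mat k k" using assms by (simp add: linear_mat_map_def)
  ultimately show ?thesis by (intro eq_matI) (auto simp: ampliation_def)
qed

lemma herm_on_add_scalar_psd:
  assumes fin: "finite I" and A: "herm_on I A"
  obtains t :: real where "psd_on I (\<lambda>r s. A r s + of_real t * (if r = s then 1 else 0))"
proof
  let ?C = "\<Sum>i\<in>I. (\<Sum>k\<in>I. cmod (A i k))\<^sup>2" and ?D = "\<lambda>r s. if r = s then 1 else 0 :: complex"
  \<comment> \<open>From -Re <Av, v> <= (|Av|^2 + |v|^2) / 2 and |Av|^2 <= C |v|^2.\<close>
  let ?t = "(?C + 1) / 2"
  have "0 \<le> Re (quad_form I (\<lambda>r s. A r s + of_real ?t * ?D r s) v)" for v
  proof -
    have "quad_form I (\<lambda>r s. A r s + of_real ?t * ?D r s) v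
        = quad_form I A v + of_real ?t * quad_form I ?D v"
      unfolding apply_on_add_left apply_on_scale_left inner_on_add_left inner_on_scale_left ..
    also have "quad_form I ?D v = of_real (normsq I v)"
      unfolding inner_on_self [symmetric]
      by (intro inner_on_cong) (simp_all add: apply_on_identity fin)
    finally have "Re (quad_form I (\<lambda>r s. A r s + of_real ?t * ?D r s) v)
        = Re (quad_form I A v) + ?t * normsq I v"
      by simp
    moreover have "- Re (quad_form I A v) \<le> (normsq I (apply_on I A v) + normsq I v) / 2"
      using normsq_nonneg [of I "\<lambda>i. apply_on I A v i + v i"] unfolding normsq_add by simp
    moreover have "normsq I (apply_on I A v) \<le> ?C * normsq I v" by (rule normsq_apply_le [OF fin])
    ultimately show ?thesis by (simp add: field_simps)
  qed
  moreover have "herm_on I (\<lambda>r s. A r s + of_real ?t * ?D r s)"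
    using A by (simp add: herm_on_iff)
  ultimately show "psd_on I (\<lambda>r s. A r s + of_real ?t * ?D r s)" by (simp add: psd_on_def)
qed

text \<open>Complete positivity speaks of positive matrices only. A Hermitian \<open>X\<close>
  becomes positive after adding a real multiple of the identity, and \<open>\<phi>\<close> maps that
  multiple to the same multiple of the identity.\<close>

lemma ucp_hermitian:
  assumes ucp: "ucp n k \<phi>" and X: "hermitian_mat n X"
  shows "hermitian_mat k (\<phi> X)"
proof -
  have cp: "completely_positive n k \<phi>" and one: "\<phi> (1\<^sub>m n) = 1\<^sub>m k" using ucp by (auto simp: ucp_def)
  then have lin: "linear_mat_map n k \<phi>" by (simp add: completely_positive_def)
  have Xc: "X \<in> carrier_mat n n" and Xh: "herm_on {..<n} (entries X)" using X
    by (auto simp: hermitian_mat_iff)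
  obtain t where t: "psd_on {..<n}
      (\<lambda>r s. entries X r s + of_real (t::real) * (if r = s then 1 else 0))"
    by (rule herm_on_add_scalar_psd [OF _ Xh]) auto
  let ?Y = "X + of_real t \<cdot>\<^sub>m 1\<^sub>m n"
  have Y: "?Y \<in> carrier_mat n n" using Xc by simp
  have "psd_on {..<n} (entries ?Y)"
    by (rule psd_on_cong [OF t]) (use Xc in \<open>auto simp: entries_def\<close>)
  then have "psd_mat (1 * n) ?Y" using Y by (simp add: psd_mat_iff)
  then have "psd_mat (1 * k) (ampliation 1 n k \<phi> ?Y)"
    using cp unfolding completely_positive_def by blast
  then have "psd_mat k (\<phi> ?Y)" using ampliation_one [OF lin Y] by simp
  then have herm: "herm_on {..<k} (entries (\<phi> ?Y))" by (simp add: psd_mat_iff psd_on_def)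
  have c: "\<phi> X \<in> carrier_mat k k" using lin Xc by (simp add: linear_mat_map_def)
  have "\<phi> ?Y = \<phi> X + \<phi> (of_real t \<cdot>\<^sub>m 1\<^sub>m n)"
    using lin Xc by (simp add: linear_mat_map_def)
  also have "\<phi> (of_real t \<cdot>\<^sub>m 1\<^sub>m n) = of_real t \<cdot>\<^sub>m 1\<^sub>m k"
    using lin one by (simp add: linear_mat_map_def)
  finally have "entries (\<phi> X) r s = entries (\<phi> ?Y) r s - of_real t * (if r = s then 1 else 0)"
    if "r < k" "s < k" for r s
    using that c by (simp add: entries_def)
  then have "herm_on {..<k} (entries (\<phi> X))"
    using herm by (simp add: herm_on_iff)
  then show ?thesis using c by (simp add: hermitian_mat_iff)
qed

text \<open>Blockwise this is linearity and unitality of \<open>\<phi>\<close>: the block at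
  \<open>(?i, ?j)\<close> is a multiple of the identity minus a combination of the
  \<open>X l\<close>, whose coefficients are entries of the \<open>A l\<close>.\<close>

lemma ampliation_kron_sum:
  assumes ucp: "ucp n k \<phi>" and A: "\<And>j. A j \<in> carrier_mat m m" and X: "\<And>j. X j \<in> carrier_mat n n"
  shows "ampliation m n k \<phi> (1\<^sub>m (m * n) - tuple_sum (m * n) (\<lambda>j. kron (A j) (X j)))
    = 1\<^sub>m (m * k) - tuple_sum (m * k) (\<lambda>j. kron (A j) (\<phi> (X j)))" (is "ampliation m n k \<phi> ?P = ?R")
proof (rule eq_matI)
  have lin: "linear_mat_map n k \<phi>" and one: "\<phi> (1\<^sub>m n) = 1\<^sub>m k"
    using ucp by (auto simp: ucp_def completely_positive_def)
  have \<phi>X: "\<phi> (X j) \<in> carrier_mat k k" for j using lin X by (simp add: linear_mat_map_def)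
  have dims: "dim_row (A j) = m" "dim_col (A j) = m" "dim_row (X j) = n" "dim_col (X j) = n"
    "dim_row (\<phi> (X j)) = k" "dim_col (\<phi> (X j)) = k" for j
    using A [of j] X [of j] \<phi>X [of j] by auto
  fix r s assume "r < dim_row ?R" "s < dim_col ?R"
  then have rs: "r < m * k" "s < m * k" by (simp_all add: tuple_sum_def)
  then have k: "0 < k" by (metis mult_0_right neq0_conv not_less_zero)
  let ?i = "r div k" and ?j = "s div k"
  have ij: "?i < m" "?j < m" using rs by (simp_all add: less_mult_imp_div_less)
  have block: "mat_block n ?P ?i ?j
      = mat n n (\<lambda>(p, q). (if ?i = ?j then 1 else 0) * 1\<^sub>m n $$ (p, q)
          - (\<Sum>l\<in>UNIV. A l $$ (?i, ?j) * X l $$ (p, q)))"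
  proof (rule eq_matI)
    fix p q assume "p < dim_row
        (mat n n (\<lambda>(p, q). (if ?i = ?j then 1 else 0) * 1\<^sub>m n $$ (p, q)
        - (\<Sum>l\<in>UNIV. A l $$ (?i, ?j) * X l $$ (p, q))))"
      "q < dim_col (mat n n
          (\<lambda>(p, q). (if ?i = ?j then 1 else 0) * 1\<^sub>m n $$ (p, q)
          - (\<Sum>l\<in>UNIV. A l $$ (?i, ?j) * X l $$ (p, q))))"
    then have pq: "p < n" "q < n" by auto
    have "?i * n + p < m * n" "?j * n + q < m * n" using ij pq by (simp_all add: pair_code_less)
    moreover have "?i * n + p = ?j * n + q \<longleftrightarrow> ?i = ?j \<and> p = q"
    proof
      assume *: "?i * n + p = ?j * n + q"
      have "(?i * n + p) div n = (?j * n + q) div n" "(?i * n + p) mod n = (?j * n + q) mod n"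
        by (simp_all only: *)
      then show "?i = ?j \<and> p = q" using pq by simp
    qed simp
    ultimately show "mat_block n ?P ?i ?j $$ (p, q)
        = mat n n (\<lambda>(p, q). (if ?i = ?j then 1 else 0) * 1\<^sub>m n $$ (p, q)
            - (\<Sum>l\<in>UNIV. A l $$ (?i, ?j) * X l $$ (p, q))) $$ (p, q)"
      using pq by (simp add: mat_block_def tuple_sum_def kron_def dims)
  qed (simp_all add: mat_block_def)
  have "ampliation m n k \<phi> ?P $$ (r, s) = \<phi> (mat_block n ?P ?i ?j) $$ (r mod k, s mod k)"
    using rs by (simp add: ampliation_def)
  also have "\<dots> = (if ?i = ?j then 1 else 0) * \<phi> (1\<^sub>m n) $$ (r mod k, s mod k)
      - (\<Sum>l\<in>UNIV. A l $$ (?i, ?j) * \<phi> (X l) $$ (r mod k, s mod k))"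
    unfolding block linear_mat_map_combination [where X = X, OF lin X finite] using k by simp
  also have "(if ?i = ?j then 1 else 0) * \<phi> (1\<^sub>m n) $$ (r mod k, s mod k) = 1\<^sub>m (m * k) $$ (r, s)"
  proof -
    have "r = s \<longleftrightarrow> ?i = ?j \<and> r mod k = s mod k" by (metis div_mult_mod_eq)
    then show ?thesis using rs k one by simp
  qed
  also have "1\<^sub>m (m * k) $$ (r, s) - (\<Sum>l\<in>UNIV. A l $$ (?i, ?j) * \<phi> (X l) $$ (r mod k, s mod k))
      = ?R $$ (r, s)"
    using rs by (simp add: tuple_sum_def kron_def dims)
  finally show "ampliation m n k \<phi> ?P $$ (r, s) = ?R $$ (r, s)" .
qed (simp_all add: ampliation_def tuple_sum_def)

text \<open>Closure under UCP maps is complete positivity applied to I minus the sum of A_j tensor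
  X_j. Since \<open>S\<close> is arbitrary, the examples for optimality can be built by prescribing
  a family of test tuples.\<close>

theorem matrix_convex_polar_dual: "matrix_convex (polar_dual S)"
  unfolding matrix_convex_def
proof (intro conjI ballI allI impI)
  show "polar_dual S \<subseteq> sa_universe" by (auto simp: polar_dual_def sa_universe_def)
next
  fix X Y assume "X \<in> polar_dual S" "Y \<in> polar_dual S"
  then obtain n m where n: "1 \<le> n" "X \<in> sa_tuples n" and m: "1 \<le> m" "Y \<in> sa_tuples m"
    and X: "\<And>k A u. 1 \<le> k \<Longrightarrow> A \<in> S \<inter> sa_tuples k \<Longrightarrow>
        Re (tens_form {..<k} {..<n} (entries_tuple A) (entries_tuple X) u)
      \<le> normsq ({..<k} \<times> {..<n}) u"
    and Y: "\<And>k A u. 1 \<le> k \<Longrightarrow> A \<in> S \<inter> sa_tuples k \<Longrightarrow>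
        Re (tens_form {..<k} {..<m} (entries_tuple A) (entries_tuple Y) u)
      \<le> normsq ({..<k} \<times> {..<m}) u"
    unfolding mem_polar_dual_iff by blast
  have c: "\<And>j. X j \<in> carrier_mat n n" "\<And>j. Y j \<in> carrier_mat m m"
    using n m by (auto simp: sa_tuples_iff)
  show "(\<lambda>j. direct_sum_mat (X j) (Y j)) \<in> polar_dual S"
    unfolding mem_polar_dual_iff
  proof (intro exI [of _ "n + m"] conjI allI impI ballI)
    show "(\<lambda>j. direct_sum_mat (X j) (Y j)) \<in> sa_tuples (n + m)"
      by (rule sa_tuples_direct_sum) fact+
    fix k A u assume "1 \<le> k" "A \<in> S \<inter> sa_tuples k"
    then show "Re (tens_form {..<k} {..<n + m} (entries_tuple A)
        (\<lambda>j. entries (direct_sum_mat (X j) (Y j))) u)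
      \<le> normsq ({..<k} \<times> {..<n + m}) u"
      unfolding tens_direct_sum [where X = X and Y = Y, OF c] normsq_direct_sum plus_complex.sel
      by (intro add_mono X Y)
  qed (use n in simp)
next
  fix n k :: nat and X \<phi> assume "1 \<le> n" "1
      \<le> k" "X \<in> polar_dual S \<inter> sa_tuples n" and ucp: "ucp n k \<phi>"
  then have X: "X \<in> sa_tuples n"
    and le: "\<And>m A. 1 \<le> m \<Longrightarrow> A \<in> S \<inter> sa_tuples m \<Longrightarrow>
      loewner_le (m * n) (tuple_sum (m * n) (\<lambda>j. kron (A j) (X j))) (1\<^sub>m (m * n))"
    by (auto simp: polar_dual_def dest: sa_tuples_unique)
  have "(\<lambda>j. \<phi> (X j)) \<in> sa_tuples k"
    using X ucp_hermitian [OF ucp] by (simp add: sa_tuples_def)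
  moreover have "loewner_le (m * k) (tuple_sum (m * k) (\<lambda>j. kron (A j) (\<phi> (X j)))) (1\<^sub>m (m * k))"
    if m: "1 \<le> m" and A: "A \<in> S \<inter> sa_tuples m" for m A
  proof -
    let ?P = "1\<^sub>m (m * n) - tuple_sum (m * n) (\<lambda>j. kron (A j) (X j))"
    have "psd_mat (m * n) ?P" using le [OF m A] by (simp add: loewner_le_def)
    then have "psd_mat (m * k) (ampliation m n k \<phi> ?P)"
      using ucp m unfolding ucp_def completely_positive_def by blast
    moreover have "ampliation m n k \<phi> ?P
        = 1\<^sub>m (m * k) - tuple_sum (m * k) (\<lambda>j. kron (A j) (\<phi> (X j)))"
      using A X by (intro ampliation_kron_sum [OF ucp]) (auto simp: sa_tuples_iff)
    ultimately show ?thesis by (simp add: loewner_le_def)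
  qed
  ultimately show "(\<lambda>j. \<phi> (X j)) \<in> polar_dual S"
    unfolding polar_dual_def using \<open>1 \<le> k\<close> by auto
qed

section \<open>Congruence and compression by isometries\<close>

lemma psd_on_congruence:
  assumes P: "psd_on J P"
  shows "psd_on I (\<lambda>p q. \<Sum>x\<in>J. \<Sum>y\<in>J. cnj (W x p) * P x y * W y q)"
proof -
  let ?Q = "\<lambda>p q. \<Sum>x\<in>J. \<Sum>y\<in>J. cnj (W x p) * P x y * W y q"
  have P_cnj: "cnj (P x y) = P y x" if "x \<in> J" "y \<in> J" for x y
    using P that by (simp add: psd_on_def herm_on_iff)
  have "cnj (?Q p q) = ?Q q p" for p q
  proof -
    have "cnj (?Q p q) = (\<Sum>x\<in>J. \<Sum>y\<in>J. cnj (W y q) * P y x * W x p)"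
      unfolding cnj_sum by (intro sum.cong refl) (simp add: P_cnj algebra_simps)
    also have "\<dots> = ?Q q p" by (rule sum.swap)
    finally show ?thesis .
  qed
  moreover have "0 \<le> Re (quad_form I ?Q v)" for v
  proof -
    define w where "w y = (\<Sum>q\<in>I. W y q * v q)" for y
    have app: "apply_on I ?Q v p = (\<Sum>x\<in>J. cnj (W x p) * apply_on J P w x)" for p
    proof -
      have "apply_on I ?Q v p = (\<Sum>q\<in>I. \<Sum>x\<in>J. \<Sum>y\<in>J. cnj (W x p) * P x y * W y q * v q)"
        by (simp add: apply_on_def sum_distrib_right)
      also have "\<dots> = (\<Sum>x\<in>J. \<Sum>y\<in>J. \<Sum>q\<in>I. cnj (W x p) * P x y * W y q * v q)"
        by (rule sum_rotate [symmetric])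
      finally show ?thesis by (simp add: apply_on_def w_def sum_distrib_left mult.assoc)
    qed
    have "quad_form I ?Q v = (\<Sum>x\<in>J. \<Sum>p\<in>I. cnj (W x p) * apply_on J P w x * cnj (v p))"
      unfolding inner_on_def app sum_distrib_right by (rule sum.swap)
    also have "\<dots> = quad_form J P w"
      unfolding inner_on_def w_def cnj_sum sum_distrib_left
      by (intro sum.cong refl) (simp add: algebra_simps)
    finally show ?thesis using P by (simp add: psd_on_def)
  qed
  ultimately show ?thesis unfolding psd_on_def by (auto intro: herm_onI_cnj)
qed

lemma psd_on_reindex_iff:
  fixes h :: "'b \<Rightarrow> 'a"
  assumes h: "bij_betw h J I"
  shows "psd_on I A \<longleftrightarrow> psd_on J (\<lambda>p q. A (h p) (h q))"
proof -
  let ?B = "\<lambda>p q. A (h p) (h q)"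
  have "herm_on I A \<longleftrightarrow> herm_on J ?B"
    unfolding herm_on_def bij_betw_imp_surj_on [OF h, symmetric] by simp
  moreover have "(\<forall>v. 0 \<le> Re (quad_form I A v)) \<longleftrightarrow>
      (\<forall>v. 0 \<le> Re (quad_form J ?B (\<lambda>p. v (h p))))"
    unfolding inner_on_reindex [OF h] apply_on_reindex [OF h] ..
  moreover have "\<dots> \<longleftrightarrow> (\<forall>w. 0 \<le> Re (quad_form J ?B w))"
  proof (rule all_reindex_iff [OF h])
    fix v w :: "'b \<Rightarrow> complex" assume vw: "\<And>i. i \<in> J \<Longrightarrow> v i = w i"
    have "apply_on J ?B v = apply_on J ?B w"
      unfolding apply_on_def using vw by (intro ext sum.cong) auto
    then have "quad_form J ?B v = quad_form J ?B w"
      using vw by (intro inner_on_cong) auto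
    then show "0 \<le> Re (quad_form J ?B v) \<longleftrightarrow> 0 \<le> Re (quad_form J ?B w)" by simp
  qed
  ultimately show ?thesis by (simp add: psd_on_def)
qed

definition compression :: "nat \<Rightarrow> nat \<Rightarrow> (nat \<Rightarrow> nat \<Rightarrow> complex) \<Rightarrow> complex mat \<Rightarrow> complex mat" where
  "compression T n V M = mat n n (\<lambda>(r, s). \<Sum>t<T. \<Sum>t'<T. cnj (V t r) * M $$ (t, t') * V t' s)"

text \<open>The hypothesis says that \<open>V\<close> is an isometry. Two instances are used: a unit
  vector, with \<open>n = 1\<close>, and the isometry that compresses a diagonal tuple to a point of
  the polar.\<close>

lemma ucp_compression:
  assumes V: "\<And>r s. r < n \<Longrightarrow> s < n \<Longrightarrow> (\<Sum>t<T. cnj (V t r) * V t s) = (if r = s then 1 else 0)"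
  shows "ucp T n (compression T n V)"
proof -
  let ?\<phi> = "compression T n V"
  have "linear_mat_map T n ?\<phi>"
    unfolding linear_mat_map_def
  proof (intro conjI ballI allI)
    fix A :: "complex mat" assume A: "A \<in> carrier_mat T T"
    show "?\<phi> A \<in> carrier_mat n n" by (simp add: compression_def)
    show "?\<phi> (a \<cdot>\<^sub>m A) = a \<cdot>\<^sub>m ?\<phi> A" for a
    proof (rule eq_matI)
      fix r s assume rs: "r < dim_row (a \<cdot>\<^sub>m ?\<phi> A)" "s < dim_col (a \<cdot>\<^sub>m ?\<phi> A)"
      then have "?\<phi> (a \<cdot>\<^sub>m A) $$ (r, s) = (\<Sum>t<T. \<Sum>t'<T. a * (cnj (V t r) * A $$ (t, t') * V t' s))"
        using A by (simp add: compression_def algebra_simps)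
      then show "?\<phi> (a \<cdot>\<^sub>m A) $$ (r, s) = (a \<cdot>\<^sub>m ?\<phi> A) $$ (r, s)"
        using rs by (simp add: compression_def sum_distrib_left)
    qed (simp_all add: compression_def)
    fix B :: "complex mat" assume B: "B \<in> carrier_mat T T"
    show "?\<phi> (A + B) = ?\<phi> A + ?\<phi> B"
    proof (rule eq_matI)
      fix r s assume rs: "r < dim_row (?\<phi> A + ?\<phi> B)" "s < dim_col (?\<phi> A + ?\<phi> B)"
      then have "?\<phi> (A + B) $$ (r, s)
          = (\<Sum>t<T. \<Sum>t'<T. cnj (V t r) * A $$ (t, t') * V t' s + cnj (V t r) * B $$ (t, t')
              * V t' s)"
        using A B by (simp add: compression_def algebra_simps)
      then show "?\<phi> (A + B) $$ (r, s) = (?\<phi> A + ?\<phi> B) $$ (r, s)"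
        using rs by (simp add: compression_def sum.distrib)
    qed (simp_all add: compression_def)
  qed
  moreover have "psd_mat (m * n) (ampliation m T n ?\<phi> P)" if P: "psd_mat (m * T) P" for m P
  proof -
    let ?I = "{..<m} \<times> {..<n}" and ?J = "{..<m} \<times> {..<T}"
    \<comment> \<open>The matrix of I tensor V, so that the ampliation is a congruence by
      \<open>?W\<close>.\<close>
    let ?W = "\<lambda>x p. if fst x = fst p then V (snd x) (snd p) else 0"
    let ?P = "\<lambda>x y. entries P (pair_code T x) (pair_code T y)"
    have "psd_on {..<m * T} (entries P)" using P by (simp add: psd_mat_iff)
    then have "psd_on ?J ?P" by (simp only: psd_on_reindex_iff [OF bij_betw_pair_code])
    then have "psd_on ?I (\<lambda>p q. \<Sum>x\<in>?J. \<Sum>y\<in>?J. cnj (?W x p) * ?P x y * ?W y q)"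
      by (rule psd_on_congruence)
    then have "psd_on ?I (\<lambda>p q. entries (ampliation m T n ?\<phi> P) (pair_code n p) (pair_code n q))"
    proof (rule psd_on_cong)
      fix p q assume pq: "p \<in> ?I" "q \<in> ?I"
      have inner: "(\<Sum>y\<in>?J. cnj (?W x p) * ?P x y * ?W y q)
          = (\<Sum>t'<T. cnj (?W x p) * ?P x (fst q, t') * V t' (snd q))" for x
      proof -
        have "(\<Sum>y\<in>?J. cnj (?W x p) * ?P x y * ?W y q)
            = (\<Sum>k<m. if k = fst q then \<Sum>t'<T. cnj (?W x p) * ?P x (k, t') * V t' (snd q) else 0)"
          unfolding sum.cartesian_product' by (intro sum.cong refl) auto
        then show ?thesis using pq by auto
      qed
      have "(\<Sum>x\<in>?J. \<Sum>y\<in>?J. cnj (?W x p) * ?P x y * ?W y q)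
          = (\<Sum>i<m. if i = fst p then \<Sum>t<T. \<Sum>t'<T. cnj (V t (snd p)) * ?P (i, t) (fst q, t')
              * V t' (snd q) else 0)"
        unfolding inner unfolding sum.cartesian_product' by (intro sum.cong refl) auto
      also have "\<dots> = (\<Sum>t<T. \<Sum>t'<T. cnj (V t (snd p)) * ?P (fst p, t) (fst q, t') * V t' (snd q))"
        using pq by auto
      also have "\<dots> = entries (ampliation m T n ?\<phi> P) (pair_code n p) (pair_code n q)"
      proof -
        have "pair_code n p < m * n" "pair_code n q < m * n"
          using pq by (auto simp: pair_code_def pair_code_less)
        moreover have "pair_code n p div n = fst p" "pair_code n p mod n = snd p"
          "pair_code n q div n = fst q" "pair_code n q mod n = snd q"
          using pq by (auto simp: pair_code_def)
        moreover have "snd p < n" "snd q < n" using pq by auto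
        ultimately show ?thesis
          by (simp add: entries_def ampliation_def compression_def mat_block_def pair_code_def)
      qed
      finally show "(\<Sum>x\<in>?J. \<Sum>y\<in>?J. cnj (?W x p) * ?P x y * ?W y q)
          = entries (ampliation m T n ?\<phi> P) (pair_code n p) (pair_code n q)" .
    qed
    then have "psd_on {..<m * n} (entries (ampliation m T n ?\<phi> P))"
      by (simp only: psd_on_reindex_iff [OF bij_betw_pair_code])
    then show ?thesis by (simp add: psd_mat_iff ampliation_def)
  qed
  moreover have "?\<phi> (1\<^sub>m T) = 1\<^sub>m n"
  proof (rule eq_matI)
    fix r s assume "r < dim_row (1\<^sub>m n)" "s < dim_col (1\<^sub>m n)"
    then have rs: "r < n" "s < n" by auto
    have "(\<Sum>t'<T. cnj (V t r) * 1\<^sub>m T $$ (t, t') * V t' s) = cnj (V t r) * V t s" if "t < T" for t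
    proof -
      have "(\<Sum>t'<T. cnj (V t r) * 1\<^sub>m T $$ (t, t') * V t' s)
          = (\<Sum>t'<T. if t' = t then cnj (V t r) * V t s else 0)"
        using that by (intro sum.cong) auto
      then show ?thesis using that by simp
    qed
    then show "?\<phi> (1\<^sub>m T) $$ (r, s) = 1\<^sub>m n $$ (r, s)"
      using rs V [OF rs] by (simp add: compression_def)
  qed (simp_all add: compression_def)
  ultimately show ?thesis by (simp add: ucp_def completely_positive_def)
qed

section \<open>The inclusions\<close>

lemma matrix_convex_compression:
  assumes S: "matrix_convex S" and X: "X \<in> S" "X \<in> sa_tuples T" and "1 \<le> T" "1 \<le> n"
    and V: "\<And>r s. r < n \<Longrightarrow> s < n \<Longrightarrow> (\<Sum>t<T. cnj (V t r) * V t s) = (if r = s then 1 else 0)"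
  shows "(\<lambda>j. compression T n V (X j)) \<in> S"
  using S X \<open>1 \<le> T\<close> \<open>1 \<le> n\<close> ucp_compression [OF V] unfolding matrix_convex_def by blast

lemma matrix_convexE:
  assumes "matrix_convex S" "X \<in> S"
  obtains n where "1 \<le> n" "X \<in> sa_tuples n"
  using assms unfolding matrix_convex_def sa_universe_def by auto

text \<open>The direct sum of the points \<open>xs\<close>, with entry \<open>j\<close> collecting
  their \<open>j\<close>-th coordinates on one diagonal.\<close>

definition diag_tuple :: "(real ^ 'd) list \<Rightarrow> 'd \<Rightarrow> complex mat" where
  "diag_tuple xs j = mat (length xs) (length xs)
     (\<lambda>(r, s). if r = s then of_real (vec_nth (xs ! r) j) else 0)"

lemma diag_tuple_mem:
  assumes S: "matrix_convex S" and "xs \<noteq> []" "set xs \<subseteq> first_level S"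
  shows "diag_tuple xs \<in> S"
  using assms(2,3)
proof (induction xs rule: list_nonempty_induct)
  case (single x)
  have "diag_tuple [x] = (\<lambda>j. mat 1 1 (\<lambda>_. complex_of_real (vec_nth x j)))"
    by (intro ext eq_matI) (auto simp: diag_tuple_def)
  then show ?case using single by (simp add: first_level_def)
next
  case (cons x xs)
  let ?X = "\<lambda>j. mat 1 1 (\<lambda>_. complex_of_real (vec_nth x j))"
  have "diag_tuple (x # xs) = (\<lambda>j. direct_sum_mat (?X j) (diag_tuple xs j))"
    by (intro ext eq_matI)
      (auto simp: diag_tuple_def direct_sum_mat_def Let_def nth_Cons' )
  moreover have "?X \<in> S" "diag_tuple xs \<in> S" using cons by (auto simp: first_level_def)
  ultimately show ?case using S by (simp add: matrix_convex_def)
qed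

lemma sa_tuples_diag_tuple: "diag_tuple xs \<in> sa_tuples (length xs)"
  by (simp add: sa_tuples_iff herm_on_iff diag_tuple_def entries_def)

text \<open>A unit vector is an isometry from a one-dimensional space, and the compression it
  defines is its vector state. The values are real because the entries of the tuple are
  Hermitian.\<close>

lemma numerical_range_mem_first_level:
  assumes S: "matrix_convex S" and X: "X \<in> S" "X \<in> sa_tuples n" "1 \<le> n"
    and v: "normsq {..<n} v = 1"
  shows "(\<chi> j. Re (inner_on {..<n} (apply_on {..<n} (entries (X j)) v) v)) \<in> first_level S"
proof -
  let ?q = "\<lambda>j. inner_on {..<n} (apply_on {..<n} (entries (X j)) v) v"
  let ?V = "\<lambda>t (_::nat). v t"
  have V: "(\<Sum>t<n. cnj (?V t r) * ?V t s) = (if r = s then 1 else 0)" if "r < 1" "s < 1" for r s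
    using v that by (simp add: normsq_def complex_norm_square mult.commute flip: of_real_eq_iff
        [where 'a = complex] del: of_real_power)
  have "(\<lambda>j. compression n 1 ?V (X j)) \<in> S"
    by (rule matrix_convex_compression [OF S X(1,2,3) _ V]) auto
  also have "(\<lambda>j. compression n 1 ?V (X j)) = (\<lambda>j. mat 1 1 (\<lambda>_. complex_of_real (Re (?q j))))"
  proof (intro ext eq_matI)
    fix j and r s :: nat
    assume "r < dim_row (mat 1 1 (\<lambda>_. complex_of_real (Re (?q j))))" "s < dim_col
        (mat 1 1 (\<lambda>_. complex_of_real (Re (?q j))))"
    then have rs: "r = 0" "s = 0" by auto
    have "compression n 1 ?V (X j) $$ (0, 0) = ?q j"
      by (simp add: compression_def inner_on_def apply_on_def entries_def sum_distrib_left
          algebra_simps)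
    also have "\<dots> = of_real (Re (?q j))"
      using herm_on_Im_inner [of "{..<n}" "entries (X j)" v] X(2)
      by (simp add: sa_tuples_iff complex_eq_iff)
    finally show "compression n 1 ?V (X j) $$ (r, s)
        = mat 1 1 (\<lambda>_. complex_of_real (Re (?q j))) $$ (r, s)"
      by (simp add: rs)
  qed (simp_all add: compression_def)
  finally show ?thesis by (simp add: first_level_def)
qed

lemma abs_quadratic_form_le:
  assumes fin: "finite I"
    and unit: "\<And>v. normsq I v = 1 \<Longrightarrow> \<bar>Re (quad_form I A v)\<bar> \<le> 1"
  shows "\<bar>Re (quad_form I A v)\<bar> \<le> normsq I v"
proof (cases "normsq I v = 0")
  case True
  then have "quad_form I A v = 0"
    using fin by (simp add: normsq_eq_0_iff inner_on_def)
  then show ?thesis by simp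
next
  case False
  then have pos: "0 < normsq I v" using normsq_nonneg [of I v] by linarith
  let ?a = "1 / sqrt (normsq I v)"
  let ?u = "\<lambda>i. of_real ?a * v i"
  have "normsq I ?u = 1"
    unfolding normsq_scale using pos by (simp add: norm_divide power_divide)
  then have "\<bar>Re (quad_form I A ?u)\<bar> \<le> 1" by (rule unit)
  also have "quad_form I A ?u = of_real (?a * ?a) * quad_form I A v"
    unfolding apply_on_scale inner_on_scale_left inner_on_scale_right
    by (simp only: of_real_mult mult.assoc complex_cnj_complex_of_real)
  also have "?a * ?a = 1 / normsq I v" using pos by simp
  also have "Re (of_real (1 / normsq I v) * quad_form I A v)
      = Re (quad_form I A v) / normsq I v"
    by simp
  finally show ?thesis using pos by (simp add: abs_divide)
qed

lemma dilateI:
  fixes X :: "'d::finite \<Rightarrow> complex mat"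
  assumes "c \<noteq> 0" "(\<lambda>j. complex_of_real (1 / c) \<cdot>\<^sub>m X j) \<in> S"
  shows "X \<in> dilate c S"
proof -
  have "X = (\<lambda>j. complex_of_real c \<cdot>\<^sub>m (complex_of_real (1 / c) \<cdot>\<^sub>m X j))"
    using assms(1) by (intro ext eq_matI) auto
  then show ?thesis unfolding dilate_def using assms(2) by (rule image_eqI)
qed

lemma entries_smult:
  "A \<in> carrier_mat n n \<Longrightarrow> r < n \<Longrightarrow> s < n \<Longrightarrow> entries (c \<cdot>\<^sub>m A) r s = c * entries A r s"
  by (simp add: entries_def)

lemma sa_tuples_scale:
  assumes "X \<in> sa_tuples n"
  shows "(\<lambda>j. complex_of_real c \<cdot>\<^sub>m X j) \<in> sa_tuples n"
  using assms by (simp add: sa_tuples_iff herm_on_iff entries_smult [where n = n])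

lemma apply_on_entries_smult:
  assumes "A \<in> carrier_mat n n" "i < n"
  shows "apply_on {..<n} (entries (c \<cdot>\<^sub>m A)) v i = c * apply_on {..<n} (entries A) v i"
  using assms by (simp add: apply_on_def entries_smult [where n = n] sum_distrib_left mult.assoc)

lemma subset_dilate_ball_B:
  fixes S :: "('d::finite \<Rightarrow> complex mat) set"
  assumes S: "matrix_convex S" and ball: "first_level S \<subseteq> cball 0 1"
  shows "S \<subseteq> dilate (sqrt (real CARD('d))) ball_B"
proof
  fix X assume X: "X \<in> S"
  with S obtain n where n: "1 \<le> n" and Xn: "X \<in> sa_tuples n" by (rule matrix_convexE)
  let ?I = "{..<n}" and ?d = "real CARD('d)"
  have c: "X j \<in> carrier_mat n n" and herm: "herm_on ?I (entries (X j))" for j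
    using Xn by (auto simp: sa_tuples_iff)
  have "\<bar>Re (quad_form ?I (entries (X j)) v)\<bar> \<le> 1" if v: "normsq ?I v = 1" for j v
  proof -
    let ?x = "\<chi> j. Re (quad_form ?I (entries (X j)) v)"
    have "?x \<in> cball 0 1"
      using numerical_range_mem_first_level [OF S X Xn n v] ball by blast
    then show ?thesis using component_le_norm_cart [of ?x j] by simp
  qed
  then have "\<bar>Re (quad_form ?I (entries (X j)) v)\<bar> \<le> 1 * normsq ?I v" for j v
    using abs_quadratic_form_le [of ?I "entries (X j)" v] by simp
  \<comment> \<open>For a Hermitian matrix a bound on the numerical range is a bound on the
    norm.\<close>
  then have le: "normsq ?I (apply_on ?I (entries (X j)) v) \<le> normsq ?I v" for j v
    using herm_on_normsq_apply_le [OF herm, of 1 j v] by simp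
  let ?c = "1 / sqrt ?d"
  have "column_contraction ?I (\<lambda>j. entries (complex_of_real ?c \<cdot>\<^sub>m X j))"
    unfolding column_contraction_def
  proof
    fix v
    have "normsq ?I (apply_on ?I (entries (complex_of_real ?c \<cdot>\<^sub>m X j)) v)
        = normsq ?I (apply_on ?I (entries (X j)) v) / ?d" for j
    proof -
      have "normsq ?I (apply_on ?I (entries (complex_of_real ?c \<cdot>\<^sub>m X j)) v)
          = normsq ?I (\<lambda>i. complex_of_real ?c * apply_on ?I (entries (X j)) v i)"
        using c by (intro normsq_cong) (simp add: apply_on_entries_smult [where n = n])
      then show ?thesis unfolding normsq_scale by (simp add: norm_divide power_divide)
    qed
    then have "(\<Sum>j\<in>UNIV. normsq ?I (apply_on ?I (entries (complex_of_real ?c \<cdot>\<^sub>m X j)) v))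
        \<le> (\<Sum>j\<in>(UNIV :: 'd set). normsq ?I v / ?d)"
      by (intro sum_mono) (simp add: le divide_right_mono)
    then show "(\<Sum>j\<in>UNIV. normsq ?I (apply_on ?I (entries (complex_of_real ?c \<cdot>\<^sub>m X j)) v))
        \<le> normsq ?I v"
      by simp
  qed
  then have "(\<lambda>j. complex_of_real ?c \<cdot>\<^sub>m X j) \<in> ball_B"
    unfolding mem_ball_B_iff using n sa_tuples_scale [OF Xn] by blast
  then show "X \<in> dilate (sqrt ?d) ball_B" by (intro dilateI) auto
qed

text \<open>The row-column estimate for \<open>X\<close> and its entrywise conjugate, which is again
  a column contraction.\<close>

lemma ball_B_subset_ball_D: "ball_B \<subseteq> ball_D"
  unfolding subset_iff mem_ball_B_iff mem_ball_D_iff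
  by (auto simp: sa_tuples_iff intro!: column_contraction_tens column_contraction_cnj)

lemma ball_D_subset_polar_dual: "ball_D \<subseteq> polar_dual ball_B"
proof
  fix X :: "'a::finite \<Rightarrow> complex mat" assume "X \<in> ball_D"
  then obtain n where n: "1 \<le> n" "X \<in> sa_tuples n"
    and X: "\<And>u. normsq ({..<n} \<times> {..<n})
      (apply_on ({..<n} \<times> {..<n}) (tens (entries_tuple X) (\<lambda>j r s. cnj (entries (X j) r s))) u)
    \<le> normsq ({..<n} \<times> {..<n}) u"
    unfolding mem_ball_D_iff by blast
  show "X \<in> polar_dual ball_B"
    unfolding mem_polar_dual_iff
  proof (intro exI [of _ n] conjI n allI impI ballI)
    fix m and A :: "'a \<Rightarrow> complex mat" and u assume "A \<in> ball_B \<inter> sa_tuples m"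
    then have "column_contraction {..<m} (entries_tuple A)" and A: "A \<in> sa_tuples m"
      by (auto simp: mem_ball_B_iff dest: sa_tuples_unique)
    then show "Re (tens_form {..<m} {..<n} (entries_tuple A) (entries_tuple X) u)
      \<le> normsq ({..<m} \<times> {..<n}) u"
      using X by (intro haagerup_inequality) (auto simp: sa_tuples_iff)
  qed
qed

text \<open>\<open>X\<close> is tested against tuples of its own size. Each positive part
  \<open>P j b\<close> is the square of a Hermitian \<open>R j b\<close>; stacking the rows of all
  these roots gives \<open>V\<close>, an isometry because the \<open>P j b\<close> sum to the
  identity. The diagonal tuple has sign \<open>b\<close> in coordinate \<open>j\<close> on the rows
  of \<open>R j b\<close>, so its compression by \<open>V\<close> is the difference
  \<open>P j True - P j False\<close>.\<close>

lemma polar_dual_ball_B_subset_dilate: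
  fixes S :: "('d::finite \<Rightarrow> complex mat) set"
  assumes S: "matrix_convex S" and ball: "cball 0 1 \<subseteq> first_level S"
  shows "polar_dual ball_B \<subseteq> dilate (sqrt (real CARD('d))) S"
proof
  fix X :: "'d \<Rightarrow> complex mat" assume "X \<in> polar_dual ball_B"
  then obtain n where n: "1 \<le> n" and Xn: "X \<in> sa_tuples n"
    and X: "\<And>A u. A \<in> ball_B \<inter> sa_tuples n \<Longrightarrow>
        Re (tens_form {..<n} {..<n} (entries_tuple A) (entries_tuple X) u)
      \<le> normsq ({..<n} \<times> {..<n}) u"
    unfolding mem_polar_dual_iff by blast
  let ?I = "{..<n}" and ?d = "sqrt (real CARD('d))"
  have c: "X j \<in> carrier_mat n n" and herm: "herm_on ?I (entries (X j))" for j
    using Xn by (auto simp: sa_tuples_iff)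
  obtain P :: "'d \<Rightarrow> bool \<Rightarrow> nat \<Rightarrow> nat \<Rightarrow> complex" where psd: "\<And>j b. psd_on ?I (P j b)"
    and P_sum: "\<And>r s. r \<in> ?I \<Longrightarrow> s \<in> ?I \<Longrightarrow>
      (\<Sum>j\<in>UNIV. P j True r s + P j False r s) = (if r = s then 1 else 0)"
    and P_diff: "\<And>j r s. r \<in> ?I \<Longrightarrow> s \<in> ?I \<Longrightarrow>
      entries (X j) r s = of_real ?d * (P j True r s - P j False r s)"
  proof (rule polar_column_decomposition [of ?I "\<lambda>j. entries (X j)"])
    fix A :: "'d \<Rightarrow> nat \<Rightarrow> nat \<Rightarrow> complex" and u :: "nat \<times> nat \<Rightarrow> complex"
    assume A: "\<And>j. herm_on ?I (A j)" "column_contraction ?I A"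
    let ?A = "\<lambda>j. mat n n (\<lambda>(r, s). A j r s)"
    have ent: "entries (?A j) r s = A j r s" if "r < n" "s < n" for j r s
      using that by (simp add: entries_def)
    have "?A \<in> sa_tuples n" using A(1) by (simp add: sa_tuples_iff herm_on_iff ent)
    moreover have "apply_on ?I (entries (?A j)) v i = apply_on ?I (A j) v i" if "i < n" for j v i
      using that by (simp add: apply_on_def ent)
    then have "normsq ?I (apply_on ?I (entries (?A j)) v) = normsq ?I (apply_on ?I (A j) v)" for j v
      by (intro normsq_cong) simp
    then have "column_contraction ?I (entries_tuple ?A)"
      using A(2) by (simp add: column_contraction_def)
    ultimately have "?A \<in> ball_B \<inter> sa_tuples n"
      using n unfolding Int_iff mem_ball_B_iff by blast
    moreover have "tens_form ?I ?I A (entries_tuple X) u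
        = tens_form ?I ?I (entries_tuple ?A) (entries_tuple X) u"
      by (intro inner_on_cong refl) (auto simp: apply_on_def tens_def ent intro!: sum.cong)
    ultimately show "Re (tens_form ?I ?I A (entries_tuple X) u)
        \<le> normsq (?I \<times> ?I) u"
      using X by simp
  qed (use herm in auto)
  have "\<exists>R. (\<forall>r s. cnj (R r s) = R s r) \<and> (\<forall>r\<in>?I. \<forall>s\<in>?I. P j b r s = (\<Sum>t\<in>?I. R r t * R t s))"
    for j b
    by (rule psd_on_sqrt [OF finite_lessThan psd [of j b]]) blast
  then obtain R where R_cnj: "\<And>j b r s. cnj (R j b r s) = R j b s r"
    and R: "\<And>j b r s. r \<in> ?I \<Longrightarrow> s \<in> ?I \<Longrightarrow> P j b r s = (\<Sum>t\<in>?I. R j b r t * R j b t s)"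
    by metis
  \<comment> \<open>The triples of a coordinate, a sign and a row of the root are put in a list,
    since the rows of \<open>V\<close> must be numbered.\<close>
  obtain l :: "('d \<times> bool \<times> nat) list" where l: "distinct l" "set l = UNIV \<times> UNIV \<times> ?I"
    using finite_distinct_list [of "UNIV \<times> UNIV \<times> ?I :: ('d \<times> bool \<times> nat) set"] by auto
  have sum_l: "(\<Sum>q<length l. f (l ! q)) = (\<Sum>j\<in>UNIV. \<Sum>t<n. f (j, True, t) + f (j, False, t))"
    for f :: "'d \<times> bool \<times> nat \<Rightarrow> complex"
  proof -
    have "(\<Sum>q<length l. f (l ! q)) = sum_list (map f l)"
      by (simp add: sum_list_sum_nth atLeast0LessThan)
    also have "\<dots> = sum f (set l)" by (rule sum_list_distinct_conv_sum_set [OF l(1)])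
    also have "\<dots> = (\<Sum>j\<in>UNIV. \<Sum>t<n. f (j, True, t) + f (j, False, t))"
      unfolding l(2) sum.cartesian_product' by (simp add: UNIV_bool sum.distrib add.commute)
    finally show ?thesis .
  qed
  define V where "V q r = (case l ! q of (j, b, t) \<Rightarrow> R j b t r)" for q r
  define xs where "xs = map (\<lambda>(j, b, t). if b then axis j 1 else - axis j (1::real)) l"
  have len: "length xs = length l" by (simp add: xs_def)
  have "(undefined, True, 0) \<in> set l" using l(2) n by simp
  then have "l \<noteq> []" by auto
  then have ne: "xs \<noteq> []" "1 \<le> length xs" by (simp_all add: xs_def Suc_le_eq)
  have "set xs \<subseteq> cball 0 1"
    by (auto simp: xs_def split: prod.splits if_splits)
  then have "diag_tuple xs \<in> S" using ball ne by (intro diag_tuple_mem [OF S]) auto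
  moreover have V: "(\<Sum>q<length xs. cnj (V q r) * V q s) = (if r = s then 1 else 0)"
      if "r < n" "s < n" for r s
  proof -
    have "(\<Sum>q<length xs. cnj (V q r) * V q s)
        = (\<Sum>j\<in>UNIV. \<Sum>t<n. R j True r t * R j True t s + R j False r t * R j False t s)"
      unfolding V_def len using sum_l [of "\<lambda>(j, b, t). cnj (R j b t r) * R j b t s"]
      by (simp add: R_cnj split_beta)
    also have "\<dots> = (\<Sum>j\<in>UNIV. P j True r s + P j False r s)"
      using that by (simp add: R sum.distrib)
    finally show ?thesis using P_sum that by simp
  qed
  ultimately have "(\<lambda>j. compression (length xs) n V (diag_tuple xs j)) \<in> S"
    using sa_tuples_diag_tuple ne n by (intro matrix_convex_compression [OF S])
  also have "(\<lambda>j. compression (length xs) n V (diag_tuple xs j))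
      = (\<lambda>j. complex_of_real (1 / ?d) \<cdot>\<^sub>m X j)"
  proof (intro ext eq_matI)
    fix j r s assume "r < dim_row (complex_of_real (1 / ?d) \<cdot>\<^sub>m X j)" "s < dim_col
        (complex_of_real (1 / ?d) \<cdot>\<^sub>m X j)"
    then have rs: "r < n" "s < n" using c [of j] by auto
    have row: "(\<Sum>p<length xs. cnj (V q r) * diag_tuple xs j $$ (q, p) * V p s)
        = of_real (vec_nth (xs ! q) j) * (cnj (V q r) * V q s)" if "q < length xs" for q
    proof -
      have "(\<Sum>p<length xs. cnj (V q r) * diag_tuple xs j $$ (q, p) * V p s)
          = (\<Sum>p<length xs. if p = q then of_real (vec_nth (xs ! q) j) * (cnj (V q r) * V q s)
              else 0)"
        using that by (intro sum.cong) (auto simp: diag_tuple_def)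
      then show ?thesis using that by simp
    qed
    have "compression (length xs) n V (diag_tuple xs j) $$ (r, s)
        = (\<Sum>q<length xs. of_real (vec_nth (xs ! q) j) * (cnj (V q r) * V q s))"
      using rs row by (simp add: compression_def)
    also have "\<dots> = (\<Sum>q<length l. case l ! q of (i, b, t) \<Rightarrow>
        if i = j then (if b then 1 else - 1) * (R i b r t * R i b t s) else 0)"
      unfolding len
    proof (intro sum.cong refl)
      fix q assume "q \<in> {..<length l}"
      then show "of_real (vec_nth (xs ! q) j) * (cnj (V q r) * V q s) = (case l ! q of (i, b, t) \<Rightarrow>
          if i = j then (if b then 1 else - 1) * (R i b r t * R i b t s) else 0)"
        by (auto simp: xs_def V_def R_cnj axis_def split: prod.splits)
    qed
    also have "\<dots> = (\<Sum>i\<in>UNIV. \<Sum>t<n. if i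
        = j then R i True r t * R i True t s - R i False r t * R i False t s else 0)"
      using sum_l [of "\<lambda>(i, b, t). if i = j then (if b then 1 else - 1) * (R i b r t * R i b t s)
          else 0"]
      by (simp add: if_distrib [of "\<lambda>x. _ + x"] cong: if_cong)
    also have "\<dots> = (\<Sum>i\<in>UNIV. if i = j then P j True r s - P j False r s else 0)"
      using rs by (intro sum.cong) (auto simp: R sum_subtractf)
    also have "\<dots> = (complex_of_real (1 / ?d) \<cdot>\<^sub>m X j) $$ (r, s)"
      using rs c [of j] P_diff [of r s j] by (simp add: entries_def)
    finally show "compression (length xs) n V (diag_tuple xs j) $$ (r, s)
        = (complex_of_real (1 / ?d) \<cdot>\<^sub>m X j) $$ (r, s)" .
  qed (simp_all add: compression_def carrier_matD [OF c])
  finally show "X \<in> dilate ?d S" by (intro dilateI) auto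
qed

section \<open>Optimality of the constant\<close>

text \<open>Hermitian generators of a Clifford algebra: each squares to the identity and distinct
  ones anticommute.\<close>

definition clifford_on :: "'a set \<Rightarrow> ('d \<Rightarrow> 'a \<Rightarrow> 'a \<Rightarrow> complex) \<Rightarrow> bool" where
  "clifford_on I f \<longleftrightarrow> (\<forall>j. herm_on I (f j)) \<and>
    (\<forall>i j. \<forall>r\<in>I. \<forall>s\<in>I. mat_prod I (f i) (f j) r s + mat_prod I (f j) (f i) r s
        = (if i = j \<and> r = s then 2 else 0))"

text \<open>Induction by doubling the size: an old generator F becomes diag(F, -F), and the new one
  is the flip of the two summands, which anticommutes with all of these and squares to the
  identity.\<close>

lemma anticommuting_unitaries_exist:
  "\<exists>N\<ge>1. \<exists>F :: nat \<Rightarrow> complex mat. \<forall>i<k. hermitian_mat N (F i) \<and>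
    (\<forall>j<k. F i * F j + F j * F i = (if i = j then 2 else 0) \<cdot>\<^sub>m 1\<^sub>m N)"
proof (induction k)
  case (Suc k)
  then obtain N F where N: "1 \<le> N" and herm: "\<And>i. i < k \<Longrightarrow> hermitian_mat N (F i)"
    and anti: "\<And>i j. i < k \<Longrightarrow> j < k \<Longrightarrow>
        F i * F j + F j * F i = (if i = j then 2 else 0) \<cdot>\<^sub>m (1\<^sub>m N :: complex mat)"
    by blast
  have F: "F i \<in> carrier_mat N N" if "i < k" for i using herm [OF that]
    by (simp add: hermitian_mat_def)
  let ?Z = "0\<^sub>m N N :: complex mat" and ?O = "1\<^sub>m N :: complex mat"
  define G where "G i = (if i < k then four_block_mat (F i) ?Z ?Z (- F i)
      else four_block_mat ?Z ?O ?O ?Z)" for i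
  have G_herm: "hermitian_mat (N + N) (G i)" if "i < Suc k" for i
  proof (cases "i < k")
    case True
    then show ?thesis using herm [OF True] F [OF True]
      by (auto simp: hermitian_mat_iff herm_on_iff entries_def G_def)
  next
    case False
    then show ?thesis by (auto simp: hermitian_mat_iff herm_on_iff entries_def G_def)
  qed
  have G_anti: "G i * G j + G j * G i = (if i = j then 2 else 0) \<cdot>\<^sub>m 1\<^sub>m (N + N)"
    if ij: "i < Suc k" "j < Suc k" for i j
  proof -
    have diag: "four_block_mat A ?Z ?Z (- A) * four_block_mat B ?Z ?Z (- B)
        = four_block_mat (A * B) ?Z ?Z (A * B)"
      if "A \<in> carrier_mat N N" "B \<in> carrier_mat N N" for A B :: "complex mat"
      using that by (subst mult_four_block_mat [of _ N N _ N _ N]) auto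
    have off: "four_block_mat A ?Z ?Z (- A) * four_block_mat ?Z ?O ?O ?Z
          + four_block_mat ?Z ?O ?O ?Z * four_block_mat A ?Z ?Z (- A) = 0\<^sub>m (N + N) (N + N)"
      "four_block_mat ?Z ?O ?O ?Z * four_block_mat A ?Z ?Z (- A)
          + four_block_mat A ?Z ?Z (- A) * four_block_mat ?Z ?O ?O ?Z = 0\<^sub>m (N + N) (N + N)"
      if "A \<in> carrier_mat N N" for A :: "complex mat"
    proof -
      have 1: "four_block_mat A ?Z ?Z (- A) * four_block_mat ?Z ?O ?O ?Z
          = four_block_mat ?Z A (- A) ?Z"
        and 2: "four_block_mat ?Z ?O ?O ?Z * four_block_mat A ?Z ?Z (- A)
            = four_block_mat ?Z (- A) A ?Z"
        using that by (subst mult_four_block_mat [of _ N N _ N _ N]; auto)+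
      show "four_block_mat A ?Z ?Z (- A) * four_block_mat ?Z ?O ?O ?Z
          + four_block_mat ?Z ?O ?O ?Z * four_block_mat A ?Z ?Z (- A) = 0\<^sub>m (N + N) (N + N)"
        "four_block_mat ?Z ?O ?O ?Z * four_block_mat A ?Z ?Z (- A)
          + four_block_mat A ?Z ?Z (- A) * four_block_mat ?Z ?O ?O ?Z = 0\<^sub>m (N + N) (N + N)"
        unfolding 1 2 using that by (auto intro!: eq_matI)
    qed
    have flip: "four_block_mat ?Z ?O ?O ?Z * four_block_mat ?Z ?O ?O ?Z = 1\<^sub>m (N + N)"
      by (subst mult_four_block_mat [of _ N N _ N _ N]) auto
    consider "i < k" "j < k" | "i < k" "j = k" | "i = k" "j < k" | "i = k" "j = k"
      using ij unfolding less_Suc_eq by blast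
    then show ?thesis
    proof cases
      case 1
      let ?S = "F i * F j + F j * F i"
      have "G i * G j + G j * G i = four_block_mat ?S ?Z ?Z ?S"
        using 1 F [of i] F [of j] by (simp add: G_def diag) (subst add_four_block_mat, auto)
      then show ?thesis
        unfolding anti [OF 1] by (auto intro!: eq_matI)
    next
      case 2
      then show ?thesis using off(1) [OF F, of i] by (auto simp: G_def intro!: eq_matI)
    next
      case 3
      then show ?thesis using off(2) [OF F, of j] by (auto simp: G_def intro!: eq_matI)
    next
      case 4
      then show ?thesis using flip by (auto simp: G_def intro!: eq_matI)
    qed
  qed
  show ?case
    by (intro exI [of _ "N + N"] conjI exI [of _ G] allI impI G_herm G_anti) (use N in simp_all)
qed auto

lemma clifford_tuple_exists:
  obtains N and F :: "'d::finite \<Rightarrow> complex mat" where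
    "1 \<le> N" "F \<in> sa_tuples N" "clifford_on {..<N} (entries_tuple F)"
proof -
  obtain h :: "'d \<Rightarrow> nat" where h: "bij_betw h UNIV {0..<CARD('d)}"
    using ex_bij_betw_finite_nat [of "UNIV :: 'd set"] by auto
  obtain N and F :: "nat \<Rightarrow> complex mat" where N: "1 \<le> N" and F: "\<And>i. i < CARD('d) \<Longrightarrow>
      hermitian_mat N (F i)"
    and anti: "\<And>i j. i < CARD('d) \<Longrightarrow> j < CARD('d) \<Longrightarrow>
      F i * F j + F j * F i = (if i = j then 2 else 0) \<cdot>\<^sub>m 1\<^sub>m N"
    using anticommuting_unitaries_exist [of "CARD('d)"] by blast
  have hless: "h j < CARD('d)" for j using bij_betwE [OF h] by simp
  have hinj: "h i = h j \<longleftrightarrow> i = j" for i j using bij_betw_imp_inj_on [OF h] by (auto dest: injD)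
  have c: "F (h j) \<in> carrier_mat N N" for j using F [OF hless] by (simp add: hermitian_mat_def)
  have sa: "(\<lambda>j. F (h j)) \<in> sa_tuples N" using F [OF hless] by (simp add: sa_tuples_def)
  moreover have "clifford_on {..<N} (\<lambda>j. entries (F (h j)))"
    unfolding clifford_on_def
  proof (intro conjI allI ballI)
    show "herm_on {..<N} (entries (F (h j)))" for j using sa by (simp add: sa_tuples_iff)
    fix i j r s assume rs: "r \<in> {..<N}" "s \<in> {..<N}"
    have "(F (h i) * F (h j) + F (h j) * F (h i)) $$ (r, s) = (if i = j \<and> r = s then 2 else 0)"
      unfolding anti [OF hless hless] using rs by (simp add: hinj)
    then show "mat_prod {..<N} (entries (F (h i))) (entries (F (h j))) r s
        + mat_prod {..<N} (entries (F (h j))) (entries (F (h i))) r s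
            = (if i = j \<and> r = s then 2 else 0)"
      using rs c [of i] c [of j]
      by (simp add: entries_mult [of _ N, symmetric] entries_def [of "_ * _"])
  qed
  ultimately show thesis using N by (intro that)
qed

lemma clifford_on_cnj:
  assumes "clifford_on I f"
  shows "clifford_on I (\<lambda>j r s. cnj (f j r s))"
proof -
  have *: "mat_prod I (\<lambda>r s. cnj (f i r s)) (\<lambda>r s. cnj (f j r s)) r s
      = cnj (mat_prod I (f i) (f j) r s)" for i j r s
    by (simp add: mat_prod_def)
  have "cnj (mat_prod I (f i) (f j) r s) + cnj (mat_prod I (f j) (f i) r s)
      = (if i = j \<and> r = s then 2 else 0)"
    if "r \<in> I" "s \<in> I" for i j r s
    using assms that unfolding clifford_on_def complex_cnj_add [symmetric] by auto
  then show ?thesis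
    using assms unfolding clifford_on_def * by (simp add: herm_on_iff)
qed

text \<open>The anticommutator determines \<open>?g i j + ?g j i\<close>. The two terms are
  conjugate to each other, so exactly the real part is known.\<close>

lemma clifford_on_inner:
  assumes fin: "finite I" and f: "clifford_on I f"
  shows "Re (inner_on I (apply_on I (f i) v) (apply_on I (f j) v))
      = (if i = j then normsq I v else 0)"
proof -
  have herm: "herm_on I (f j)" for j using f by (simp add: clifford_on_def)
  let ?g = "\<lambda>i j. inner_on I (apply_on I (f i) v) (apply_on I (f j) v)"
  have g: "?g i j = quad_form I (mat_prod I (f j) (f i)) v" for i j
    unfolding apply_mat_prod by (rule herm_on_inner [OF herm, symmetric])
  have "?g i j + ?g j i
      = quad_form I (\<lambda>r s. mat_prod I (f j) (f i) r s + mat_prod I (f i) (f j) r s) v"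
    unfolding g apply_on_add_left inner_on_add_left ..
  also have "\<dots> = inner_on I (\<lambda>r. (if i = j then 2 else 0) * v r) v"
  proof (rule inner_on_cong)
    fix r assume r: "r \<in> I"
    have "apply_on I (\<lambda>r s. mat_prod I (f j) (f i) r s + mat_prod I (f i) (f j) r s) v r
        = (\<Sum>s\<in>I. if s = r then (if i = j then 2 else 0) * v r else 0)"
      unfolding apply_on_def
    proof (rule sum.cong [OF refl])
      fix s assume "s \<in> I"
      then have "mat_prod I (f j) (f i) r s + mat_prod I (f i) (f j) r s
          = (if j = i \<and> r = s then 2 else 0)"
        using f r unfolding clifford_on_def by blast
      then show "(mat_prod I (f j) (f i) r s + mat_prod I (f i) (f j) r s) * v s
          = (if s = r then (if i = j then 2 else 0) * v r else 0)"
        by auto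
    qed
    then show "apply_on I (\<lambda>r s. mat_prod I (f j) (f i) r s + mat_prod I (f i) (f j) r s) v r
        = (if i = j then 2 else 0) * v r"
      using r fin by simp
  qed simp
  finally have "?g i j + ?g j i = (if i = j then of_real (2 * normsq I v) else 0)"
    by (simp add: inner_on_scale_left inner_on_self)
  moreover have "Re (?g j i) = Re (?g i j)" by (subst inner_on_cnj [symmetric]) simp
  moreover have "Re (?g i j + ?g j i) = Re (?g i j) + Re (?g j i)" by simp
  ultimately show ?thesis by (auto split: if_splits)
qed

text \<open>The combination of the \<open>f j\<close> with coefficients \<open>x\<close> squares to
  |x|^2 times the identity, so it is a contraction. Hence a Clifford tuple passes every test by a
  point of the unit ball.\<close>

lemma clifford_on_quadratic_le:
  fixes x :: "real ^ 'd::finite"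
  assumes fin: "finite I" and f: "clifford_on I f" and x: "norm x \<le> 1"
  shows "Re (inner_on I (\<lambda>i. \<Sum>j\<in>UNIV. of_real (vec_nth x j) * apply_on I (f j) v i) v) \<le> normsq I v"
proof -
  let ?u = "\<lambda>i. \<Sum>j\<in>UNIV. complex_of_real (vec_nth x j) * apply_on I (f j) v i"
  have "of_real (normsq I ?u) = (\<Sum>j\<in>UNIV. \<Sum>i\<in>UNIV. of_real (vec_nth x i * vec_nth x j)
      * inner_on I (apply_on I (f i) v) (apply_on I (f j) v))"
    unfolding inner_on_self [symmetric] inner_on_sum_right inner_on_sum_left inner_on_scale_left
        inner_on_scale_right
      sum_distrib_left
    by (simp add: algebra_simps)
  then have "Re (of_real (normsq I ?u)) = (\<Sum>j\<in>UNIV. \<Sum>i\<in>UNIV. vec_nth x i * vec_nth x j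
      * Re (inner_on I (apply_on I (f i) v) (apply_on I (f j) v)))"
    by simp
  then have "normsq I ?u = (\<Sum>j\<in>UNIV. vec_nth x j * vec_nth x j * normsq I v)"
    by (simp add: clifford_on_inner [OF fin f] if_distrib [of "\<lambda>y. _ * y"] cong: if_cong)
  also have "\<dots> = (norm x)\<^sup>2 * normsq I v"
    by (simp add: power2_norm_eq_inner inner_vec_def sum_distrib_right)
  also have "\<dots> \<le> 1 * normsq I v"
    using x by (intro mult_right_mono) (auto simp: power_le_one)
  finally show ?thesis using Re_inner_on_le [of I ?u v] by simp
qed

text \<open>The left side is the form of the sum of F_j tensor its conjugate at the maximally
  entangled vector, whose squared norm is \<open>card I\<close>: the quotient \<open>d\<close> is
  what both optimality proofs exploit.\<close>

lemma clifford_on_trace: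
  fixes f :: "'d::finite \<Rightarrow> 'a \<Rightarrow> 'a \<Rightarrow> complex"
  assumes fin: "finite I" and f: "clifford_on I f"
  shows "(\<Sum>t\<in>I. \<Sum>s\<in>I. \<Sum>j\<in>UNIV. f j s t * cnj (f j s t)) = of_nat (CARD('d) * card I)"
proof -
  have herm: "herm_on I (f j)" for j using f by (simp add: clifford_on_def)
  have "mat_prod I (f j) (f j) s s = 1" if "s \<in> I" for j s
  proof -
    have "mat_prod I (f j) (f j) s s + mat_prod I (f j) (f j) s s = 2"
      using f that unfolding clifford_on_def by auto
    then show ?thesis by simp
  qed
  then have "(\<Sum>j\<in>UNIV. \<Sum>s\<in>I. mat_prod I (f j) (f j) s s) = of_nat (CARD('d) * card I)" by simp
  moreover have "(\<Sum>t\<in>I. \<Sum>s\<in>I. \<Sum>j\<in>UNIV. f j s t * cnj (f j s t))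
      = (\<Sum>j\<in>UNIV. \<Sum>t\<in>I. \<Sum>s\<in>I. f j s t * cnj (f j s t))"
    by (rule sum_rotate)
  moreover have "\<dots> = (\<Sum>j\<in>UNIV. \<Sum>s\<in>I. \<Sum>t\<in>I. f j s t * f j t s)"
  proof (rule sum.cong [OF refl])
    fix j
    have "(\<Sum>t\<in>I. \<Sum>s\<in>I. f j s t * cnj (f j s t)) = (\<Sum>s\<in>I. \<Sum>t\<in>I. f j s t * cnj (f j s t))"
      by (rule sum.swap)
    also have "\<dots> = (\<Sum>s\<in>I. \<Sum>t\<in>I. f j s t * f j t s)"
      by (intro sum.cong refl) (simp add: herm_on_cnj [OF herm])
    finally show "(\<Sum>t\<in>I. \<Sum>s\<in>I. f j s t * cnj (f j s t)) = (\<Sum>s\<in>I. \<Sum>t\<in>I. f j s t * f j t s)" .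
  qed
  ultimately show ?thesis by (simp add: mat_prod_def)
qed

section \<open>Point tuples and the maximally entangled vector\<close>

definition point_tuple :: "real ^ 'd \<Rightarrow> 'd \<Rightarrow> complex mat" where
  "point_tuple x = (\<lambda>j. mat 1 1 (\<lambda>_. complex_of_real (vec_nth x j)))"

lemma sa_tuples_point_tuple: "point_tuple x \<in> sa_tuples 1"
  by (simp add: sa_tuples_iff herm_on_iff point_tuple_def entries_def)

lemma first_level_iff: "x \<in> first_level S \<longleftrightarrow> point_tuple x \<in> S"
  by (simp add: first_level_def point_tuple_def)

lemma tens_point_tuple_left:
  "tens_form {..<1} J (\<lambda>j. entries (point_tuple x j)) X u
    = inner_on J (\<lambda>i. \<Sum>j\<in>UNIV. of_real (vec_nth x j) * apply_on J (X j) (\<lambda>s. u (0, s)) i)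
        (\<lambda>s. u (0, s))"
proof -
  have "apply_on ({..<1} \<times> J) (tens (\<lambda>j. entries (point_tuple x j)) X) u (0, r)
      = (\<Sum>j\<in>UNIV. of_real (vec_nth x j) * apply_on J (X j) (\<lambda>s. u (0, s)) r)" for r
    unfolding apply_on_def tens_def sum.cartesian_product' sum_distrib_left
    by (simp add: sum_distrib_right point_tuple_def entries_def mult.assoc) (rule sum.swap)
  then show ?thesis unfolding inner_on_def sum.cartesian_product' by simp
qed

lemma tens_point_tuple_right:
  "tens_form J {..<1} X (\<lambda>j. entries (point_tuple x j)) u
    = inner_on J (\<lambda>i. \<Sum>j\<in>UNIV. of_real (vec_nth x j) * apply_on J (X j) (\<lambda>s. u (s, 0)) i)
        (\<lambda>s. u (s, 0))"
proof -
  have "apply_on (J \<times> {..<1}) (tens X (\<lambda>j. entries (point_tuple x j))) u (r, 0)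
      = (\<Sum>j\<in>UNIV. of_real (vec_nth x j) * apply_on J (X j) (\<lambda>s. u (s, 0)) r)" for r
    unfolding apply_on_def tens_def sum.cartesian_product' sum_distrib_left
    by (simp add: sum_distrib_left sum_distrib_right point_tuple_def entries_def mult_ac)
        (rule sum.swap)
  then show ?thesis unfolding inner_on_def sum.cartesian_product' by simp
qed

lemma normsq_entangled: "normsq ({..<N} \<times> {..<N}) (\<lambda>p. basis_fun (snd p) (fst p)) = real N"
proof -
  have "normsq ({..<N} \<times> {..<N}) (\<lambda>p. basis_fun (snd p) (fst p))
      = (\<Sum>i<N. \<Sum>r<N. if r = i then 1 else 0)"
    unfolding normsq_def sum.cartesian_product' by (intro sum.cong refl) (simp add: basis_fun_def)
  then show ?thesis by simp
qed

text \<open>The pairing is bilinear, so a sum of squared moduli appears when one tuple is the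
  conjugate of the other.\<close>

lemma inner_tens_basis_fun:
  fixes A X :: "'d::finite \<Rightarrow> 'a \<Rightarrow> 'a \<Rightarrow> complex"
  assumes "finite I"
  shows "tens_form I I A X (\<lambda>p. basis_fun (snd p) (fst p))
    = (\<Sum>t\<in>I. \<Sum>s\<in>I. \<Sum>j\<in>UNIV. A j s t * X j s t)"
  unfolding inner_tens_entangled [OF assms]
  by (simp add: apply_basis_fun inner_basis_fun assms)

text \<open>The conclusion multiplies by \<open>c\<close> instead of dividing, because
  \<open>c\<close> may be 0.\<close>

lemma dilateE:
  assumes "X \<in> dilate c S" "X \<in> sa_tuples N" "S \<subseteq> sa_universe"
  obtains Y where "Y \<in> S" "Y \<in> sa_tuples N"
    "\<And>j r s. r < N \<Longrightarrow> s < N \<Longrightarrow> entries (X j) r s = of_real c * entries (Y j) r s"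
proof -
  obtain Y where Y: "Y \<in> S" "X = (\<lambda>j. complex_of_real c \<cdot>\<^sub>m Y j)" using assms(1)
    by (auto simp: dilate_def)
  then obtain n where n: "Y \<in> sa_tuples n" using assms(3) by (auto simp: sa_universe_def)
  then have "X \<in> sa_tuples n" unfolding Y(2) by (rule sa_tuples_scale)
  then have "n = N" using assms(2) by (rule sa_tuples_unique)
  with n have "Y \<in> sa_tuples N" by simp
  moreover from this have "entries (X j) r s = of_real c * entries (Y j) r s" if "r < N" "s < N"
    for j r s
    using that unfolding Y(2) by (intro entries_smult) (auto simp: sa_tuples_iff)
  ultimately show thesis using Y(1) by (intro that)
qed

text \<open>The largest matrix convex set with first level the ball contains the Clifford tuples.\<close>

lemma optimal_outer:
  assumes c: "0 \<le> c" "c < sqrt (real CARD('d))"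
  obtains S :: "('d::finite \<Rightarrow> complex mat) set" where
    "matrix_convex S" "first_level S \<subseteq> cball 0 1" "\<not> S \<subseteq> dilate c ball_D"
proof
  let ?S = "polar_dual (point_tuple ` cball 0 1) :: ('d \<Rightarrow> complex mat) set"
  show "matrix_convex ?S" by (rule matrix_convex_polar_dual)
  show "first_level ?S \<subseteq> cball 0 1"
  proof
    fix y assume "y \<in> first_level ?S"
    then have "point_tuple y \<in> ?S" by (simp add: first_level_iff)
    then obtain n where n: "point_tuple y \<in> sa_tuples n"
      and le: "\<And>m A u. 1 \<le> m \<Longrightarrow> A \<in> point_tuple ` cball 0 1 \<inter> sa_tuples m \<Longrightarrow>
          Re (tens_form {..<m} {..<n} (entries_tuple A) (\<lambda>j. entries (point_tuple y j)) u)
      \<le> normsq ({..<m} \<times> {..<n}) u"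
      unfolding mem_polar_dual_iff by blast
    have n1: "n = 1" using n sa_tuples_point_tuple by (rule sa_tuples_unique)
    \<comment> \<open>The sharpest test in the ball is the direction of \<open>y\<close>, where the
      inner product is the norm of \<open>y\<close>. For \<open>y = 0\<close> division by zero gives
      the zero vector.\<close>
    define x where "x = y /\<^sub>R norm y"
    have "norm x \<le> 1" unfolding x_def by (cases "y = 0") auto
    then have "point_tuple x \<in> point_tuple ` cball 0 1 \<inter> sa_tuples 1"
      by (intro IntI imageI sa_tuples_point_tuple) simp
    from le [OF order_refl this, of "\<lambda>_. 1", unfolded n1 tens_point_tuple_left]
    have "(\<Sum>j\<in>UNIV. vec_nth x j * vec_nth y j) \<le> 1"
      by (simp add: inner_on_def apply_on_def normsq_def point_tuple_def entries_def lessThan_Suc)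
    then have "x \<bullet> y \<le> 1" by (simp add: inner_vec_def)
    then have "norm y \<le> 1"
      unfolding x_def by (cases "y = 0")
          (simp_all add: inner_commute dot_square_norm power2_eq_square field_simps)
    then show "y \<in> cball 0 1" by simp
  qed
  show "\<not> ?S \<subseteq> dilate c ball_D"
  proof
    assume sub: "?S \<subseteq> dilate c ball_D"
    obtain N and F :: "'d \<Rightarrow> complex mat" where N: "1 \<le> N" and F: "F \<in> sa_tuples N"
      and cliff: "clifford_on {..<N} (entries_tuple F)" by (rule clifford_tuple_exists)
    have "F \<in> ?S"
      unfolding mem_polar_dual_iff
    proof (intro exI [of _ N] conjI allI impI ballI N F)
      fix m and A :: "'d \<Rightarrow> complex mat" and u :: "nat \<times> nat \<Rightarrow> complex"
      assume "A \<in> point_tuple ` cball 0 1 \<inter> sa_tuples m"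
      then obtain x where x: "A = point_tuple x" "norm x \<le> 1" and "A \<in> sa_tuples m" by auto
      then have m: "m = 1" using sa_tuples_unique sa_tuples_point_tuple by blast
      have "normsq ({..<1} \<times> {..<N}) u = normsq {..<N} (\<lambda>s. u (0, s))"
        unfolding normsq_def sum.cartesian_product' by simp
      then show "Re (tens_form {..<m} {..<N} (entries_tuple A) (entries_tuple F) u)
        \<le> normsq ({..<m} \<times> {..<N}) u"
        unfolding m x(1) tens_point_tuple_left using clifford_on_quadratic_le [OF _ cliff x(2)]
        by simp
    qed
    then have "F \<in> dilate c ball_D" using sub by blast
    moreover note F
    moreover have "ball_D \<subseteq> (sa_universe :: ('d \<Rightarrow> complex mat) set)"
      by (auto simp: ball_D_def sa_universe_def)
    ultimately obtain Y where "Y \<in> ball_D" and Y: "Y \<in> sa_tuples N"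
      and FY: "\<And>j r s. r < N \<Longrightarrow> s < N \<Longrightarrow> entries (F j) r s = of_real c * entries (Y j) r s"
      by (rule dilateE) blast
    \<comment> \<open>At the entangled vector the form for \<open>Y\<close> is at most
      \<open>N\<close>, as \<open>Y\<close> lies in \<open>ball_D\<close>. Multiplied by the square
      of \<open>c\<close> it becomes the form for \<open>F\<close>, which is \<open>d\<close> times
      \<open>N\<close>; so \<open>d\<close> is at most the square of \<open>c\<close>.\<close>
    let ?P = "{..<N} \<times> {..<N}" and ?w = "\<lambda>p :: nat \<times> nat. basis_fun (snd p) (fst p)"
    let ?T = "apply_on ?P (tens (entries_tuple Y) (\<lambda>j r s. cnj (entries (Y j) r s)))"
    have "normsq ?P (?T ?w) \<le> normsq ?P ?w"
      using \<open>Y \<in> ball_D\<close> Y sa_tuples_unique unfolding mem_ball_D_iff by blast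
    then have "Re (inner_on ?P (?T ?w) ?w) \<le> real N"
      using Re_inner_on_le [of ?P "?T ?w" ?w] by (simp add: normsq_entangled)
    then have "c\<^sup>2 * Re (inner_on ?P (?T ?w) ?w) \<le> c\<^sup>2 * real N" by (rule mult_left_mono) simp
    moreover have "of_real (c\<^sup>2) * inner_on ?P (?T ?w) ?w = of_nat (CARD('d) * N)"
    proof -
      have "of_real (c\<^sup>2) * inner_on ?P (?T ?w) ?w
          = (\<Sum>t<N. \<Sum>s<N. \<Sum>j\<in>UNIV. entries (F j) s t * cnj (entries (F j) s t))"
        unfolding inner_tens_basis_fun [OF finite_lessThan] sum_distrib_left
        by (intro sum.cong refl) (simp add: FY power2_eq_square)
      then show ?thesis using clifford_on_trace [OF _ cliff] by simp
    qed
    from arg_cong [OF this, of Re] have "c\<^sup>2 * Re (inner_on ?P (?T ?w) ?w) = real (CARD('d) * N)"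
      by (simp only: times_complex.sel Re_complex_of_real Im_complex_of_real complex_Re_of_nat
          mult_zero_left diff_zero)
    ultimately have "real CARD('d) \<le> c\<^sup>2" using N by simp
    moreover have "c\<^sup>2 < (sqrt (real CARD('d)))\<^sup>2" using c by (intro power_strict_mono) auto
    ultimately show False by simp
  qed
qed

text \<open>Dually, the free spectrahedron of a Clifford tuple has the ball as its first level and
  contains no large multiple of the conjugate tuple.\<close>

lemma optimal_inner:
  assumes c: "0 \<le> c" "c < sqrt (real CARD('d))"
  obtains S :: "('d::finite \<Rightarrow> complex mat) set" where
    "matrix_convex S" "cball 0 1 \<subseteq> first_level S" "\<not> ball_D \<subseteq> dilate c S"
proof -
  obtain N and F :: "'d \<Rightarrow> complex mat" where N: "1 \<le> N" and F: "F \<in> sa_tuples N"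
    and cliff: "clifford_on {..<N} (entries_tuple F)" by (rule clifford_tuple_exists)
  have Fc: "F j \<in> carrier_mat N N" for j using F by (simp add: sa_tuples_iff)
  \<comment> \<open>The set is tested by the conjugate tuple so that its pairing with
    \<open>F\<close> at the entangled vector is the sum of the squared moduli of the entries of
    \<open>F\<close>.\<close>
  let ?G = "\<lambda>j. mat_conj (F j)" and ?d = "sqrt (real CARD('d))"
  have G_ent: "entries (?G j) r s = cnj (entries (F j) r s)" if "r < N" "s < N" for j r s
    using that Fc by (intro entries_mat_conj)
  have G: "?G \<in> sa_tuples N"
    using F by (simp add: sa_tuples_iff mat_conj_carrier herm_on_iff G_ent)
  have "mat_prod {..<N} (entries (?G i)) (entries (?G j)) r s
      = mat_prod {..<N} (\<lambda>r s. cnj (entries (F i) r s)) (\<lambda>r s. cnj (entries (F j) r s)) r s"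
    if "r < N" "s < N" for i j r s
    unfolding mat_prod_def using that by (intro sum.cong refl) (simp add: G_ent)
  then have cliff_G: "clifford_on {..<N} (entries_tuple ?G)"
    using clifford_on_cnj [OF cliff] G by (simp add: clifford_on_def sa_tuples_iff)
  let ?S = "polar_dual {?G}"
  show thesis
  proof
    show "matrix_convex ?S" by (rule matrix_convex_polar_dual)
    show "cball 0 1 \<subseteq> first_level ?S"
    proof
      fix x :: "real ^ 'd" assume x: "x \<in> cball 0 1"
      show "x \<in> first_level ?S"
        unfolding first_level_iff mem_polar_dual_iff
      proof (intro exI [of _ 1] conjI allI impI ballI sa_tuples_point_tuple)
        fix m and A :: "'d \<Rightarrow> complex mat"
            and u :: "nat \<times> nat \<Rightarrow> complex" assume "A \<in> {?G} \<inter> sa_tuples m"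
        then have A: "A = ?G" and m: "m = N" using sa_tuples_unique [OF G] by auto
        have "normsq ({..<N} \<times> {..<1}) u = normsq {..<N} (\<lambda>s. u (s, 0))"
          unfolding normsq_def sum.cartesian_product' by simp
        then show "Re (tens_form {..<m} {..<1} (entries_tuple A) (\<lambda>j. entries (point_tuple x j)) u)
          \<le> normsq ({..<m} \<times> {..<1}) u"
          unfolding m A tens_point_tuple_right
          using clifford_on_quadratic_le [OF _ cliff_G, of x] x by simp
      qed simp
    qed
    show "\<not> ball_D \<subseteq> dilate c ?S"
    proof
      assume sub: "ball_D \<subseteq> dilate c ?S"
      \<comment> \<open>The squares of the \<open>F j\<close> sum to \<open>d\<close> times the
        identity, so this multiple of \<open>F\<close> lies on the boundary of
        \<open>ball_B\<close>, and thereby in \<open>ball_D\<close>.\<close>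
      let ?X = "\<lambda>j. complex_of_real (1 / ?d) \<cdot>\<^sub>m F j"
      have X: "?X \<in> sa_tuples N" by (rule sa_tuples_scale [OF F])
      have "column_contraction {..<N} (entries_tuple ?X)"
        unfolding column_contraction_def
      proof
        fix v
        have "normsq {..<N} (apply_on {..<N} (entries (?X j)) v) = normsq {..<N} v / real CARD('d)"
          for j
        proof -
          have "normsq {..<N} (apply_on {..<N} (entries (?X j)) v)
              = normsq {..<N} (\<lambda>i. complex_of_real (1 / ?d) * apply_on {..<N} (entries (F j)) v i)"
            using Fc by (intro normsq_cong) (simp add: apply_on_entries_smult [where n = N])
          also have "\<dots> = normsq {..<N} (apply_on {..<N} (entries (F j)) v) / real CARD('d)"
            unfolding normsq_scale by (simp add: norm_divide power_divide)
          also have "normsq {..<N} (apply_on {..<N} (entries (F j)) v) = normsq {..<N} v"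
            using clifford_on_inner [OF _ cliff, of j v j] by (simp add: inner_on_self)
          finally show ?thesis .
        qed
        then show "(\<Sum>j\<in>UNIV. normsq {..<N} (apply_on {..<N} (entries (?X j)) v)) \<le> normsq {..<N} v"
          by simp
      qed
      then have "?X \<in> ball_B" unfolding mem_ball_B_iff using N X by blast
      then have XS: "?X \<in> dilate c ?S" using ball_B_subset_ball_D sub by blast
      have "?S \<subseteq> sa_universe" by (auto simp: polar_dual_def sa_universe_def)
      with XS X obtain Y where "Y \<in> ?S" and Y: "Y \<in> sa_tuples N"
        and XY: "\<And>j r s. r < N \<Longrightarrow> s < N \<Longrightarrow> entries (?X j) r s = of_real c * entries (Y j) r s"
        by (rule dilateE) blast
      \<comment> \<open>Membership of \<open>Y\<close> in the polar gives
        \<open>Re ?q \<le> N\<close>, while \<open>c * ?q\<close> is the pairing of the conjugate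
        tuple with \<open>?X\<close>, that is \<open>sqrt d * N\<close>. So \<open>sqrt d\<close> is
        at most \<open>c\<close>.\<close>
      let ?P = "{..<N} \<times> {..<N}" and ?w = "\<lambda>p :: nat \<times> nat. basis_fun (snd p) (fst p)"
      let ?q = "inner_on ?P (apply_on ?P (tens (entries_tuple ?G) (entries_tuple Y)) ?w) ?w"
      have "Re ?q \<le> normsq ?P ?w"
      proof -
        obtain n where "Y \<in> sa_tuples n" and le: "\<forall>m\<ge>1. \<forall>A\<in>{?G} \<inter> sa_tuples m. \<forall>u.
            Re (tens_form {..<m} {..<n} (entries_tuple A) (entries_tuple Y) u)
            \<le> normsq ({..<m} \<times> {..<n}) u"
          using \<open>Y \<in> ?S\<close> unfolding mem_polar_dual_iff by blast
        then have "n = N" using Y sa_tuples_unique by blast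
        then show ?thesis using le N G by auto
      qed
      then have "c * Re ?q \<le> c * real N" using c
        by (intro mult_left_mono) (simp_all add: normsq_entangled)
      moreover have "of_real c * ?q = of_real (?d * real N)"
      proof -
        have "of_real c * ?q = (\<Sum>t<N. \<Sum>s<N. \<Sum>j\<in>UNIV. cnj (entries (F j) s t) * entries (?X j) s t)"
          unfolding inner_tens_basis_fun [OF finite_lessThan] sum_distrib_left
          by (intro sum.cong refl) (simp only: lessThan_iff G_ent XY mult.left_commute)
        also have "\<dots> = (\<Sum>t<N. \<Sum>s<N. \<Sum>j\<in>UNIV. of_real (1 / ?d)
            * (entries (F j) s t * cnj (entries (F j) s t)))"
          using Fc by (intro sum.cong refl) (simp add: entries_smult [where n = N])
        also have "\<dots> = of_real (1 / ?d) * of_nat (CARD('d) * N)"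
          using clifford_on_trace [OF _ cliff]
          by (simp only: sum_distrib_left [symmetric] finite_lessThan card_lessThan)
        also have "\<dots> = of_real (real CARD('d) / ?d * real N)" by simp
        also have "real CARD('d) / ?d = ?d" by (rule real_div_sqrt) simp
        finally show ?thesis .
      qed
      from arg_cong [OF this, of Re] have "c * Re ?q = ?d * real N"
        by (simp only: times_complex.sel Re_complex_of_real Im_complex_of_real mult_zero_left
            diff_zero)
      ultimately show False using c N by simp
    qed
  qed
qed

theorem theorem9p7:
  shows
    "(\<forall>S :: ('d::finite \<Rightarrow> complex mat) set. matrix_convex S \<longrightarrow>
        (first_level S \<subseteq> cball 0 1 \<longrightarrow>
           S \<subseteq> dilate (sqrt (real CARD('d))) ball_B \<and>
           dilate (sqrt (real CARD('d))) (ball_B :: ('d \<Rightarrow> complex mat) set)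
             \<subseteq> dilate (sqrt (real CARD('d))) ball_D) \<and>
        (cball 0 1 \<subseteq> first_level S \<longrightarrow>
           (ball_D :: ('d \<Rightarrow> complex mat) set) \<subseteq> polar_dual ball_B \<and>
           polar_dual ball_B \<subseteq> dilate (sqrt (real CARD('d))) S)) \<and>
     (\<forall>c :: real. 0 \<le> c \<and> c < sqrt (real CARD('d)) \<longrightarrow>
        \<not> (\<forall>S :: ('d \<Rightarrow> complex mat) set.
              matrix_convex S \<longrightarrow> first_level S \<subseteq> cball 0 1 \<longrightarrow> S \<subseteq> dilate c ball_B) \<and>
        \<not> (\<forall>S :: ('d \<Rightarrow> complex mat) set.
              matrix_convex S \<longrightarrow> first_level S \<subseteq> cball 0 1 \<longrightarrow> S \<subseteq> dilate c ball_D) \<and>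
        \<not> (\<forall>S :: ('d \<Rightarrow> complex mat) set.
              matrix_convex S \<longrightarrow> cball 0 1 \<subseteq> first_level S \<longrightarrow> polar_dual ball_B \<subseteq> dilate c S) \<and>
        \<not> (\<forall>S :: ('d \<Rightarrow> complex mat) set.
              matrix_convex S \<longrightarrow> cball 0 1 \<subseteq> first_level S \<longrightarrow> ball_D \<subseteq> dilate c S))"
proof (intro conjI allI impI)
  fix S :: "('d \<Rightarrow> complex mat) set"
  assume S: "matrix_convex S"
  show "S \<subseteq> dilate (sqrt (real CARD('d))) ball_B" if "first_level S \<subseteq> cball 0 1"
    using S that by (rule subset_dilate_ball_B)
  show "dilate (sqrt (real CARD('d))) (ball_B :: ('d \<Rightarrow> complex mat) set) \<subseteq> dilate
      (sqrt (real CARD('d))) ball_D"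
    unfolding dilate_def by (rule image_mono [OF ball_B_subset_ball_D])
  show "(ball_D :: ('d \<Rightarrow> complex mat) set) \<subseteq> polar_dual ball_B" by (rule ball_D_subset_polar_dual)
  show "polar_dual ball_B \<subseteq> dilate (sqrt (real CARD('d))) S" if "cball 0 1 \<subseteq> first_level S"
    using S that by (rule polar_dual_ball_B_subset_dilate)
next
  fix c :: real assume "0 \<le> c \<and> c < sqrt (real CARD('d))"
  then have c: "0 \<le> c" "c < sqrt (real CARD('d))" by auto
  obtain S :: "('d \<Rightarrow> complex mat) set" where
    S: "matrix_convex S" "first_level S \<subseteq> cball 0 1" "\<not> S \<subseteq> dilate c ball_D"
    by (rule optimal_outer [OF c])
  have "dilate c (ball_B :: ('d \<Rightarrow> complex mat) set) \<subseteq> dilate c ball_D"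
    unfolding dilate_def by (rule image_mono [OF ball_B_subset_ball_D])
  with S show "\<not> (\<forall>S :: ('d \<Rightarrow> complex mat) set.
      matrix_convex S \<longrightarrow> first_level S \<subseteq> cball 0 1 \<longrightarrow> S \<subseteq> dilate c ball_B)"
    by blast
  from S show "\<not> (\<forall>S :: ('d \<Rightarrow> complex mat) set.
      matrix_convex S \<longrightarrow> first_level S \<subseteq> cball 0 1 \<longrightarrow> S \<subseteq> dilate c ball_D)"
    by blast
  obtain S' :: "('d \<Rightarrow> complex mat) set" where
    S': "matrix_convex S'" "cball 0 1 \<subseteq> first_level S'" "\<not> ball_D \<subseteq> dilate c S'"
    by (rule optimal_inner [OF c])
  then show "\<not> (\<forall>S :: ('d \<Rightarrow> complex mat) set.
      matrix_convex S \<longrightarrow> cball 0 1 \<subseteq> first_level S \<longrightarrow> polar_dual ball_B \<subseteq> dilate c S)"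
    using ball_D_subset_polar_dual by blast
  from S' show "\<not> (\<forall>S :: ('d \<Rightarrow> complex mat) set.
      matrix_convex S \<longrightarrow> cball 0 1 \<subseteq> first_level S \<longrightarrow> ball_D \<subseteq> dilate c S)"
    by blast
qed

end
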